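(* Let $\Sigma$ be a simplicial fan in a lattice $N$, let $X$ be the associated toric variety, and let $\Psi$ be a complement map on $N$ such that $\Sigma$ is $\Psi$-generic. Then the cycle-level action of $\mathrm{Div}_T(X)$ on $Z_*^T(X)$ attached to $\Psi$ induces a commutative ring structure on $Z^T_*(X)$ (with identity $V_{\{0\}}$, and in which multiplication by $V_\rho$, for $\rho$ a ray of $\Sigma$, is the action of the $\mathbb Q$-Cartier divisor whose Weil divisor is $V(\rho)$). This product is a lifting of the product on the equivariant cohomology ring $A_T^*(X)_{\mathbb Q}$: the natural surjection $Z_*^T(X)\to A_T^*(X)_{\mathbb Q}$ is a ring homomorphism. Furthermore, let $\rho_1,\dots,\rho_s$ be the one-dimensional cones of $\Sigma$, let $D_i=V_{\rho_i}\in Z_*^T(X)$, and let $n_i$ be the primitive element of $N\cap\rho_i$. Then $$Z_*^T(X)\cong\frac{\Lambda_{\mathbb Q}[D_1,\dots,D_s]}{I+J^\Psi},$$ where $I$ is the Stanley–Reisner ideal $$I=\langle D_{i_1}D_{i_2}\cdots D_{i_k}:\ \rho_{i_1}+\rho_{i_2}+\cdots+\rho_{i_k}\notin\Sigma\rangle$$ and $$J^\Psi=\Bigl\langle D_{i_1}D_{i_2}\cdots D_{i_k}\Bigl(\sum_{j=1}^s\langle m,n_j\rangle D_j-m\Bigr):\ \rho_{i_1}+\rho_{i_2}+\cdots+\rho_{i_k}=\sigma\in\Sigma,\ m\in\Psi(\sigma)\Bigr\rangle .$$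
   Context: Setting. $N$ is a lattice, $M=\mathrm{Hom}(N,\mathbb Z)$, $\langle\ ,\ \rangle$ is the natural pairing, and a subscript $\mathbb Q$ denotes $\otimes\,\mathbb Q$. $\Lambda=\mathbb Z[M]$ denotes the polynomial ring (symmetric algebra) on $M$, not the group ring, so $\Lambda_{\mathbb Q}=\mathrm{Sym}_{\mathbb Q}(M_{\mathbb Q})$. Cones are rational, strongly convex polyhedral cones, and fans are finite. For a cone $\sigma$, $N_\sigma=N\cap\mathrm{span}(\sigma)$, $N(\sigma)=N/N_\sigma$, $M(\sigma)=M\cap\sigma^\perp$ and $M_\sigma=M/M(\sigma)=\mathrm{Hom}(N_\sigma,\mathbb Z)$. We write $\tau\to\sigma$ if $\sigma$ is a codimension one face of $\tau$; then $n_{\tau,\sigma}\in N(\sigma)$ is the primitive generator of the image of $\tau$ in $N(\sigma)$. $V(\sigma)\subset X$ is the torus-invariant subvariety of $\sigma\in\Sigma$. Cycles and divisors. $Z_*(X)$ is the free abelian group on $\{V(\sigma):\sigma\in\Sigma\}$; $Z_*^T(X)=Z_*(X)\otimes\Lambda_{\mathbb Q}$, and $V_\sigma$ is $V(\sigma)$ viewed in $Z^T_*(X)$. $\mathrm{Div}(X)$ is the group of $T$-invariant $\mathbb Q$-Cartier divisors; such a divisor is a collection of local equations $d_\sigma\in M_{\sigma,\mathbb Q}$ ($\sigma\in\Sigma$), with $d_\tau\mapsto d_\sigma$ under $M_{\tau,\mathbb Q}\to M_{\sigma,\mathbb Q}$ whenever $\sigma\subset\tau$. $\mathrm{Div}_T(X)=\mathrm{Div}(X)\otimes_{\mathbb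 Q}\Lambda_{\mathbb Q}$. The Weil divisor of $D$ is $\sum_i\langle d_{\rho_i},n_i\rangle V(\rho_i)$. Since $\Sigma$ is simplicial, $D\mapsto$ (Weil divisor of $D$) identifies $\mathrm{Div}(X)$ with the rational span of the $V(\rho_i)$. Complement maps. Let $\mathcal L$ be a set of $\mathbb Q$-subspaces of $N_{\mathbb Q}$ containing $N_{\mathbb Q}$. A complement map $\Psi$ assigns to each pair $L_1\subset L_2$ in $\mathcal L$ a linear section $i^\Psi:L_1^*\to L_2^*$ of the restriction map $L_2^*\to L_1^*$, transitively with respect to chains $L_1\subset L_2\subset L_3$. A fan $\Sigma$ is $\Psi$-generic if $N_{\sigma,\mathbb Q}\in\mathcal L$ for all $\sigma\in\Sigma$. For $d\in M_{\sigma,\mathbb Q}$, $d^\Psi\in M_{\mathbb Q}$ is the image of $d$ under $i^\Psi:M_{\sigma,\mathbb Q}\to M_{\mathbb Q}$, and $\Psi(\sigma)=i^\Psi(M_{\sigma,\mathbb Q})\subset M_{\mathbb Q}$. Action. The cycle-level action attached to $\Psi$ is the $\Lambda_{\mathbb Q}$-bilinear map $\mathrm{Div}_T(X)\times Z_*^T(X)\to Z_*^T(X)$ given for $D\in\mathrm{Div}(X)$ with local equations $\{d_\sigma\}$ by $$D\cdot V_\sigma=\sum_{\tau\to\sigma}\langle d_\tau-d_\sigma^\Psi,n_{\tau,\sigma}\rangle V_\tau+d_\sigma^\Psi V_\sigma,$$ where $d_\tau-d_\sigma^\Psi$ is regarded as an element of $M(\sigma)_{\mathbb Q}$ modulo $M(\tau)_{\mathbb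 Q}$. Equivariant cohomology. For simplicial $X$, $A_T^*(X)_{\mathbb Q}$ is the rational equivariant Chow cohomology ring, presented as $\Lambda_{\mathbb Q}[D_1,\dots,D_s]/(I+J')$, where $J'$ is defined like $J^\Psi$ but allowing all $m\in M_{\mathbb Q}$ (the case $\sigma=\{0\}$, with empty product $1$, being included). The natural surjection $Z_*^T(X)\to A_T^*(X)_{\mathbb Q}$ is $\Lambda_{\mathbb Q}$-linear and sends $V_\sigma$ to the class of $V(\sigma)$, which for $\sigma=\rho_{i_1}+\dots+\rho_{i_k}$ of dimension $k$ is $[N_\sigma:\mathbb Z n_{i_1}+\cdots+\mathbb Z n_{i_k}]\cdot D_{i_1}\cdots D_{i_k}$. *)

theory Defs
  imports
    Complex_Main
    "HOL-Library.Poly_Mapping"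
    "HOL-Library.Set_Algebras"
    "HOL-Algebra.Module"
    "HOL-Algebra.QuotRing"
begin

text \<open>
  As for Euclidean spaces in HOL-Analysis, a basis is part of the class: a lattice \<open>N\<close> is given by a type
  whose universe is \<open>N\<^sub>\<rat>\<close>, together with a finite \<open>\<rat>\<close>-basis \<open>LBasis\<close> whose integral span
  \<open>int_points\<close> is \<open>N\<close>.  The basis may be empty (lattice of rank 0).
\<close>

class rat_lattice = ab_group_add +
  fixes scaleQ :: "rat \<Rightarrow> 'a \<Rightarrow> 'a"  (infixr "*\<^sub>Q" 75)
    and LBasis :: "'a set"
  assumes scaleQ_right_distrib: "a *\<^sub>Q (x + y) = a *\<^sub>Q x + a *\<^sub>Q y"
    and scaleQ_left_distrib: "(a + b) *\<^sub>Q x = a *\<^sub>Q x + b *\<^sub>Q x"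
    and scaleQ_scaleQ: "a *\<^sub>Q b *\<^sub>Q x = (a * b) *\<^sub>Q x"
    and scaleQ_one: "1 *\<^sub>Q x = x"
    and finite_LBasis: "finite LBasis"
    and LBasis_expansion:
      "\<exists>!c. (\<forall>b. b \<notin> LBasis \<longrightarrow> c b = 0) \<and> x = (\<Sum>b\<in>LBasis. c b *\<^sub>Q b)"

interpretation Q: vector_space "scaleQ :: rat \<Rightarrow> 'v::rat_lattice \<Rightarrow> 'v"
  by unfold_locales
    (simp_all add: scaleQ_right_distrib scaleQ_left_distrib scaleQ_scaleQ scaleQ_one)

interpretation Q: finite_dimensional_vector_space
  "scaleQ :: rat \<Rightarrow> 'v::rat_lattice \<Rightarrow> 'v" "LBasis :: 'v set"
proof
  show "finite (LBasis :: 'v set)"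
    by (rule finite_LBasis)
  show "Q.independent (LBasis :: 'v set)"
  proof (rule Q.independent_if_scalars_zero[OF finite_LBasis])
    fix f :: "'v \<Rightarrow> rat" and b :: 'v
    assume 0: "(\<Sum>x\<in>LBasis. f x *\<^sub>Q x) = 0" and b: "b \<in> LBasis"
    have "(\<lambda>x. if x \<in> LBasis then f x else 0) = (\<lambda>_. 0)"
      by (rule Uniq_D[OF conjunct2[OF iffD1[OF ex1_iff_ex_Uniq LBasis_expansion[of "0 :: 'v"]]]])
        (use 0 in simp_all)
    with b show "f b = 0" by (auto dest: fun_cong[of _ _ b])
  qed
  show "Q.span (LBasis :: 'v set) = UNIV"
  proof -
    have "x \<in> Q.span LBasis" for x :: 'v
    proof -
      obtain c where "x = (\<Sum>b\<in>LBasis. c b *\<^sub>Q b)"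
        using ex1_implies_ex[OF LBasis_expansion[of x]] by (elim exE conjE)
      then show ?thesis
        by (simp add: Q.span_sum Q.span_scale Q.span_base)
    qed
    then show ?thesis by auto
  qed
qed

definition int_span :: "'v::rat_lattice set \<Rightarrow> 'v set" where
  "int_span S = {\<Sum>v\<in>S. of_int (c v) *\<^sub>Q v | c :: 'v \<Rightarrow> int. True}"

definition int_points :: "'v::rat_lattice set" where
  "int_points = int_span LBasis"

text \<open>
  The dual \<open>L\<^sup>*\<close> of a subspace \<open>L\<close>: linear functionals on \<open>L\<close>, extended by \<open>0\<close> outside \<open>L\<close> so that
  each functional is represented by exactly one function.  In particular \<open>M\<^sub>\<rat>\<close> is \<open>dual UNIV\<close> and
  \<open>M\<^bsub>\<sigma>,\<rat>\<^esub>\<close> is \<open>dual (Q.span \<sigma>)\<close>.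
\<close>

definition dual :: "'v::rat_lattice set \<Rightarrow> ('v \<Rightarrow> rat) set" where
  "dual L = {f. (\<forall>x\<in>L. \<forall>y\<in>L. f (x + y) = f x + f y) \<and>
                (\<forall>c. \<forall>x\<in>L. f (c *\<^sub>Q x) = c * f x) \<and>
                (\<forall>x. x \<notin> L \<longrightarrow> f x = 0)}"

definition restr :: "'v set \<Rightarrow> ('v \<Rightarrow> rat) \<Rightarrow> ('v \<Rightarrow> rat)" where
  "restr L f = (\<lambda>x. if x \<in> L then f x else 0)"

text \<open>
  Cones are taken in \<open>N\<^sub>\<rat>\<close>; rational polyhedral cones in \<open>N\<^sub>\<real>\<close> correspond to them by
  \<open>\<sigma> \<mapsto> \<sigma> \<inter> N\<^sub>\<rat>\<close>.
\<close>

definition cone_hull :: "'v::rat_lattice set \<Rightarrow> 'v set" where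
  "cone_hull S = {\<Sum>v\<in>S. c v *\<^sub>Q v | c :: 'v \<Rightarrow> rat. \<forall>v\<in>S. 0 \<le> c v}"

definition is_cone :: "'v::rat_lattice set \<Rightarrow> bool" where
  "is_cone \<sigma> \<longleftrightarrow> (\<exists>S. finite S \<and> \<sigma> = cone_hull S) \<and> (\<forall>v. v \<in> \<sigma> \<and> - v \<in> \<sigma> \<longrightarrow> v = 0)"

definition cone_face :: "'v::rat_lattice set \<Rightarrow> 'v set \<Rightarrow> bool" where
  "cone_face \<sigma> \<tau> \<longleftrightarrow> (\<exists>m\<in>dual UNIV. (\<forall>v\<in>\<tau>. 0 \<le> m v) \<and> \<sigma> = {v\<in>\<tau>. m v = 0})"

definition fan :: "'v::rat_lattice set set \<Rightarrow> bool" where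
  "fan \<Sigma> \<longleftrightarrow> finite \<Sigma> \<and> \<Sigma> \<noteq> {} \<and> (\<forall>\<sigma>\<in>\<Sigma>. is_cone \<sigma>) \<and>
     (\<forall>\<tau>\<in>\<Sigma>. \<forall>\<sigma>. cone_face \<sigma> \<tau> \<longrightarrow> \<sigma> \<in> \<Sigma>) \<and>
     (\<forall>\<sigma>\<in>\<Sigma>. \<forall>\<tau>\<in>\<Sigma>. cone_face (\<sigma> \<inter> \<tau>) \<sigma> \<and> cone_face (\<sigma> \<inter> \<tau>) \<tau>)"

definition simplicial_fan :: "'v::rat_lattice set set \<Rightarrow> bool" where
  "simplicial_fan \<Sigma> \<longleftrightarrow> fan \<Sigma> \<and>
     (\<forall>\<sigma>\<in>\<Sigma>. \<exists>S. finite S \<and> Q.independent S \<and> \<sigma> = cone_hull S)"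

definition rays :: "'v::rat_lattice set set \<Rightarrow> 'v set set" where
  "rays \<Sigma> = {\<rho>\<in>\<Sigma>. Q.dim \<rho> = 1}"

definition rays_of :: "'v::rat_lattice set set \<Rightarrow> 'v set \<Rightarrow> 'v set set" where
  "rays_of \<Sigma> \<sigma> = {\<rho>\<in>rays \<Sigma>. cone_face \<rho> \<sigma>}"

text \<open>The relation \<open>\<tau> \<rightarrow> \<sigma>\<close>.\<close>

definition covers :: "'v::rat_lattice set \<Rightarrow> 'v set \<Rightarrow> bool" where
  "covers \<tau> \<sigma> \<longleftrightarrow> cone_face \<sigma> \<tau> \<and> Q.dim \<tau> = Q.dim \<sigma> + 1"

text \<open>
  \<open>n\<close> maps to a primitive element of \<open>N / (N \<inter> L)\<close>; the instance \<open>k = 0\<close> excludes \<open>n \<in> L\<close>.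
\<close>

definition primitive_mod :: "'v::rat_lattice set \<Rightarrow> 'v \<Rightarrow> bool" where
  "primitive_mod L n \<longleftrightarrow> n \<in> int_points \<and>
     (\<forall>k :: int. \<forall>n'\<in>int_points. n - of_int k *\<^sub>Q n' \<in> L \<longrightarrow> \<bar>k\<bar> = 1)"

definition ray_gen :: "'v::rat_lattice set \<Rightarrow> 'v" where
  "ray_gen \<rho> = (THE n. n \<in> \<rho> \<and> primitive_mod {0} n)"

text \<open>
  A representative in \<open>N\<close> of \<open>n\<^bsub>\<tau>,\<sigma>\<^esub> \<in> N(\<sigma>) = N / N\<^sub>\<sigma>\<close>.  It lies in \<open>\<tau> + span \<sigma>\<close> since \<open>n\<^bsub>\<tau>,\<sigma>\<^esub>\<close>
  lies in the image of \<open>\<tau>\<close>.  The choice is immaterial, as it is only paired with functionals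
  vanishing on \<open>\<sigma>\<close>.
\<close>

definition normal_rep :: "'v::rat_lattice set \<Rightarrow> 'v set \<Rightarrow> 'v" where
  "normal_rep \<tau> \<sigma> = (SOME n. n \<in> \<tau> + Q.span \<sigma> \<and> primitive_mod (Q.span \<sigma>) n)"

text \<open>The index \<open>[N\<^sub>\<sigma> : \<int> n\<^bsub>i\<^sub>1\<^esub> + \<dots> + \<int> n\<^bsub>i\<^sub>k\<^esub>]\<close>.\<close>

definition cone_mult :: "'v::rat_lattice set set \<Rightarrow> 'v set \<Rightarrow> nat" where
  "cone_mult \<Sigma> \<sigma> =
     card (rcosets\<^bsub>\<lparr>carrier = int_points \<inter> Q.span \<sigma>, mult = (+), one = 0\<rparr>\<^esub>
             (int_span (ray_gen ` rays_of \<Sigma> \<sigma>)))"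

definition complement_map ::
  "'v::rat_lattice set set \<Rightarrow> ('v set \<Rightarrow> 'v set \<Rightarrow> ('v \<Rightarrow> rat) \<Rightarrow> ('v \<Rightarrow> rat)) \<Rightarrow> bool" where
  "complement_map \<L> \<Psi> \<longleftrightarrow>
     (\<forall>L\<in>\<L>. Q.subspace L) \<and> UNIV \<in> \<L> \<and>
     (\<forall>L1\<in>\<L>. \<forall>L2\<in>\<L>. L1 \<subseteq> L2 \<longrightarrow>
        (\<forall>f\<in>dual L1. \<Psi> L1 L2 f \<in> dual L2 \<and> restr L1 (\<Psi> L1 L2 f) = f) \<and>
        (\<forall>f\<in>dual L1. \<forall>g\<in>dual L1.
           \<Psi> L1 L2 (\<lambda>x. f x + g x) = (\<lambda>x. \<Psi> L1 L2 f x + \<Psi> L1 L2 g x)) \<and>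
        (\<forall>c. \<forall>f\<in>dual L1. \<Psi> L1 L2 (\<lambda>x. c * f x) = (\<lambda>x. c * \<Psi> L1 L2 f x))) \<and>
     (\<forall>L1\<in>\<L>. \<forall>L2\<in>\<L>. \<forall>L3\<in>\<L>. L1 \<subseteq> L2 \<and> L2 \<subseteq> L3 \<longrightarrow>
        (\<forall>f\<in>dual L1. \<Psi> L2 L3 (\<Psi> L1 L2 f) = \<Psi> L1 L3 f))"

definition generic_fan :: "'v::rat_lattice set set \<Rightarrow> 'v set set \<Rightarrow> bool" where
  "generic_fan \<L> \<Sigma> \<longleftrightarrow> (\<forall>\<sigma>\<in>\<Sigma>. Q.span \<sigma> \<in> \<L>)"

definition Psi_space ::
  "('v::rat_lattice set \<Rightarrow> 'v set \<Rightarrow> ('v \<Rightarrow> rat) \<Rightarrow> ('v \<Rightarrow> rat)) \<Rightarrow> 'v set \<Rightarrow> ('v \<Rightarrow> rat) set" where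
  "Psi_space \<Psi> \<sigma> = \<Psi> (Q.span \<sigma>) UNIV ` dual (Q.span \<sigma>)"

text \<open>
  \<open>poly_ring A X\<close> is the ring of polynomials with coefficients in the subring \<open>A\<close> of the coefficient
  type, in the variables indexed by \<open>X\<close>.
\<close>

definition poly_ring ::
  "'a::comm_ring_1 set \<Rightarrow> 'x set \<Rightarrow> (('x \<Rightarrow>\<^sub>0 nat) \<Rightarrow>\<^sub>0 'a) ring" where
  "poly_ring A X =
     \<lparr>carrier = {p. \<forall>t\<in>Poly_Mapping.keys p. Poly_Mapping.keys t \<subseteq> X \<and> Poly_Mapping.lookup p t \<in> A},
      mult = (*), one = 1, zero = 0, add = (+)\<rparr>"

definition Cst :: "'a::comm_ring_1 \<Rightarrow> (('x \<Rightarrow>\<^sub>0 nat) \<Rightarrow>\<^sub>0 'a)" where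
  "Cst a = Poly_Mapping.single 0 a"

definition Var :: "'x \<Rightarrow> (('x \<Rightarrow>\<^sub>0 nat) \<Rightarrow>\<^sub>0 'a::comm_ring_1)" where
  "Var x = Poly_Mapping.single (Poly_Mapping.single x 1) 1"

text \<open>
  \<open>\<Lambda>\<^sub>\<rat> = Sym M\<^sub>\<rat>\<close> is the polynomial ring over \<open>\<rat>\<close> on the basis of \<open>M\<close> dual to \<open>LBasis\<close>: the
  variable \<open>Var b\<close> is the functional dual to \<open>b\<close>, and \<open>Lam_lin m\<close> is \<open>m \<in> M\<^sub>\<rat>\<close> as an element of \<open>\<Lambda>\<^sub>\<rat>\<close>.
\<close>

type_synonym 'v lam = "('v \<Rightarrow>\<^sub>0 nat) \<Rightarrow>\<^sub>0 rat"

definition Lam :: "'v::rat_lattice lam ring" where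
  "Lam = poly_ring UNIV LBasis"

definition Lam_lin :: "('v::rat_lattice \<Rightarrow> rat) \<Rightarrow> 'v lam" where
  "Lam_lin m = (\<Sum>b\<in>LBasis. Cst (m b) * Var b)"

text \<open>
  \<open>Z\<^sub>*\<^sup>T(X)\<close> is the free \<open>\<Lambda>\<^sub>\<rat>\<close>-module on the cones of \<open>\<Sigma>\<close>, with basis elements \<open>V \<sigma>\<close>.
\<close>

type_synonym 'v cyc = "'v set \<Rightarrow>\<^sub>0 'v lam"

definition V :: "'v set \<Rightarrow> 'v::rat_lattice cyc" where
  "V \<sigma> = Poly_Mapping.single \<sigma> 1"

definition smul :: "'v::rat_lattice lam \<Rightarrow> 'v cyc \<Rightarrow> 'v cyc" where
  "smul l z = Poly_Mapping.map (\<lambda>a. l * a) z"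

definition cycles :: "'v::rat_lattice set set \<Rightarrow> 'v cyc set" where
  "cycles \<Sigma> = {z. \<forall>\<sigma>\<in>Poly_Mapping.keys z. \<sigma> \<in> \<Sigma> \<and> Poly_Mapping.lookup z \<sigma> \<in> carrier Lam}"

text \<open>
  \<open>Div(X)\<close>: families of local equations, normalized to \<open>0\<close> outside \<open>\<Sigma>\<close>.
\<close>

type_synonym 'v divisor = "'v set \<Rightarrow> 'v \<Rightarrow> rat"

definition Div :: "'v::rat_lattice set set \<Rightarrow> 'v divisor set" where
  "Div \<Sigma> = {d. (\<forall>\<sigma>\<in>\<Sigma>. d \<sigma> \<in> dual (Q.span \<sigma>)) \<and>
               (\<forall>\<sigma>\<in>\<Sigma>. \<forall>\<tau>\<in>\<Sigma>. \<sigma> \<subseteq> \<tau> \<longrightarrow> restr (Q.span \<sigma>) (d \<tau>) = d \<sigma>) \<and>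
               (\<forall>\<sigma>. \<sigma> \<notin> \<Sigma> \<longrightarrow> d \<sigma> = (\<lambda>_. 0))}"

definition weil :: "'v::rat_lattice set set \<Rightarrow> 'v divisor \<Rightarrow> 'v cyc" where
  "weil \<Sigma> d = (\<Sum>\<rho>\<in>rays \<Sigma>. smul (Cst (d \<rho> (ray_gen \<rho>))) (V \<rho>))"

definition act ::
  "('v::rat_lattice set \<Rightarrow> 'v set \<Rightarrow> ('v \<Rightarrow> rat) \<Rightarrow> ('v \<Rightarrow> rat)) \<Rightarrow> 'v set set \<Rightarrow>
   'v divisor \<Rightarrow> 'v cyc \<Rightarrow> 'v cyc" where
  "act \<Psi> \<Sigma> d z =
     (\<Sum>\<sigma>\<in>\<Sigma>. smul (Poly_Mapping.lookup z \<sigma>)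
        (let m = \<Psi> (Q.span \<sigma>) UNIV (d \<sigma>) in
          (\<Sum>\<tau> | \<tau> \<in> \<Sigma> \<and> covers \<tau> \<sigma>.
             let n = normal_rep \<tau> \<sigma> in smul (Cst (d \<tau> n - m n)) (V \<tau>))
          + smul (Lam_lin m) (V \<sigma>)))"

text \<open>
  An element of \<open>Div\<^sub>T(X) = Div(X) \<otimes>\<^sub>\<rat> \<Lambda>\<^sub>\<rat>\<close> is represented by a finite formal sum
  \<open>\<Sum> D\<^sub>k \<otimes> l\<^sub>k\<close>, that is, a finitely supported function from divisors to \<open>\<Lambda>\<^sub>\<rat>\<close>.  The maps
  \<open>weilT\<close> and \<open>actT\<close> only depend on the element represented, as \<open>weil\<close> and \<open>act\<close> are linear
  over the rationals in the divisor.
\<close>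

definition DivT :: "'v::rat_lattice set set \<Rightarrow> ('v divisor \<Rightarrow>\<^sub>0 'v lam) set" where
  "DivT \<Sigma> = {E. \<forall>d\<in>Poly_Mapping.keys E. d \<in> Div \<Sigma> \<and> Poly_Mapping.lookup E d \<in> carrier Lam}"

definition weilT :: "'v::rat_lattice set set \<Rightarrow> ('v divisor \<Rightarrow>\<^sub>0 'v lam) \<Rightarrow> 'v cyc" where
  "weilT \<Sigma> E = (\<Sum>d\<in>Poly_Mapping.keys E. smul (Poly_Mapping.lookup E d) (weil \<Sigma> d))"

definition actT ::
  "('v::rat_lattice set \<Rightarrow> 'v set \<Rightarrow> ('v \<Rightarrow> rat) \<Rightarrow> ('v \<Rightarrow> rat)) \<Rightarrow> 'v set set \<Rightarrow>
   ('v divisor \<Rightarrow>\<^sub>0 'v lam) \<Rightarrow> 'v cyc \<Rightarrow> 'v cyc" where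
  "actT \<Psi> \<Sigma> E z = (\<Sum>d\<in>Poly_Mapping.keys E. smul (Poly_Mapping.lookup E d) (act \<Psi> \<Sigma> d z))"

definition cycle_ring ::
  "'v::rat_lattice set set \<Rightarrow> ('v cyc \<Rightarrow> 'v cyc \<Rightarrow> 'v cyc) \<Rightarrow> ('v lam, 'v cyc) module" where
  "cycle_ring \<Sigma> f =
     \<lparr>carrier = cycles \<Sigma>, mult = f, one = V {0}, zero = 0, add = (+), smult = smul\<rparr>"

text \<open>
  The multiplication \<open>f\<close> on \<open>Z\<^sub>*\<^sup>T(X)\<close> is induced by the action: it makes \<open>Z\<^sub>*\<^sup>T(X)\<close> a commutative
  \<open>\<Lambda>\<^sub>\<rat>\<close>-algebra with identity \<open>V {0}\<close>, in which multiplication by (the Weil divisor of) an element of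
  \<open>Div\<^sub>T(X)\<close> is the action of that element.
\<close>

definition induced_product ::
  "('v::rat_lattice set \<Rightarrow> 'v set \<Rightarrow> ('v \<Rightarrow> rat) \<Rightarrow> ('v \<Rightarrow> rat)) \<Rightarrow> 'v set set \<Rightarrow>
   ('v cyc \<Rightarrow> 'v cyc \<Rightarrow> 'v cyc) \<Rightarrow> bool" where
  "induced_product \<Psi> \<Sigma> f \<longleftrightarrow>
     algebra Lam (cycle_ring \<Sigma> f) \<and>
     (\<forall>E\<in>DivT \<Sigma>. \<forall>z\<in>cycles \<Sigma>. f (weilT \<Sigma> E) z = actT \<Psi> \<Sigma> E z) \<and>
     (\<forall>\<rho>\<in>rays \<Sigma>. \<exists>d\<in>Div \<Sigma>. weil \<Sigma> d = V \<rho> \<and> (\<forall>z\<in>cycles \<Sigma>. f (V \<rho>) z = act \<Psi> \<Sigma> d z))"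

text \<open>The ring \<open>\<Lambda>\<^sub>\<rat>[D\<^sub>1, \<dots>, D\<^sub>s]\<close>, the variable \<open>D\<^sub>i\<close> being indexed by the ray \<open>\<rho>\<^sub>i\<close> itself.\<close>

type_synonym 'v dpoly = "('v set \<Rightarrow>\<^sub>0 nat) \<Rightarrow>\<^sub>0 'v lam"

definition D_ring :: "'v::rat_lattice set set \<Rightarrow> 'v dpoly ring" where
  "D_ring \<Sigma> = poly_ring (carrier Lam) (rays \<Sigma>)"

text \<open>
  In the next two definitions \<open>\<Sum>\<rho>\<in>S. \<rho>\<close> is the Minkowski sum of the rays in \<open>S\<close> (which is \<open>{0}\<close>
  for \<open>S = {}\<close>).
\<close>

definition SR_ideal :: "'v::rat_lattice set set \<Rightarrow> 'v dpoly set" where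
  "SR_ideal \<Sigma> =
     genideal (D_ring \<Sigma>) {\<Prod>\<rho>\<in>S. Var \<rho> | S. S \<subseteq> rays \<Sigma> \<and> (\<Sum>\<rho>\<in>S. \<rho>) \<notin> \<Sigma>}"

definition J_ideal ::
  "('v::rat_lattice set \<Rightarrow> ('v \<Rightarrow> rat) set) \<Rightarrow> 'v set set \<Rightarrow> 'v dpoly set" where
  "J_ideal P \<Sigma> =
     genideal (D_ring \<Sigma>)
       {(\<Prod>\<rho>\<in>S. Var \<rho>) *
        ((\<Sum>\<rho>\<in>rays \<Sigma>. Cst (Cst (m (ray_gen \<rho>))) * Var \<rho>) - Cst (Lam_lin m))
        | S m. S \<subseteq> rays \<Sigma> \<and> (\<Sum>\<rho>\<in>S. \<rho>) \<in> \<Sigma> \<and> m \<in> P (\<Sum>\<rho>\<in>S. \<rho>)}"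

definition Psi_ideal ::
  "('v::rat_lattice set \<Rightarrow> 'v set \<Rightarrow> ('v \<Rightarrow> rat) \<Rightarrow> ('v \<Rightarrow> rat)) \<Rightarrow> 'v set set \<Rightarrow> 'v dpoly set" where
  "Psi_ideal \<Psi> \<Sigma> = SR_ideal \<Sigma> <+>\<^bsub>D_ring \<Sigma>\<^esub> J_ideal (Psi_space \<Psi>) \<Sigma>"

text \<open>The ideal \<open>I + J'\<close> and the equivariant Chow cohomology ring \<open>A\<^sub>T\<^sup>*(X)\<^sub>\<rat>\<close>.\<close>

definition AT_ideal :: "'v::rat_lattice set set \<Rightarrow> 'v dpoly set" where
  "AT_ideal \<Sigma> = SR_ideal \<Sigma> <+>\<^bsub>D_ring \<Sigma>\<^esub> J_ideal (\<lambda>\<sigma>. dual UNIV) \<Sigma>"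

definition AT_ring :: "'v::rat_lattice set set \<Rightarrow> 'v dpoly set ring" where
  "AT_ring \<Sigma> = D_ring \<Sigma> Quot AT_ideal \<Sigma>"

text \<open>
  The \<open>\<Lambda>\<^sub>\<rat>\<close>-linear map \<open>Z\<^sub>*\<^sup>T(X) \<rightarrow> A\<^sub>T\<^sup>*(X)\<^sub>\<rat>\<close> sending \<open>V \<sigma>\<close> to the class of
  \<open>[N\<^sub>\<sigma> : \<int> n\<^bsub>i\<^sub>1\<^esub> + \<dots> + \<int> n\<^bsub>i\<^sub>k\<^esub>] D\<^bsub>i\<^sub>1\<^esub> \<cdots> D\<^bsub>i\<^sub>k\<^esub>\<close>.
\<close>

definition to_AT :: "'v::rat_lattice set set \<Rightarrow> 'v cyc \<Rightarrow> 'v dpoly set" where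
  "to_AT \<Sigma> z = AT_ideal \<Sigma> +>\<^bsub>D_ring \<Sigma>\<^esub>
     (\<Sum>\<sigma>\<in>\<Sigma>. Cst (Poly_Mapping.lookup z \<sigma>) * (of_nat (cone_mult \<Sigma> \<sigma>) * (\<Prod>\<rho>\<in>rays_of \<Sigma> \<sigma>. Var \<rho>)))"

end

theory Submission
  imports Defs
begin

text \<open>
  Write \<open>n\<^sub>\<rho>\<close> for the primitive generator of a ray and put \<open>D\<^sub>\<sigma> = V\<^sub>\<sigma> / mult \<sigma>\<close>, where \<open>mult \<sigma>\<close> is the index
  of the lattice spanned by the ray generators of \<open>\<sigma>\<close>.  If \<open>\<tau> = \<sigma> + \<rho>\<close>, then \<open>n\<^sub>\<rho>\<close> maps to a positive
  multiple \<open>k\<close> of \<open>n\<^bsub>\<tau>,\<sigma>\<^esub>\<close> in \<open>N(\<sigma>)\<close>, and \<open>mult \<tau> = k mult \<sigma>\<close> for the same \<open>k\<close> (\<open>normal_rep_and_mult\<close>).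
  So the lattice constants cancel in the new basis: a divisor \<open>d\<close> acts by

    \<open>d \<cdot> D\<^sub>\<sigma> = \<Sum>\<^sub>\<rho> (d(n\<^sub>\<rho>) - d\<^sub>\<sigma>\<^sup>\<Psi>(n\<^sub>\<rho>)) D\<^bsub>\<sigma>+\<rho>\<^esub> + d\<^sub>\<sigma>\<^sup>\<Psi> D\<^sub>\<sigma>\<close>,

  summed over the rays \<open>\<rho>\<close> outside \<open>\<sigma>\<close>, with \<open>D\<^bsub>\<sigma>+\<rho>\<^esub> = 0\<close> when \<open>\<sigma> + \<rho>\<close> is not a cone
  (\<open>act_face_cycle\<close>).  Only the complex of faces and the map \<open>\<Psi>\<close> are left, and two consequences of the
  formula carry the whole proof.  First, the ray divisor of a ray \<open>\<rho>\<close> outside \<open>\<sigma>\<close> sends \<open>D\<^sub>\<sigma>\<close> to \<open>D\<^bsub>\<sigma>+\<rho>\<^esub>\<close>.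
  Second, for \<open>m \<in> \<Psi>(\<sigma>)\<close> the divisor of \<open>m\<close> acts on \<open>D\<^sub>\<sigma>\<close> as the scalar \<open>m\<close>; as \<open>\<Psi>(\<sigma>) \<subseteq> \<Psi>(\<tau>)\<close> by
  transitivity, it then acts on \<open>D\<^sub>\<tau>\<close> as the same scalar for every \<open>\<tau>\<close> containing \<open>\<sigma>\<close>.

  Since \<open>\<sigma>\<close> is simplicial, some \<open>m \<in> \<Psi>(\<sigma>)\<close> is dual to a given ray of \<open>\<sigma>\<close>; hence on \<open>D\<^sub>\<sigma>\<close> the operator of
  that ray is a scalar minus a combination of operators of rays outside \<open>\<sigma>\<close>.  It follows that all
  ray operators commute (\<open>A_commute\<close>), so that \<open>\<Lambda>[D\<^sub>1, \<dots>, D\<^sub>s]\<close> acts on cycles.  Evaluation at \<open>V\<^bsub>{0}\<^esub>\<close>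
  (\<open>cycle_of\<close>) sends the square-free monomial of the rays of \<open>\<sigma>\<close> to \<open>D\<^sub>\<sigma>\<close>; it is surjective and kills
  \<open>I + J\<^sup>\<Psi>\<close>.  Conversely, the rewriting just described, read in the polynomial ring, reduces every
  polynomial modulo \<open>I + J\<^sup>\<Psi>\<close> to a combination of the monomials of faces (\<open>normal_form_cong\<close>).  The images
  of these form a basis, so the kernel is exactly \<open>I + J\<^sup>\<Psi>\<close> (\<open>kernel_cycle_of\<close>).  This yields at once the
  product and its presentation.  The product is determined by the action because cycles are generated
  from \<open>V\<^bsub>{0}\<^esub>\<close> by ray operators, and since \<open>J\<^sup>\<Psi> \<subseteq> J'\<close> the presentation maps onto the one of
  \<open>A\<^sub>T\<^sup>*(X)\<close>: this map is \<open>to_AT\<close>, because \<open>to_AT z\<close> is the class of the normal form of \<open>z\<close>.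
\<close>

section \<open>Polynomial rings over subrings\<close>

text \<open>
  The rings \<open>\<Lambda>\<close> and \<open>\<Lambda>[D\<^sub>1, \<dots>, D\<^sub>s]\<close> are subrings of polynomial rings in which every element of the type
  is a variable.  Calculations are done in the ambient ring type; membership in such subrings is
  tracked separately.
\<close>

definition unital_subring :: "'a::comm_ring_1 set \<Rightarrow> bool" where
  "unital_subring A \<longleftrightarrow> 1 \<in> A \<and> (\<forall>a\<in>A. \<forall>b\<in>A. a - b \<in> A \<and> a * b \<in> A)"

lemma unital_subring_UNIV: "unital_subring UNIV"
  by (simp add: unital_subring_def)

context
  fixes A :: "'a::comm_ring_1 set"
  assumes A: "unital_subring A"
begin

lemma subring_one: "1 \<in> A"
  and subring_diff: "a \<in> A \<Longrightarrow> b \<in> A \<Longrightarrow> a - b \<in> A"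
  and subring_mult: "a \<in> A \<Longrightarrow> b \<in> A \<Longrightarrow> a * b \<in> A"
  using A by (auto simp: unital_subring_def)

lemma subring_zero: "0 \<in> A"
  using subring_diff[OF subring_one subring_one] by simp

lemma subring_uminus: "a \<in> A \<Longrightarrow> - a \<in> A"
  using subring_diff[OF subring_zero, of a] by simp

lemma subring_add: "a \<in> A \<Longrightarrow> b \<in> A \<Longrightarrow> a + b \<in> A"
  using subring_diff[OF _ subring_uminus, of a b] by simp

lemma subring_sum: "(\<And>i. i \<in> I \<Longrightarrow> f i \<in> A) \<Longrightarrow> sum f I \<in> A"
  by (induction I rule: infinite_finite_induct) (auto simp: subring_zero subring_add)

lemma subring_prod: "(\<And>i. i \<in> I \<Longrightarrow> f i \<in> A) \<Longrightarrow> prod f I \<in> A"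
  by (induction I rule: infinite_finite_induct) (auto simp: subring_one subring_mult)

lemma subring_of_nat: "of_nat n \<in> A"
  by (induction n) (auto simp: subring_zero subring_one subring_add)

end

lemma poly_ring_simps [simp]:
  "mult (poly_ring A X) = (*)" "one (poly_ring A X) = 1"
  "zero (poly_ring A X) = 0" "add (poly_ring A X) = (+)"
  by (simp_all add: poly_ring_def)

lemma mem_poly_ring:
  "p \<in> carrier (poly_ring A X) \<longleftrightarrow>
     (\<forall>t\<in>Poly_Mapping.keys p. Poly_Mapping.keys t \<subseteq> X \<and> Poly_Mapping.lookup p t \<in> A)"
  by (simp add: poly_ring_def)

lemma sum_monomials:
  "(\<Sum>t\<in>Poly_Mapping.keys p. Poly_Mapping.single t (Poly_Mapping.lookup p t)) = p"
proof (rule poly_mapping_eqI)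
  fix k
  show "Poly_Mapping.lookup (\<Sum>t\<in>Poly_Mapping.keys p. Poly_Mapping.single t (Poly_Mapping.lookup p t)) k
    = Poly_Mapping.lookup p k"
    by (simp add: lookup_sum lookup_single when_def in_keys_iff)
qed

context
  fixes A :: "'a::comm_ring_1 set" and X :: "'x set"
  assumes A: "unital_subring A"
begin

lemma single_in_poly_ring:
  "Poly_Mapping.keys t \<subseteq> X \<Longrightarrow> a \<in> A \<Longrightarrow> Poly_Mapping.single t a \<in> carrier (poly_ring A X)"
  by (simp add: mem_poly_ring)

lemma diff_in_poly_ring:
  assumes "p \<in> carrier (poly_ring A X)" "q \<in> carrier (poly_ring A X)"
  shows "p - q \<in> carrier (poly_ring A X)"
proof -
  have coeff: "Poly_Mapping.lookup r t \<in> A" if "r \<in> carrier (poly_ring A X)" for r t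
    using that subring_zero[OF A]
    by (cases "t \<in> Poly_Mapping.keys r") (auto simp: mem_poly_ring in_keys_iff)
  have "Poly_Mapping.keys t \<subseteq> X" if "t \<in> Poly_Mapping.keys (p - q)" for t
    using subsetD[OF keys_diff that] assms by (auto simp: mem_poly_ring)
  then show ?thesis
    using coeff[OF assms(1)] coeff[OF assms(2)] subring_diff[OF A]
    by (auto simp: mem_poly_ring lookup_minus)
qed

lemma one_in_poly_ring: "1 \<in> carrier (poly_ring A X)"
  by (simp add: mem_poly_ring subring_one[OF A])

lemma zero_in_poly_ring: "0 \<in> carrier (poly_ring A X)"
  by (simp add: mem_poly_ring)

lemma poly_ring_uminus:
  "p \<in> carrier (poly_ring A X) \<Longrightarrow> - p \<in> carrier (poly_ring A X)"
  using diff_in_poly_ring[OF diff_in_poly_ring[OF one_in_poly_ring one_in_poly_ring], of p] by simp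

lemma poly_ring_add:
  "p \<in> carrier (poly_ring A X) \<Longrightarrow> q \<in> carrier (poly_ring A X) \<Longrightarrow> p + q \<in> carrier (poly_ring A X)"
  using diff_in_poly_ring[OF _ poly_ring_uminus, of p q] by simp

lemma poly_ring_sum:
  "(\<And>i. i \<in> I \<Longrightarrow> f i \<in> carrier (poly_ring A X)) \<Longrightarrow> sum f I \<in> carrier (poly_ring A X)"
  by (induction I rule: infinite_finite_induct) (auto simp: poly_ring_add zero_in_poly_ring)

lemma unital_subring_poly_ring: "unital_subring (carrier (poly_ring A X))"
proof -
  have "p * q \<in> carrier (poly_ring A X)"
    if p: "p \<in> carrier (poly_ring A X)" and q: "q \<in> carrier (poly_ring A X)" for p q
  proof -
    let ?m = "\<lambda>p t. Poly_Mapping.single t (Poly_Mapping.lookup p t)"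
    have "p * q = (\<Sum>s\<in>Poly_Mapping.keys p. ?m p s) * (\<Sum>t\<in>Poly_Mapping.keys q. ?m q t)"
      by (simp add: sum_monomials)
    also have "\<dots> = (\<Sum>s\<in>Poly_Mapping.keys p. \<Sum>t\<in>Poly_Mapping.keys q. ?m p s * ?m q t)"
      by (simp add: sum_product)
    also have "\<dots> \<in> carrier (poly_ring A X)"
    proof (intro poly_ring_sum)
      fix s t assume "s \<in> Poly_Mapping.keys p" "t \<in> Poly_Mapping.keys q"
      then show "?m p s * ?m q t \<in> carrier (poly_ring A X)"
        using p q keys_add[of s t] unfolding mult_single
        by (intro single_in_poly_ring) (fastforce simp: mem_poly_ring intro: subring_mult[OF A])+
    qed
    finally show ?thesis .
  qed
  then show ?thesis
    by (auto simp: unital_subring_def diff_in_poly_ring one_in_poly_ring)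
qed

lemma Cst_in_poly_ring: "a \<in> A \<Longrightarrow> Cst a \<in> carrier (poly_ring A X)"
  by (simp add: Cst_def mem_poly_ring)

lemma Var_in_poly_ring: "x \<in> X \<Longrightarrow> Var x \<in> carrier (poly_ring A X)"
  by (simp add: Var_def mem_poly_ring subring_one[OF A])

lemma cring_poly_ring: "cring (poly_ring A X)"
proof (rule cringI)
  note U = unital_subring_poly_ring
  show "abelian_group (poly_ring A X)"
  proof (rule abelian_groupI)
    fix p assume "p \<in> carrier (poly_ring A X)"
    then show "\<exists>q\<in>carrier (poly_ring A X). q \<oplus>\<^bsub>poly_ring A X\<^esub> p = \<zero>\<^bsub>poly_ring A X\<^esub>"
      by (intro bexI[of _ "- p"]) (auto simp: poly_ring_uminus)
  qed (auto simp: subring_add[OF U] subring_zero[OF U] algebra_simps)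
  show "Group.comm_monoid (poly_ring A X)"
    by (rule comm_monoidI) (auto simp: subring_mult[OF U] subring_one[OF U] algebra_simps)
qed (simp add: algebra_simps)

lemma poly_ring_minus:
  assumes "p \<in> carrier (poly_ring A X)" "q \<in> carrier (poly_ring A X)"
  shows "p \<ominus>\<^bsub>poly_ring A X\<^esub> q = p - q"
proof -
  interpret R: cring "poly_ring A X" by (rule cring_poly_ring)
  have "\<ominus>\<^bsub>poly_ring A X\<^esub> q = - q"
    by (rule R.minus_equality) (use assms in \<open>auto simp: poly_ring_uminus\<close>)
  then show ?thesis by (simp add: a_minus_def)
qed

lemma poly_ring_ideal:
  assumes "ideal I (poly_ring A X)"
  shows "0 \<in> I" "p \<in> I \<Longrightarrow> q \<in> I \<Longrightarrow> p + q \<in> I" "p \<in> I \<Longrightarrow> q \<in> I \<Longrightarrow> p - q \<in> I"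
    "r \<in> carrier (poly_ring A X) \<Longrightarrow> p \<in> I \<Longrightarrow> r * p \<in> I"
    "(\<And>i. i \<in> S \<Longrightarrow> f i \<in> I) \<Longrightarrow> sum f S \<in> I"
proof -
  interpret ideal I "poly_ring A X" by (rule assms)
  show zero: "0 \<in> I" using additive_subgroup.zero_closed[OF is_additive_subgroup] by simp
  show add: "p + q \<in> I" if "p \<in> I" "q \<in> I" for p q
    using additive_subgroup.a_closed[OF is_additive_subgroup that] by simp
  show mult: "r * p \<in> I" if "r \<in> carrier (poly_ring A X)" "p \<in> I" for r p
    using I_l_closed[OF that(2,1)] by simp
  show "p - q \<in> I" if "p \<in> I" "q \<in> I" for p q
    using add[OF that(1) mult[OF poly_ring_uminus[OF one_in_poly_ring] that(2)]] by simp
  show "sum f S \<in> I" if "\<And>i. i \<in> S \<Longrightarrow> f i \<in> I" for f :: "'i \<Rightarrow> _" and S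
    using that by (induction S rule: infinite_finite_induct) (auto simp: zero add)
qed

lemma poly_ring_coset_eq_iff:
  assumes "ideal I (poly_ring A X)" "p \<in> carrier (poly_ring A X)" "q \<in> carrier (poly_ring A X)"
  shows "I +>\<^bsub>poly_ring A X\<^esub> p = I +>\<^bsub>poly_ring A X\<^esub> q \<longleftrightarrow> p - q \<in> I"
proof -
  interpret R: cring "poly_ring A X" by (rule cring_poly_ring)
  show ?thesis
    using R.quotient_eq_iff_same_a_r_cos[OF assms] poly_ring_minus[OF assms(2,3)] by auto
qed

end

lemma Cst_0 [simp]: "Cst 0 = 0" and Cst_1 [simp]: "Cst 1 = 1"
  and Cst_add: "Cst (a + b) = Cst a + Cst b" and Cst_diff: "Cst (a - b) = Cst a - Cst b"
  and Cst_mult: "Cst (a * b) = Cst a * Cst b" and Cst_of_nat: "Cst (of_nat n) = of_nat n"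
  by (simp_all add: Cst_def single_add single_diff mult_single)

text \<open>A polynomial ring is generated by its constants and variables.\<close>

lemma poly_ring_induct [consumes 2, case_names one Cst Var add]:
  assumes A: "unital_subring A" and p: "p \<in> carrier (poly_ring A X)"
    and one: "P 1"
    and Cst: "\<And>a q. a \<in> A \<Longrightarrow> q \<in> carrier (poly_ring A X) \<Longrightarrow> P q \<Longrightarrow> P (Cst a * q)"
    and Var: "\<And>x q. x \<in> X \<Longrightarrow> q \<in> carrier (poly_ring A X) \<Longrightarrow> P q \<Longrightarrow> P (Var x * q)"
    and add: "\<And>q r. q \<in> carrier (poly_ring A X) \<Longrightarrow> r \<in> carrier (poly_ring A X) \<Longrightarrow> P q \<Longrightarrow> P r
      \<Longrightarrow> P (q + r)"
  shows "P p"
proof -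
  have zero: "P 0"
    using Cst[OF subring_zero[OF A] one_in_poly_ring[OF A] one] by simp
  have Var_power: "P (Poly_Mapping.single (t + Poly_Mapping.single x n) 1)"
    if "P (Poly_Mapping.single t 1)" "x \<in> X" "Poly_Mapping.keys t \<subseteq> X" for t x n
  proof (induction n)
    case (Suc n)
    have "Poly_Mapping.keys (t + Poly_Mapping.single x n) \<subseteq> X"
      using keys_add[of t "Poly_Mapping.single x n"] that(2,3) by (auto split: if_splits)
    then have c: "Poly_Mapping.single (t + Poly_Mapping.single x n) 1 \<in> carrier (poly_ring A X)"
      by (intro single_in_poly_ring A subring_one)
    have "Var x * Poly_Mapping.single (t + Poly_Mapping.single x n) 1 =
      Poly_Mapping.single (t + Poly_Mapping.single x (Suc n)) (1::'a)"
      using single_add[of x 1 n] by (simp add: Var_def mult_single ac_simps)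
    then show ?case using Var[OF that(2) c Suc.IH] by simp
  qed (use that in simp)
  have monomial: "P (Poly_Mapping.single t 1)" if "Poly_Mapping.keys t \<subseteq> X" for t
  proof -
    have "P (Poly_Mapping.single (\<Sum>x\<in>F. Poly_Mapping.single x (Poly_Mapping.lookup t x)) 1) \<and>
        Poly_Mapping.keys (\<Sum>x\<in>F. Poly_Mapping.single x (Poly_Mapping.lookup t x)) \<subseteq> X"
      if "finite F" "F \<subseteq> X" for F
      using that
    proof (induction F rule: finite_induct)
      case (insert x F)
      then have IH: "P (Poly_Mapping.single (\<Sum>x\<in>F. Poly_Mapping.single x (Poly_Mapping.lookup t x)) 1)"
        "Poly_Mapping.keys (\<Sum>x\<in>F. Poly_Mapping.single x (Poly_Mapping.lookup t x)) \<subseteq> X" "x \<in> X" by auto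
      have "Poly_Mapping.keys ((\<Sum>x\<in>F. Poly_Mapping.single x (Poly_Mapping.lookup t x)) +
         Poly_Mapping.single x (Poly_Mapping.lookup t x)) \<subseteq> X"
        using keys_add[of "\<Sum>x\<in>F. Poly_Mapping.single x (Poly_Mapping.lookup t x)"
            "Poly_Mapping.single x (Poly_Mapping.lookup t x)"] IH by (auto split: if_splits)
      with Var_power[OF IH(1,3,2)] insert.hyps show ?case by (simp add: add.commute)
    qed (simp add: one)
    from this[of "Poly_Mapping.keys t"] that show ?thesis by (simp add: sum_monomials)
  qed
  have "P (\<Sum>t\<in>F. Poly_Mapping.single t (Poly_Mapping.lookup p t)) \<and>
      (\<Sum>t\<in>F. Poly_Mapping.single t (Poly_Mapping.lookup p t)) \<in> carrier (poly_ring A X)"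
    if "finite F" "F \<subseteq> Poly_Mapping.keys p" for F
    using that
  proof (induction F rule: finite_induct)
    case (insert t F)
    have t: "Poly_Mapping.keys t \<subseteq> X" "Poly_Mapping.lookup p t \<in> A"
      using p insert.prems by (auto simp: mem_poly_ring)
    have c: "Poly_Mapping.single t 1 \<in> carrier (poly_ring A X)"
      by (intro single_in_poly_ring A t subring_one)
    have eq: "Poly_Mapping.single t (Poly_Mapping.lookup p t) =
      Cst (Poly_Mapping.lookup p t) * Poly_Mapping.single t 1"
      by (simp add: Cst_def mult_single)
    have m: "P (Poly_Mapping.single t (Poly_Mapping.lookup p t))"
      using Cst[OF t(2) c monomial[OF t(1)]] by (simp only: eq)
    from insert show ?case
      by (auto intro!: add m single_in_poly_ring A t poly_ring_add[OF A])
  qed (auto simp: zero zero_in_poly_ring A)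
  from this[of "Poly_Mapping.keys p"] show ?thesis by (simp add: sum_monomials)
qed

section \<open>Modules spanned by the faces of a complex\<close>

text \<open>
  The combinatorial core of the problem.  The faces are the sets \<open>S\<close> of rays that span a cone, \<open>D S\<close> is
  the normalized cycle of that cone (with \<open>coord\<close> the coordinates in this basis), and \<open>A i\<close> is the action
  of the \<open>i\<close>-th ray divisor.  The predicate \<open>Rel S c l\<close> stands for a functional \<open>m \<in> \<Psi>(\<sigma>)\<close>, where \<open>\<sigma>\<close> is
  the cone of \<open>S\<close>, known only through its values \<open>c j = m(n\<^sub>j)\<close> and its image \<open>l\<close> in \<open>\<Lambda>\<close>.  Then \<open>Rel_D\<close> says
  that the divisor of \<open>m\<close> acts on \<open>D S\<close> as the scalar \<open>m\<close>, \<open>Rel_mono\<close> is the inclusion \<open>\<Psi>(\<sigma>) \<subseteq> \<Psi>(\<tau>)\<close>, and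
  \<open>Rel_delta\<close> provides dual bases for the rays of simplicial cones.  By \<open>A_coord\<close> the operators only see
  the part of a vector that lies in the span of the \<open>D S\<close>.
\<close>

locale face_module = Modules.module scale
  for scale :: "'a::comm_ring_1 \<Rightarrow> 'z::ab_group_add \<Rightarrow> 'z" +
  fixes C :: "'a set" and R :: "'r set" and K :: "'r set set"
    and D :: "'r set \<Rightarrow> 'z" and coord :: "'z \<Rightarrow> 'r set \<Rightarrow> 'a"
    and A :: "'r \<Rightarrow> 'z \<Rightarrow> 'z" and Rel :: "'r set \<Rightarrow> ('r \<Rightarrow> 'a) \<Rightarrow> 'a \<Rightarrow> bool"
  assumes C: "unital_subring C"
    and finite_R: "finite R"
    and face_subset: "S \<in> K \<Longrightarrow> S \<subseteq> R"
    and empty_face: "{} \<in> K"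
    and face_down: "S \<in> K \<Longrightarrow> T \<subseteq> S \<Longrightarrow> T \<in> K"
    and D_nonface: "S \<notin> K \<Longrightarrow> D S = 0"
    and coord_D: "S \<in> K \<Longrightarrow> T \<in> K \<Longrightarrow> coord (D S) T = (if S = T then 1 else 0)"
    and coord_add: "coord (x + y) T = coord x T + coord y T"
    and coord_scale: "coord (scale a x) T = a * coord x T"
    and A_add: "i \<in> R \<Longrightarrow> A i (x + y) = A i x + A i y"
    and A_scale: "i \<in> R \<Longrightarrow> A i (scale a x) = scale a (A i x)"
    and A_coord: "i \<in> R \<Longrightarrow> A i (\<Sum>S\<in>K. scale (coord z S) (D S)) = A i z"
    and A_D: "i \<in> R \<Longrightarrow> S \<in> K \<Longrightarrow> i \<notin> S \<Longrightarrow> A i (D S) = D (insert i S)"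
    and Rel_closed: "S \<in> K \<Longrightarrow> Rel S c l \<Longrightarrow> l \<in> C \<and> (\<forall>j\<in>R. c j \<in> C)"
    and Rel_D: "S \<in> K \<Longrightarrow> Rel S c l \<Longrightarrow> (\<Sum>j\<in>R. scale (c j) (A j (D S))) = scale l (D S)"
    and Rel_mono: "T \<in> K \<Longrightarrow> S \<subseteq> T \<Longrightarrow> Rel S c l \<Longrightarrow> Rel T c l"
    and Rel_delta: "S \<in> K \<Longrightarrow> i \<in> S \<Longrightarrow> \<exists>c l. Rel S c l \<and> (\<forall>j\<in>S. c j = (if j = i then 1 else 0))"
begin

lemma finite_face: "S \<in> K \<Longrightarrow> finite S"
  using face_subset finite_R finite_subset by blast

lemma finite_K: "finite K"
  using face_subset finite_R by (meson PowI finite_Pow_iff finite_subset subsetI)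

lemma A_zero: "i \<in> R \<Longrightarrow> A i 0 = 0"
  using A_add[of i 0 0] by simp

lemma A_diff: "i \<in> R \<Longrightarrow> A i (x - y) = A i x - A i y"
  using A_add[of i "x - y" y] by (simp add: algebra_simps)

lemma A_sum: "i \<in> R \<Longrightarrow> A i (sum f I) = (\<Sum>x\<in>I. A i (f x))"
  by (induction I rule: infinite_finite_induct) (auto simp: A_zero A_add)

lemma coord_zero: "coord 0 T = 0"
  using coord_add[of 0 0 T] by simp

lemma coord_diff: "coord (x - y) T = coord x T - coord y T"
  using coord_add[of "x - y" y T] by (simp add: algebra_simps)

lemma A_D_new: "i \<in> R \<Longrightarrow> i \<notin> S \<Longrightarrow> A i (D S) = D (insert i S)"
  using A_D[of i S] A_zero[of i] D_nonface[of S] D_nonface[of "insert i S"]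
    face_down[of "insert i S" S] by (cases "S \<in> K") auto

text \<open>
  Solving the relation of an element dual to \<open>i\<close> for the operator \<open>A i\<close>.  The relation is taken from the
  smaller face \<open>S\<close> but applied at \<open>T\<close>, so the remaining sum still ranges over rays outside \<open>S\<close> only.
\<close>

lemma A_D_old:
  assumes S: "S \<in> K" "i \<in> S" "S \<subseteq> T" and c: "Rel S c l" "\<forall>j\<in>S. c j = (if j = i then 1 else 0)"
  shows "A i (D T) = scale l (D T) - (\<Sum>j\<in>R - S. scale (c j) (A j (D T)))"
proof (cases "T \<in> K")
  case True
  have "scale l (D T) = (\<Sum>j\<in>R. scale (c j) (A j (D T)))"
    using Rel_D[OF True Rel_mono[OF True S(3) c(1)]] by simp
  also have "\<dots> = (\<Sum>j\<in>R - S. scale (c j) (A j (D T))) + (\<Sum>j\<in>S. scale (c j) (A j (D T)))"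
    using face_subset[OF S(1)] finite_R by (rule sum.subset_diff)
  also have "(\<Sum>j\<in>S. scale (c j) (A j (D T))) = (\<Sum>j\<in>S. if j = i then A j (D T) else 0)"
    using c(2) by (intro sum.cong) auto
  also have "\<dots> = A i (D T)"
    using S finite_face by (simp add: sum.delta)
  finally show ?thesis by (simp add: algebra_simps)
next
  case False
  then show ?thesis
    using S face_subset by (auto simp: D_nonface A_zero subset_iff intro!: sum.neutral)
qed

lemma A_comm_new_new:
  assumes "i \<in> R" "k \<in> R" "i \<notin> S" "k \<notin> S"
  shows "A i (A k (D S)) = A k (A i (D S))"
  using assms by (cases "i = k") (simp_all add: A_D_new insert_commute)

text \<open>
  The operator \<open>A k\<close> commutes with the operators on the right-hand side of \<open>A_D_old\<close> at \<open>S\<close>, and moving it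
  past them produces the right-hand side of \<open>A_D_old\<close> at \<open>insert k S\<close>, with the same coefficients.
\<close>

lemma A_comm_old_new:
  assumes S: "S \<in> K" "i \<in> S" and k: "k \<in> R" "k \<notin> S"
  shows "A i (A k (D S)) = A k (A i (D S))"
proof -
  obtain c l where c: "Rel S c l" "\<forall>j\<in>S. c j = (if j = i then 1 else 0)"
    using Rel_delta[OF S] by blast
  have "A k (A i (D S)) = scale l (A k (D S)) - (\<Sum>j\<in>R - S. scale (c j) (A k (A j (D S))))"
    using A_D_old[OF S order_refl c] k by (simp add: A_diff A_scale A_sum)
  also have "\<dots> = scale l (A k (D S)) - (\<Sum>j\<in>R - S. scale (c j) (A j (A k (D S))))"
    using k A_comm_new_new[of k _ S] by (auto intro!: sum.cong)
  also have "\<dots> = scale l (D (insert k S)) - (\<Sum>j\<in>R - S. scale (c j) (A j (D (insert k S))))"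
    using k by (simp add: A_D_new)
  also have "\<dots> = A i (A k (D S))"
    using A_D_old[OF S subset_insertI c, of k] k by (simp add: A_D_new)
  finally show ?thesis ..
qed

text \<open>
  Both composites expand, by \<open>A_D_old\<close> and the previous case, into an expression in operators of rays
  outside \<open>S\<close>, which is symmetric in the two relations since those operators commute on \<open>D S\<close>.
\<close>

lemma A_comm_old_old:
  assumes S: "S \<in> K" "i \<in> S" "k \<in> S"
  shows "A i (A k (D S)) = A k (A i (D S))"
proof -
  obtain c l where c: "Rel S c l" "\<forall>j\<in>S. c j = (if j = i then 1 else 0)"
    using Rel_delta S by blast
  obtain c' l' where c': "Rel S c' l'" "\<forall>j\<in>S. c' j = (if j = k then 1 else 0)"
    using Rel_delta S by blast
  have R: "i \<in> R" "k \<in> R" using S face_subset by auto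
  note i = A_D_old[OF S(1,2) order_refl c] and k = A_D_old[OF S(1,3) order_refl c']
  define X where "X c = (\<Sum>j\<in>R - S. scale (c j) (A j (D S)))" for c
  \<comment> \<open>the general expansion, used for \<open>A i (A k _)\<close> and for \<open>A k (A i _)\<close>\<close>
  have two: "A i' (A k' (D S)) =
      scale (l' * l) (D S) - scale l' (X c) - scale l (X c') +
      (\<Sum>j\<in>R - S. \<Sum>h\<in>R - S. scale (c' j * c h) (A j (A h (D S))))"
    if i': "i' \<in> S" "i' \<in> R" "A i' (D S) = scale l (D S) - X c"
      and k': "A k' (D S) = scale l' (D S) - X c'"
    for i' k' l l' c c'
  proof -
    have "A i' (A k' (D S)) = scale l' (A i' (D S)) - (\<Sum>j\<in>R - S. scale (c' j) (A i' (A j (D S))))"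
      using i' k' by (simp add: X_def A_diff A_scale A_sum)
    also have "(\<Sum>j\<in>R - S. scale (c' j) (A i' (A j (D S)))) =
        (\<Sum>j\<in>R - S. scale (c' j) (A j (A i' (D S))))"
      using A_comm_old_new[OF S(1) i'(1)] by (intro sum.cong) auto
    also have "\<dots> = (\<Sum>j\<in>R - S. scale l (scale (c' j) (A j (D S))) -
        (\<Sum>h\<in>R - S. scale (c' j * c h) (A j (A h (D S)))))"
      by (intro sum.cong)
        (auto simp: i' X_def A_diff A_scale A_sum scale_right_diff_distrib scale_sum_right mult.commute)
    also have "\<dots> = scale l (X c') - (\<Sum>j\<in>R - S. \<Sum>h\<in>R - S. scale (c' j * c h) (A j (A h (D S))))"
      by (simp add: sum_subtractf X_def scale_sum_right)
    finally show ?thesis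
      by (simp add: i' scale_right_diff_distrib)
  qed
  have swap: "(\<Sum>j\<in>R - S. \<Sum>h\<in>R - S. scale (c' j * c h) (A j (A h (D S)))) =
      (\<Sum>j\<in>R - S. \<Sum>h\<in>R - S. scale (c j * c' h) (A j (A h (D S))))"
    by (subst sum.swap, intro sum.cong) (auto simp: A_comm_new_new[of _ _ S] mult.commute)
  show ?thesis
    unfolding two[OF S(2) R(1) i[folded X_def] k[folded X_def]]
      two[OF S(3) R(2) k[folded X_def] i[folded X_def]] swap
    by (simp add: algebra_simps)
qed

lemma A_commute:
  assumes "i \<in> R" "k \<in> R"
  shows "A i (A k z) = A k (A i z)"
proof -
  have D: "A i (A k (D S)) = A k (A i (D S))" if "S \<in> K" for S
    using A_comm_new_new A_comm_old_new A_comm_old_old that assms by metis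
  have "A i (A k z) = (\<Sum>S\<in>K. scale (coord z S) (A i (A k (D S))))"
    by (subst A_coord[OF assms(2), symmetric]) (simp add: A_sum A_scale assms)
  also have "\<dots> = (\<Sum>S\<in>K. scale (coord z S) (A k (A i (D S))))"
    using D by simp
  also have "\<dots> = A k (A i z)"
    by (subst (2) A_coord[OF assms(1), symmetric]) (simp add: A_sum A_scale assms)
  finally show ?thesis .
qed

subsection \<open>The action of polynomials\<close>

text \<open>
  As the operators \<open>A i\<close> commute, the fold applies the powers \<open>A i ^^ t i\<close> in an irrelevant order.
\<close>

definition monomial_act :: "('r \<Rightarrow>\<^sub>0 nat) \<Rightarrow> 'z \<Rightarrow> 'z" where
  "monomial_act t z = Finite_Set.fold (\<lambda>i. A i ^^ Poly_Mapping.lookup t i) z R"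

definition poly_act :: "(('r \<Rightarrow>\<^sub>0 nat) \<Rightarrow>\<^sub>0 'a) \<Rightarrow> 'z \<Rightarrow> 'z" where
  "poly_act p z = (\<Sum>t\<in>Poly_Mapping.keys p. scale (Poly_Mapping.lookup p t) (monomial_act t z))"

lemma funpow_commute:
  assumes "\<And>z. g (h z) = h (g z)"
  shows "g ((h ^^ n) z) = (h ^^ n) (g z)"
  by (induction n) (auto simp: assms)

lemma comp_fun_commute_on_A: "comp_fun_commute_on R A"
  by unfold_locales (auto simp: A_commute fun_eq_iff)

lemma fold_insert_A:
  assumes "finite F" "i \<notin> F" "insert i F \<subseteq> R"
  shows "Finite_Set.fold (\<lambda>i. A i ^^ e i) z (insert i F) =
    (A i ^^ e i) (Finite_Set.fold (\<lambda>i. A i ^^ e i) z F)"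
proof -
  interpret comp_fun_commute_on R "\<lambda>i. A i ^^ e i"
    by (rule comp_fun_commute_on.comp_fun_commute_on_funpow[OF comp_fun_commute_on_A])
  show ?thesis using fold_insert assms by simp
qed

lemma fold_commute:
  assumes "finite F" "F \<subseteq> R" "\<And>i z. i \<in> R \<Longrightarrow> g (A i z) = A i (g z)"
  shows "g (Finite_Set.fold (\<lambda>i. A i ^^ e i) z F) = Finite_Set.fold (\<lambda>i. A i ^^ e i) (g z) F"
  using assms by (induction F rule: finite_induct) (auto simp: fold_insert_A funpow_commute)

lemma funpow_A_add: "i \<in> R \<Longrightarrow> (A i ^^ n) (x + y) = (A i ^^ n) x + (A i ^^ n) y"
  by (induction n) (auto simp: A_add)

lemma monomial_act_add_right: "monomial_act t (x + y) = monomial_act t x + monomial_act t y"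
proof -
  have "Finite_Set.fold (\<lambda>i. A i ^^ e i) (x + y) F =
      Finite_Set.fold (\<lambda>i. A i ^^ e i) x F + Finite_Set.fold (\<lambda>i. A i ^^ e i) y F"
    if "finite F" "F \<subseteq> R" for F e
    using that by (induction F rule: finite_induct) (auto simp: fold_insert_A funpow_A_add)
  then show ?thesis by (simp add: monomial_act_def finite_R)
qed

lemma monomial_act_scale: "monomial_act t (scale a x) = scale a (monomial_act t x)"
  unfolding monomial_act_def
  by (rule fold_commute[OF finite_R order_refl, symmetric]) (simp add: A_scale)

lemma monomial_act_zero: "monomial_act 0 z = z"
proof -
  have "Finite_Set.fold (\<lambda>i. A i ^^ 0) z F = z" if "finite F" "F \<subseteq> R" for F
    using that fold_insert_A[where e = "\<lambda>_. 0"] by (induction F rule: finite_induct) auto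
  from this[OF finite_R order_refl] show ?thesis by (simp add: monomial_act_def)
qed

lemma monomial_act_single:
  assumes "i \<in> R"
  shows "monomial_act (Poly_Mapping.single i 1) z = A i z"
proof -
  let ?e = "Poly_Mapping.lookup (Poly_Mapping.single i (1::nat))"
  have "Finite_Set.fold (\<lambda>i. A i ^^ ?e i) z F = (if i \<in> F then A i z else z)"
    if "finite F" "F \<subseteq> R" for F
    using that
    by (induction F rule: finite_induct) (auto simp: fold_insert_A lookup_single when_def)
  then show ?thesis using assms by (simp add: monomial_act_def finite_R)
qed

lemma monomial_act_add: "monomial_act (s + t) z = monomial_act s (monomial_act t z)"
proof -
  let ?e = "\<lambda>t i. A i ^^ Poly_Mapping.lookup t i"
  have "Finite_Set.fold (?e (s + t)) z F = Finite_Set.fold (?e s) (Finite_Set.fold (?e t) z F) F"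
    if "finite F" "F \<subseteq> R" for F
    using that
  proof (induction F rule: finite_induct)
    case (insert x F)
    then have F: "finite F" "x \<notin> F" "insert x F \<subseteq> R" "F \<subseteq> R" "x \<in> R" by auto
    have "Finite_Set.fold (?e (s + t)) z (insert x F) = ?e (s + t) x (Finite_Set.fold (?e (s + t)) z F)"
      by (rule fold_insert_A[OF F(1-3)])
    also have "\<dots> = ?e s x (?e t x (Finite_Set.fold (?e s) (Finite_Set.fold (?e t) z F) F))"
      by (subst insert.IH[OF F(4)]) (simp only: lookup_add funpow_add o_apply)
    also have "?e t x (Finite_Set.fold (?e s) (Finite_Set.fold (?e t) z F) F) =
        Finite_Set.fold (?e s) (?e t x (Finite_Set.fold (?e t) z F)) F"
      using F(5) by (intro fold_commute F(1,4) funpow_commute[symmetric]) (simp add: A_commute)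
    finally show ?case by (simp add: fold_insert_A[OF F(1-3)])
  qed simp
  from this[OF finite_R order_refl] show ?thesis by (simp add: monomial_act_def)
qed

lemma monomial_act_sum: "monomial_act t (sum f I) = (\<Sum>x\<in>I. monomial_act t (f x))"
  using monomial_act_add_right[of t 0 0]
  by (induction I rule: infinite_finite_induct) (auto simp: monomial_act_add_right)

lemma poly_act_superset:
  assumes "finite F" "Poly_Mapping.keys p \<subseteq> F"
  shows "poly_act p z = (\<Sum>t\<in>F. scale (Poly_Mapping.lookup p t) (monomial_act t z))"
  unfolding poly_act_def using assms by (intro sum.mono_neutral_left) (auto simp: in_keys_iff)

lemma poly_act_single: "poly_act (Poly_Mapping.single t a) z = scale a (monomial_act t z)"
  by (subst poly_act_superset[of "{t}"]) auto

lemma poly_act_add: "poly_act (p + q) z = poly_act p z + poly_act q z"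
  using keys_add[of p q]
  by (subst (1 2 3) poly_act_superset[of "Poly_Mapping.keys p \<union> Poly_Mapping.keys q"])
    (auto simp: lookup_add scale_left_distrib sum.distrib)

lemma poly_act_zero: "poly_act 0 z = 0"
  by (simp add: poly_act_def)

lemma poly_act_diff: "poly_act (p - q) z = poly_act p z - poly_act q z"
  using poly_act_add[of "p - q" q z] by (simp add: algebra_simps)

lemma poly_act_sum: "poly_act (sum f I) z = (\<Sum>x\<in>I. poly_act (f x) z)"
  by (induction I rule: infinite_finite_induct) (auto simp: poly_act_zero poly_act_add)

lemma poly_act_mult: "poly_act (p * q) z = poly_act p (poly_act q z)"
proof -
  let ?m = "\<lambda>p t. Poly_Mapping.single t (Poly_Mapping.lookup p t)"
  have "p * q = (\<Sum>s\<in>Poly_Mapping.keys p. ?m p s) * (\<Sum>t\<in>Poly_Mapping.keys q. ?m q t)"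
    by (simp add: sum_monomials)
  also have "\<dots> = (\<Sum>s\<in>Poly_Mapping.keys p. \<Sum>t\<in>Poly_Mapping.keys q. ?m p s * ?m q t)"
    by (simp add: sum_product)
  finally have "poly_act (p * q) z = (\<Sum>s\<in>Poly_Mapping.keys p. \<Sum>t\<in>Poly_Mapping.keys q.
      scale (Poly_Mapping.lookup p s * Poly_Mapping.lookup q t) (monomial_act (s + t) z))"
    by (simp add: poly_act_sum mult_single poly_act_single)
  also have "\<dots> = poly_act p (poly_act q z)"
    by (simp add: poly_act_def monomial_act_sum monomial_act_scale scale_sum_right monomial_act_add)
  finally show ?thesis .
qed

lemma poly_act_Cst: "poly_act (Cst a) z = scale a z"
  by (simp add: Cst_def poly_act_single monomial_act_zero)

lemma poly_act_one: "poly_act 1 z = z"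
  using poly_act_Cst[of 1 z] by simp

lemma poly_act_Var: "i \<in> R \<Longrightarrow> poly_act (Var i) z = A i z"
  by (simp add: Var_def poly_act_single monomial_act_single[unfolded One_nat_def])

subsection \<open>The cyclic submodule generated by the empty face\<close>

definition cycle_of :: "(('r \<Rightarrow>\<^sub>0 nat) \<Rightarrow>\<^sub>0 'a) \<Rightarrow> 'z" where
  "cycle_of p = poly_act p (D {})"

definition normal_form :: "'z \<Rightarrow> ('r \<Rightarrow>\<^sub>0 nat) \<Rightarrow>\<^sub>0 'a" where
  "normal_form z = (\<Sum>S\<in>K. Cst (coord z S) * (\<Prod>i\<in>S. Var i))"

definition D_span :: "'z set" where
  "D_span = {z. (\<forall>S\<in>K. coord z S \<in> C) \<and> z = (\<Sum>S\<in>K. scale (coord z S) (D S))}"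

abbreviation "P \<equiv> poly_ring C R"

lemma poly_act_cycle_of: "poly_act p (cycle_of q) = cycle_of (p * q)"
  by (simp add: cycle_of_def poly_act_mult)

lemma cycle_of_add: "cycle_of (p + q) = cycle_of p + cycle_of q"
  and cycle_of_sum: "cycle_of (sum f I) = (\<Sum>x\<in>I. cycle_of (f x))" and cycle_of_one: "cycle_of 1 = D {}"
  and cycle_of_Cst_mult: "cycle_of (Cst a * p) = scale a (cycle_of p)"
  and cycle_of_Var_mult: "i \<in> R \<Longrightarrow> cycle_of (Var i * p) = A i (cycle_of p)"
  by (simp_all add: cycle_of_def poly_act_add poly_act_sum poly_act_one poly_act_mult
      poly_act_Cst poly_act_Var)

lemma cycle_of_prod_Var:
  assumes "S \<subseteq> R"
  shows "cycle_of (\<Prod>i\<in>S. Var i) = D S"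
proof -
  have "finite S" using assms finite_R finite_subset by blast
  then show ?thesis using assms
    by (induction S rule: finite_induct) (auto simp: cycle_of_one cycle_of_Var_mult A_D_new)
qed

lemma cycle_of_prod_Var_mult:
  assumes "S \<subseteq> R"
  shows "cycle_of ((\<Prod>i\<in>S. Var i) * p) = poly_act p (D S)"
  using poly_act_cycle_of[of p "\<Prod>i\<in>S. Var i"] cycle_of_prod_Var[OF assms] by (simp add: mult.commute)

lemma normal_form_add: "normal_form (x + y) = normal_form x + normal_form y"
  and normal_form_diff: "normal_form (x - y) = normal_form x - normal_form y"
  and normal_form_scale: "normal_form (scale a x) = Cst a * normal_form x"
  and normal_form_zero: "normal_form 0 = 0"
  by (simp_all add: normal_form_def coord_add coord_diff coord_scale coord_zero Cst_add Cst_diff Cst_mult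
      distrib_right left_diff_distrib sum.distrib sum_subtractf sum_distrib_left mult.assoc)

lemma normal_form_sum: "normal_form (sum f I) = (\<Sum>x\<in>I. normal_form (f x))"
  by (induction I rule: infinite_finite_induct) (auto simp: normal_form_zero normal_form_add)

lemma normal_form_D: "S \<in> K \<Longrightarrow> normal_form (D S) = (\<Prod>i\<in>S. Var i)"
proof -
  assume S: "S \<in> K"
  have "normal_form (D S) = (\<Sum>T\<in>K. if S = T then \<Prod>i\<in>T. Var i else 0)"
    unfolding normal_form_def by (intro sum.cong) (auto simp: coord_D S)
  then show ?thesis using S by (simp add: finite_K)
qed

lemma cycle_of_normal_form: "z \<in> D_span \<Longrightarrow> cycle_of (normal_form z) = z"
  by (auto simp: normal_form_def cycle_of_sum cycle_of_Cst_mult cycle_of_prod_Var face_subset D_span_def)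

lemma prod_Var_in_P: "S \<subseteq> R \<Longrightarrow> (\<Prod>i\<in>S. Var i) \<in> carrier P"
  by (intro subring_prod[OF unital_subring_poly_ring[OF C]] Var_in_poly_ring[OF C]) auto

lemma normal_form_in_P: "z \<in> D_span \<Longrightarrow> normal_form z \<in> carrier P"
  unfolding normal_form_def D_span_def
  by (intro poly_ring_sum[OF C] subring_mult[OF unital_subring_poly_ring[OF C]]
      Cst_in_poly_ring[OF C] prod_Var_in_P face_subset) auto

lemma D_span_zero: "0 \<in> D_span"
  by (simp add: D_span_def coord_zero subring_zero[OF C])

lemma D_span_add: "x \<in> D_span \<Longrightarrow> y \<in> D_span \<Longrightarrow> x + y \<in> D_span"
  by (auto simp: D_span_def coord_add subring_add[OF C] scale_left_distrib sum.distrib)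

lemma D_span_scale: "a \<in> C \<Longrightarrow> x \<in> D_span \<Longrightarrow> scale a x \<in> D_span"
proof -
  assume a: "a \<in> C" and x: "x \<in> D_span"
  have "(\<Sum>S\<in>K. scale (coord (scale a x) S) (D S)) = scale a (\<Sum>S\<in>K. scale (coord x S) (D S))"
    by (simp add: coord_scale scale_sum_right)
  also have "\<dots> = scale a x" using x by (simp add: D_span_def)
  finally show ?thesis using a x
    by (auto simp: D_span_def coord_scale subring_mult[OF C])
qed

lemma D_span_diff: "x \<in> D_span \<Longrightarrow> y \<in> D_span \<Longrightarrow> x - y \<in> D_span"
  using D_span_add[of x "scale (-1) y"] D_span_scale[of "-1" y] subring_uminus[OF C subring_one[OF C]] by simp

lemma D_span_sum: "(\<And>x. x \<in> I \<Longrightarrow> f x \<in> D_span) \<Longrightarrow> sum f I \<in> D_span"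
  by (induction I rule: infinite_finite_induct) (auto simp: D_span_zero D_span_add)

lemma D_in_D_span: "D S \<in> D_span"
proof (cases "S \<in> K")
  case True
  have "(\<Sum>T\<in>K. scale (coord (D S) T) (D T)) = (\<Sum>T\<in>K. if S = T then D T else 0)"
    by (intro sum.cong) (auto simp: coord_D True)
  then show ?thesis using True
    by (simp add: D_span_def finite_K coord_D subring_zero[OF C] subring_one[OF C])
qed (simp add: D_nonface D_span_zero)

lemma A_in_D_span:
  assumes "i \<in> R" "z \<in> D_span"
  shows "A i z \<in> D_span"
proof -
  have D: "A i (D S) \<in> D_span" if S: "S \<in> K" for S
  proof (cases "i \<in> S")
    case True
    obtain c l where c: "Rel S c l" "\<forall>j\<in>S. c j = (if j = i then 1 else 0)"
      using Rel_delta[OF S True] by blast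
    then show ?thesis
      using Rel_closed[OF S c(1)] unfolding A_D_old[OF S True order_refl c]
      by (intro D_span_diff D_span_scale D_span_sum D_in_D_span) (auto simp: A_D_new D_in_D_span)
  qed (simp add: A_D_new assms D_in_D_span)
  have "A i z = (\<Sum>S\<in>K. scale (coord z S) (A i (D S)))"
    by (subst A_coord[symmetric]) (simp_all add: assms A_sum A_scale)
  then show ?thesis
    using assms D by (auto simp: D_span_def[THEN eqset_imp_iff, of z] intro!: D_span_sum D_span_scale)
qed

lemma cycle_of_in_D_span:
  assumes "p \<in> carrier P"
  shows "cycle_of p \<in> D_span"
  using C assms
  by (induction p rule: poly_ring_induct)
    (auto simp: cycle_of_one D_in_D_span cycle_of_Cst_mult D_span_scale cycle_of_Var_mult A_in_D_span cycle_of_add D_span_add)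

text \<open>The abstract counterparts of the generators of \<open>I\<close> and \<open>J\<^sup>\<Psi>\<close>, see \<open>relators_eq\<close>.\<close>

definition relators :: "(('r \<Rightarrow>\<^sub>0 nat) \<Rightarrow>\<^sub>0 'a) set" where
  "relators = {(\<Prod>i\<in>S. Var i) | S. S \<subseteq> R \<and> S \<notin> K} \<union>
     {(\<Prod>i\<in>S. Var i) * ((\<Sum>j\<in>R. Cst (c j) * Var j) - Cst l) | S c l. S \<in> K \<and> Rel S c l}"

lemma cycle_of_relators: "p \<in> relators \<Longrightarrow> cycle_of p = 0"
  by (auto simp: relators_def cycle_of_prod_Var D_nonface cycle_of_prod_Var_mult face_subset poly_act_diff
      poly_act_sum poly_act_mult poly_act_Cst poly_act_Var Rel_D)

text \<open>
  The set of polynomials congruent to their normal form contains \<open>1\<close> and is closed under addition and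
  multiplication by constants.  For multiplication by \<open>Var i\<close> it is enough to consider the monomial of a
  face \<open>S\<close>.  If \<open>i \<notin> S\<close>, the product is the monomial of a face or a relator; if \<open>i \<in> S\<close>, the relator of
  an element dual to \<open>i\<close> rewrites it in terms of the former case, in parallel to \<open>A_D_old\<close>.
\<close>

lemma normal_form_cong:
  assumes I: "ideal I P" "relators \<subseteq> I" and p: "p \<in> carrier P"
  shows "p - normal_form (cycle_of p) \<in> I"
  using C p
proof (induction p rule: poly_ring_induct)
  case one
  have "normal_form (cycle_of 1) = 1" by (simp add: cycle_of_one normal_form_D empty_face)
  then show ?case using poly_ring_ideal(1)[OF C I(1)] by simp
next
  case (Cst a q)
  have "Cst a * q - normal_form (cycle_of (Cst a * q)) = Cst a * (q - normal_form (cycle_of q))"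
    by (simp add: cycle_of_Cst_mult normal_form_scale right_diff_distrib)
  then show ?case
    using poly_ring_ideal(4)[OF C I(1) Cst_in_poly_ring[OF C Cst(1)] Cst(3)] by simp
next
  case (add q r)
  have "q + r - normal_form (cycle_of (q + r)) = (q - normal_form (cycle_of q)) + (r - normal_form (cycle_of r))"
    by (simp add: cycle_of_add normal_form_add)
  then show ?case using poly_ring_ideal(2)[OF C I(1) add(3,4)] by (simp only:)
next
  case (Var i q)
  define m where "m S = (\<Prod>i\<in>S. Var i :: ('r \<Rightarrow>\<^sub>0 nat) \<Rightarrow>\<^sub>0 'a)" for S
  have new: "Var j * m S - normal_form (A j (D S)) \<in> I" if "j \<in> R" "S \<in> K" "j \<notin> S" for j S
  proof -
    have m: "Var j * m S = m (insert j S)"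
      using that finite_face by (simp add: m_def)
    show ?thesis
    proof (cases "insert j S \<in> K")
      case True
      then show ?thesis
        using poly_ring_ideal(1)[OF C I(1)] that by (simp add: A_D normal_form_D m m_def[symmetric])
    next
      case False
      then have "m (insert j S) \<in> relators"
        using that face_subset[OF that(2)] by (auto simp: relators_def m_def)
      then show ?thesis using I(2) False that by (auto simp: A_D D_nonface normal_form_zero m)
    qed
  qed
  have old: "Var i * m S - normal_form (A i (D S)) \<in> I" if S: "S \<in> K" "i \<in> S" for S
  proof -
    obtain c l where c: "Rel S c l" "\<forall>j\<in>S. c j = (if j = i then 1 else 0)"
      using Rel_delta[OF S] by blast
    have cC: "c j \<in> C" if "j \<in> R" for j
      using Rel_closed[OF S(1) c(1)] that by blast
    have rel: "m S * ((\<Sum>j\<in>R. Cst (c j) * Var j) - Cst l) \<in> I"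
      using c(1) S(1) by (intro subsetD[OF I(2)]) (auto simp: relators_def m_def)
    have "(\<Sum>j\<in>R. Cst (c j) * Var j) =
        (\<Sum>j\<in>R - S. Cst (c j) * Var j) + (\<Sum>j\<in>S. Cst (c j) * Var j :: ('r \<Rightarrow>\<^sub>0 nat) \<Rightarrow>\<^sub>0 'a)"
      using face_subset[OF S(1)] finite_R by (rule sum.subset_diff)
    also have "(\<Sum>j\<in>S. Cst (c j) * Var j :: ('r \<Rightarrow>\<^sub>0 nat) \<Rightarrow>\<^sub>0 'a) = (\<Sum>j\<in>S. if j = i then Var j else 0)"
      using c(2) by (intro sum.cong) auto
    also have "\<dots> = Var i"
      using S finite_face by (simp add: sum.delta)
    finally have split: "m S * ((\<Sum>j\<in>R. Cst (c j) * Var j) - Cst l) =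
        Var i * m S + (\<Sum>j\<in>R - S. Cst (c j) * (Var j * m S)) - Cst l * m S"
      by (simp add: algebra_simps sum_distrib_left)
    have "normal_form (A i (D S)) = Cst l * m S - (\<Sum>j\<in>R - S. Cst (c j) * normal_form (A j (D S)))"
      by (simp add: A_D_old[OF S order_refl c] normal_form_diff normal_form_scale normal_form_sum normal_form_D S m_def)
    then have "Var i * m S - normal_form (A i (D S)) =
        m S * ((\<Sum>j\<in>R. Cst (c j) * Var j) - Cst l) -
        (\<Sum>j\<in>R - S. Cst (c j) * (Var j * m S - normal_form (A j (D S))))"
      unfolding split by (simp add: right_diff_distrib sum_subtractf)
    also have "\<dots> \<in> I"
    proof (rule poly_ring_ideal(3)[OF C I(1) rel poly_ring_ideal(5)[OF C I(1)]])
      fix j assume "j \<in> R - S"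
      then show "Cst (c j) * (Var j * m S - normal_form (A j (D S))) \<in> I"
        using S by (intro poly_ring_ideal(4)[OF C I(1)] new Cst_in_poly_ring[OF C] cC) auto
    qed
    finally show ?thesis .
  qed
  have q: "cycle_of q \<in> D_span" using cycle_of_in_D_span Var by blast
  have qC: "coord (cycle_of q) S \<in> C" if "S \<in> K" for S
    using q that by (simp add: D_span_def)
  have "A i (cycle_of q) = (\<Sum>S\<in>K. scale (coord (cycle_of q) S) (A i (D S)))"
    by (subst A_coord[symmetric]) (simp_all add: Var A_sum A_scale)
  then have "Var i * normal_form (cycle_of q) - normal_form (A i (cycle_of q)) =
      (\<Sum>S\<in>K. Cst (coord (cycle_of q) S) * (Var i * m S - normal_form (A i (D S))))"
    by (simp add: normal_form_sum normal_form_scale normal_form_def[of "cycle_of q"] m_def[symmetric] sum_distrib_left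
        sum_subtractf right_diff_distrib mult.left_commute)
  also have "\<dots> \<in> I"
    using new old Var(1) qC
    by (intro poly_ring_ideal(5)[OF C I(1)] poly_ring_ideal(4)[OF C I(1)] Cst_in_poly_ring[OF C]) blast+
  finally have 1: "Var i * normal_form (cycle_of q) - normal_form (A i (cycle_of q)) \<in> I" .
  have 2: "Var i * (q - normal_form (cycle_of q)) \<in> I"
    by (rule poly_ring_ideal(4)[OF C I(1) Var_in_poly_ring[OF C Var(1)] Var(3)])
  have "Var i * q - normal_form (cycle_of (Var i * q)) =
      Var i * (q - normal_form (cycle_of q)) + (Var i * normal_form (cycle_of q) - normal_form (A i (cycle_of q)))"
    by (simp add: cycle_of_Var_mult Var right_diff_distrib)
  then show ?case using poly_ring_ideal(2)[OF C I(1) 2 1] by simp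
qed

subsection \<open>The induced product\<close>

text \<open>
  The product transported from the polynomial ring: the polynomials form a commutative ring acting on
  the module, every element of \<open>D_span\<close> is of the form \<open>cycle_of p\<close>, and \<open>cycle_of p\<close> acts as \<open>p\<close> does
  (\<open>face_prod_cycle_of\<close>).  All ring laws follow from this.
\<close>

definition face_prod :: "'z \<Rightarrow> 'z \<Rightarrow> 'z" where
  "face_prod y z = poly_act (normal_form y) z"

text \<open>
  Write \<open>z = cycle_of q\<close>.  Polynomials commute, so \<open>p\<close> and the normal form of \<open>cycle_of p\<close> both send \<open>z\<close> to
  the image of \<open>cycle_of p\<close> under \<open>q\<close>.
\<close>

lemma face_prod_cycle_of:
  assumes "p \<in> carrier P" "z \<in> D_span"
  shows "face_prod (cycle_of p) z = poly_act p z"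
proof -
  have "face_prod (cycle_of p) z = poly_act (normal_form (cycle_of p)) (cycle_of (normal_form z))"
    by (simp add: face_prod_def cycle_of_normal_form assms)
  also have "\<dots> = poly_act (normal_form z) (cycle_of (normal_form (cycle_of p)))"
    by (simp add: poly_act_cycle_of mult.commute)
  also have "\<dots> = poly_act (normal_form z) (cycle_of p)"
    by (simp add: cycle_of_normal_form cycle_of_in_D_span assms)
  also have "\<dots> = poly_act p (cycle_of (normal_form z))"
    by (simp add: poly_act_cycle_of mult.commute)
  finally show ?thesis by (simp add: cycle_of_normal_form assms)
qed

lemma cycle_of_mult:
  "p \<in> carrier P \<Longrightarrow> q \<in> carrier P \<Longrightarrow> cycle_of (p * q) = face_prod (cycle_of p) (cycle_of q)"
  by (simp add: face_prod_cycle_of cycle_of_in_D_span poly_act_cycle_of)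

lemma cycle_of_image: "cycle_of ` carrier P = D_span"
proof
  show "cycle_of ` carrier P \<subseteq> D_span" using cycle_of_in_D_span by auto
  show "D_span \<subseteq> cycle_of ` carrier P" using cycle_of_normal_form normal_form_in_P by (metis image_eqI subsetI)
qed

lemma face_prod_in_D_span: "x \<in> D_span \<Longrightarrow> y \<in> D_span \<Longrightarrow> face_prod x y \<in> D_span"
  using subring_mult[OF unital_subring_poly_ring[OF C, of R]]
  by (auto simp: cycle_of_image[symmetric] cycle_of_mult[symmetric] intro!: imageI)

lemma face_prod_commute: "x \<in> D_span \<Longrightarrow> y \<in> D_span \<Longrightarrow> face_prod x y = face_prod y x"
  by (auto simp: cycle_of_image[symmetric] cycle_of_mult[symmetric] mult.commute)

lemma face_prod_assoc:
  "x \<in> D_span \<Longrightarrow> y \<in> D_span \<Longrightarrow> z \<in> D_span \<Longrightarrow> face_prod (face_prod x y) z = face_prod x (face_prod y z)"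
  using subring_mult[OF unital_subring_poly_ring[OF C, of R]]
  by (auto simp: cycle_of_image[symmetric] cycle_of_mult[symmetric] mult.assoc)

lemma face_prod_D_empty: "z \<in> D_span \<Longrightarrow> face_prod (D {}) z = z"
  using face_prod_cycle_of[OF one_in_poly_ring[OF C]] by (simp add: cycle_of_one poly_act_one)

lemma face_prod_D_singleton: "i \<in> R \<Longrightarrow> z \<in> D_span \<Longrightarrow> face_prod (D {i}) z = A i z"
  using face_prod_cycle_of[of "Var i" z] Var_in_poly_ring[OF C, of i R] cycle_of_prod_Var[of "{i}"]
  by (simp add: poly_act_Var)

lemma face_prod_add: "face_prod (x + y) z = face_prod x z + face_prod y z"
  by (simp add: face_prod_def normal_form_add poly_act_add)

lemma face_prod_scale: "face_prod (scale a x) z = scale a (face_prod x z)"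
  by (simp add: face_prod_def normal_form_scale poly_act_mult poly_act_Cst)

end

section \<open>Linear functionals and cones\<close>

interpretation QR: vector_space_pair "scaleQ :: rat \<Rightarrow> 'v::rat_lattice \<Rightarrow> 'v" "(*) :: rat \<Rightarrow> rat \<Rightarrow> rat"
  by unfold_locales (auto simp: algebra_simps)

lemma dual_add: "f \<in> dual L \<Longrightarrow> x \<in> L \<Longrightarrow> y \<in> L \<Longrightarrow> f (x + y) = f x + f y"
  and dual_scale: "f \<in> dual L \<Longrightarrow> x \<in> L \<Longrightarrow> f (c *\<^sub>Q x) = c * f x"
  and dual_outside: "f \<in> dual L \<Longrightarrow> x \<notin> L \<Longrightarrow> f x = 0"
  by (auto simp: dual_def)

lemma dual_zero: "f \<in> dual L \<Longrightarrow> Q.subspace L \<Longrightarrow> f 0 = 0"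
  using dual_scale[of f L 0 0] Q.subspace_0[of L] by simp

lemma dual_diff:
  assumes "f \<in> dual L" "Q.subspace L" "x \<in> L" "y \<in> L"
  shows "f (x - y) = f x - f y"
  using dual_add[OF assms(1) Q.subspace_diff[OF assms(2-4)] assms(4)] by simp

lemma dual_eqI:
  assumes f: "f \<in> dual (Q.span S)" and g: "g \<in> dual (Q.span S)"
    and eq: "\<And>s. s \<in> S \<Longrightarrow> f s = g s"
  shows "f = g"
proof
  fix x
  show "f x = g x"
  proof (cases "x \<in> Q.span S")
    case True
    then have "x \<in> Q.span S \<and> f x = g x"
    proof (induction rule: Q.span_induct_alt)
      case base
      then show ?case using dual_zero[OF f] dual_zero[OF g] by (simp add: Q.span_zero)
    next
      case (step c x y)
      then have x: "x \<in> Q.span S" by (simp add: Q.span_base)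
      show ?case
        using step x eq[OF step(1)]
        by (simp add: Q.span_add Q.span_scale dual_add[OF f] dual_add[OF g] dual_scale[OF f]
            dual_scale[OF g])
    qed
    then show ?thesis by simp
  qed (simp add: dual_outside[OF f] dual_outside[OF g])
qed

lemma dual_lincomb:
  assumes "f \<in> dual L" "Q.subspace L" "\<And>x. x \<in> S \<Longrightarrow> x \<in> L"
  shows "f (\<Sum>x\<in>S. c x *\<^sub>Q x) = (\<Sum>x\<in>S. c x * f x)"
  using assms(3)
  by (induction S rule: infinite_finite_induct)
    (auto simp: dual_zero[OF assms(1,2)] assms dual_add[OF assms(1)] dual_scale[OF assms(1)] Q.subspace_sum
      Q.subspace_scale)

lemma restr_dual:
  "f \<in> dual L' \<Longrightarrow> L \<subseteq> L' \<Longrightarrow> Q.subspace L \<Longrightarrow> restr L f \<in> dual L"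
  by (auto simp: dual_def restr_def Q.subspace_add Q.subspace_scale subset_iff)

lemma restr_dual_UNIV: "f \<in> dual UNIV \<Longrightarrow> restr (Q.span S) f \<in> dual (Q.span S)"
  by (rule restr_dual) auto

lemma dual_lin: "f \<in> dual L \<Longrightarrow> g \<in> dual L \<Longrightarrow> (\<lambda>x. f x + g x) \<in> dual L"
  "f \<in> dual L \<Longrightarrow> (\<lambda>x. c * f x) \<in> dual L"
  by (auto simp: dual_def distrib_left mult.left_commute add.assoc add.left_commute)

lemma functional_exists:
  assumes "Q.independent S"
  shows "\<exists>m\<in>dual UNIV. \<forall>s\<in>S. m s = g s"
proof -
  obtain m where m: "Vector_Spaces.linear scaleQ (*) m" "\<forall>s\<in>S. m s = g s"
    using QR.linear_independent_extend[OF assms] by blast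
  interpret Vector_Spaces.linear scaleQ "(*)" m by (rule m)
  have "m \<in> dual UNIV" by (auto simp: dual_def add scale)
  with m show ?thesis by blast
qed

text \<open>
  Extend a basis of \<open>L\<close> by \<open>v\<close>; the coordinate of \<open>v\<close> is such a functional.
\<close>

lemma separating_functional:
  assumes L: "Q.subspace L" and v: "v \<notin> L"
  shows "\<exists>m\<in>dual UNIV. m v = 1 \<and> (\<forall>x\<in>L. m x = 0)"
proof -
  obtain B where B: "B \<subseteq> L" "Q.independent B" "L \<subseteq> Q.span B"
    by (rule Q.maximal_independent_subset)
  have LB: "L = Q.span B" using B Q.span_minimal[OF B(1) L] by auto
  have "Q.independent (insert v B)"
    using B v LB by (simp add: Q.independent_insert)
  from functional_exists[OF this, of "\<lambda>x. if x = v then 1 else 0"] obtain m where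
    m: "m \<in> dual UNIV" "\<forall>s\<in>insert v B. m s = (if s = v then 1 else 0)" by blast
  have "m x = 0" if "x \<in> L" for x
  proof -
    have "restr (Q.span B) m = (\<lambda>_. 0)"
      using m v B(1) by (intro dual_eqI[OF restr_dual_UNIV])
        (auto simp: dual_def restr_def Q.span_base)
    then show ?thesis using that LB by (auto simp: restr_def fun_eq_iff split: if_splits)
  qed
  with m show ?thesis by auto
qed

lemma cone_hull_empty [simp]: "cone_hull {} = {0}"
  by (auto simp: cone_hull_def)

lemma cone_hull_singleton: "cone_hull {v} = {c *\<^sub>Q v | c. 0 \<le> c}"
proof -
  have "c *\<^sub>Q v \<in> cone_hull {v}" if "0 \<le> c" for c
    unfolding cone_hull_def using that by (intro CollectI exI[of _ "\<lambda>_. c"]) simp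
  then show ?thesis by (auto simp: cone_hull_def)
qed

lemma cone_hull_insert:
  assumes "finite S" "v \<notin> S"
  shows "cone_hull (insert v S) = cone_hull {v} + cone_hull S"
proof (intro equalityI subsetI)
  fix x assume "x \<in> cone_hull (insert v S)"
  then obtain c where c: "x = (\<Sum>s\<in>insert v S. c s *\<^sub>Q s)" "\<forall>s\<in>insert v S. 0 \<le> c s"
    by (auto simp: cone_hull_def)
  then have "x = c v *\<^sub>Q v + (\<Sum>s\<in>S. c s *\<^sub>Q s)" using assms by simp
  moreover have "c v *\<^sub>Q v \<in> cone_hull {v}" "(\<Sum>s\<in>S. c s *\<^sub>Q s) \<in> cone_hull S"
    using c by (auto simp: cone_hull_def)
  ultimately show "x \<in> cone_hull {v} + cone_hull S" by (auto simp: set_plus_def)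
next
  fix x assume "x \<in> cone_hull {v} + cone_hull S"
  then obtain a c where x: "x = a *\<^sub>Q v + (\<Sum>s\<in>S. c s *\<^sub>Q s)" "0 \<le> a" "\<forall>s\<in>S. 0 \<le> c s"
    unfolding set_plus_def cone_hull_singleton by (auto simp: cone_hull_def)
  have "(\<Sum>s\<in>S. (c(v := a)) s *\<^sub>Q s) = (\<Sum>s\<in>S. c s *\<^sub>Q s)"
    using assms by (intro sum.cong) auto
  then have "x = (\<Sum>s\<in>insert v S. (c(v := a)) s *\<^sub>Q s)"
    using assms x by simp
  then show "x \<in> cone_hull (insert v S)"
    unfolding cone_hull_def using x assms by (intro CollectI exI[of _ "c(v := a)"]) auto
qed

lemma minkowski_sum_rays: "finite S \<Longrightarrow> (\<Sum>s\<in>S. cone_hull {s}) = cone_hull S"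
proof (induction S rule: finite_induct)
  case (insert x S)
  then show ?case using cone_hull_insert[of S x] by simp
qed simp

lemma cone_hull_subset_span: "cone_hull S \<subseteq> Q.span S"
  by (auto simp: cone_hull_def intro!: Q.span_sum[OF Q.span_scale[OF Q.span_base]])

lemma cone_hull_mono: "finite S \<Longrightarrow> T \<subseteq> S \<Longrightarrow> cone_hull T \<subseteq> cone_hull S"
proof
  fix x assume S: "finite S" "T \<subseteq> S" and "x \<in> cone_hull T"
  then obtain c where c: "x = (\<Sum>s\<in>T. c s *\<^sub>Q s)" "\<forall>s\<in>T. 0 \<le> c s"
    by (auto simp: cone_hull_def)
  have "x = (\<Sum>s\<in>S. (if s \<in> T then c s else 0) *\<^sub>Q s)"
    unfolding c(1) by (rule sum.mono_neutral_cong_left) (use S in auto)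
  then show "x \<in> cone_hull S" unfolding cone_hull_def
    using c by (intro CollectI exI[of _ "\<lambda>s. if s \<in> T then c s else 0"]) auto
qed

lemma generator_in_cone_hull: "finite S \<Longrightarrow> s \<in> S \<Longrightarrow> s \<in> cone_hull S"
proof -
  assume S: "finite S" "s \<in> S"
  have "s \<in> cone_hull {s}" by (auto simp: cone_hull_singleton intro!: exI[of _ 1])
  then show ?thesis using cone_hull_mono[of S "{s}"] S by auto
qed

lemma span_cone_hull: "finite S \<Longrightarrow> Q.span (cone_hull S) = Q.span S"
  using Q.span_mono[of S "cone_hull S"] generator_in_cone_hull[of S]
    Q.span_minimal[OF cone_hull_subset_span Q.subspace_span, of S]
  by (intro equalityI) auto

text \<open>
  On the cone, a supporting functional is a sum of nonnegative terms, one for each generator; it vanishes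
  only if all generators that occur lie in its kernel.
\<close>

lemma face_of_cone_hull:
  assumes S: "finite S" and face: "cone_face \<sigma> (cone_hull S)"
  shows "\<exists>T\<subseteq>S. \<sigma> = cone_hull T"
proof -
  obtain m where m: "m \<in> dual UNIV" "\<forall>v\<in>cone_hull S. 0 \<le> m v" "\<sigma> = {v\<in>cone_hull S. m v = 0}"
    using face by (auto simp: cone_face_def)
  let ?T = "{s\<in>S. m s = 0}"
  have "\<sigma> = cone_hull ?T"
  proof (intro equalityI subsetI)
    fix x assume "x \<in> \<sigma>"
    then obtain c where c: "x = (\<Sum>s\<in>S. c s *\<^sub>Q s)" "\<forall>s\<in>S. 0 \<le> c s" and x0: "m x = 0"
      using m(3) by (auto simp: cone_hull_def)
    have "(\<Sum>s\<in>S. c s * m s) = 0"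
      using x0 dual_lincomb[OF m(1), of S c] c(1) by simp
    moreover have "\<forall>s\<in>S. 0 \<le> c s * m s"
      using c m(2) generator_in_cone_hull[OF S] by simp
    ultimately have "\<forall>s\<in>S. c s * m s = 0"
      using sum_nonneg_eq_0_iff[OF S, of "\<lambda>s. c s * m s"] by simp
    then have "x = (\<Sum>s\<in>?T. c s *\<^sub>Q s)"
      unfolding c(1) using S by (intro sum.mono_neutral_right) auto
    then show "x \<in> cone_hull ?T" using c by (auto simp: cone_hull_def)
  next
    fix x assume x: "x \<in> cone_hull ?T"
    then obtain c where c: "x = (\<Sum>s\<in>?T. c s *\<^sub>Q s)" by (auto simp: cone_hull_def)
    have "m x = 0" unfolding c using dual_lincomb[OF m(1), of ?T c] by simp
    then show "x \<in> \<sigma>" using x cone_hull_mono[OF S, of ?T] m(3) by auto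
  qed
  then show ?thesis by (intro exI[of _ ?T]) auto
qed

text \<open>
  For independent generators, the functional that is \<open>0\<close> on \<open>T\<close> and \<open>1\<close> on the other generators cuts out
  the face.
\<close>

lemma cone_hull_face:
  assumes S: "finite S" "Q.independent S" "T \<subseteq> S"
  shows "cone_face (cone_hull T) (cone_hull S)"
proof -
  obtain m where m: "m \<in> dual UNIV" "\<forall>s\<in>S. m s = (if s \<in> T then 0 else 1)"
    using functional_exists[OF S(2), of "\<lambda>s. if s \<in> T then 0 else 1"] by blast
  have val: "m (\<Sum>s\<in>S. c s *\<^sub>Q s) = (\<Sum>s\<in>S. if s \<in> T then 0 else c s)" for c
    using dual_lincomb[OF m(1), of S c] m(2) by (simp add: if_distrib cong: if_cong)
  have pos: "\<forall>v\<in>cone_hull S. 0 \<le> m v"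
    by (auto simp: cone_hull_def val intro!: sum_nonneg)
  have "cone_hull T = {v\<in>cone_hull S. m v = 0}"
  proof (intro equalityI subsetI)
    fix x assume x: "x \<in> cone_hull T"
    then obtain c where c: "x = (\<Sum>s\<in>T. c s *\<^sub>Q s)" by (auto simp: cone_hull_def)
    have "m x = 0" unfolding c using dual_lincomb[OF m(1), of T c] m(2) S(3)
      by (auto intro!: sum.neutral)
    then show "x \<in> {v\<in>cone_hull S. m v = 0}" using x cone_hull_mono[OF S(1,3)] by auto
  next
    fix x assume "x \<in> {v\<in>cone_hull S. m v = 0}"
    then obtain c where c: "x = (\<Sum>s\<in>S. c s *\<^sub>Q s)" "\<forall>s\<in>S. 0 \<le> c s" and x0: "m x = 0"
      by (auto simp: cone_hull_def)
    have "(\<Sum>s\<in>S. if s \<in> T then 0 else c s) = 0" using x0 val c(1) by simp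
    then have "\<forall>s\<in>S. (if s \<in> T then 0 else c s) = 0"
      using sum_nonneg_eq_0_iff[OF S(1), of "\<lambda>s. if s \<in> T then 0 else c s"] c(2) by auto
    then have "x = (\<Sum>s\<in>T. c s *\<^sub>Q s)"
      unfolding c(1) using S by (intro sum.mono_neutral_right) auto
    then show "x \<in> cone_hull T" using c S(3) by (auto simp: cone_hull_def)
  qed
  with pos show ?thesis unfolding cone_face_def by (intro bexI[OF _ m(1)] conjI)
qed

section \<open>Primitive lattice vectors and lattice indices\<close>

lemma int_span_zero: "0 \<in> int_span S"
  unfolding int_span_def by (intro CollectI exI[of _ "\<lambda>_. 0"]) simp

lemma int_span_diff: "x \<in> int_span S \<Longrightarrow> y \<in> int_span S \<Longrightarrow> x - y \<in> int_span S"
proof -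
  assume "x \<in> int_span S" "y \<in> int_span S"
  then obtain c d where "x = (\<Sum>s\<in>S. of_int (c s) *\<^sub>Q s)" "y = (\<Sum>s\<in>S. of_int (d s) *\<^sub>Q s)"
    by (auto simp: int_span_def)
  then have "x - y = (\<Sum>s\<in>S. of_int (c s - d s) *\<^sub>Q s)"
    by (simp add: sum_subtractf Q.scale_left_diff_distrib)
  then show ?thesis unfolding int_span_def by (intro CollectI exI[of _ "\<lambda>s. c s - d s"]) simp
qed

lemma int_span_minus: "x \<in> int_span S \<Longrightarrow> - x \<in> int_span S"
  using int_span_diff[OF int_span_zero, of x S] by simp

lemma int_span_add: "x \<in> int_span S \<Longrightarrow> y \<in> int_span S \<Longrightarrow> x + y \<in> int_span S"
  using int_span_diff[OF _ int_span_minus, of x S y] by simp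

lemma int_span_scale: "x \<in> int_span S \<Longrightarrow> of_int k *\<^sub>Q x \<in> int_span S"
proof -
  assume "x \<in> int_span S"
  then obtain c where "x = (\<Sum>s\<in>S. of_int (c s) *\<^sub>Q s)" by (auto simp: int_span_def)
  then have "of_int k *\<^sub>Q x = (\<Sum>s\<in>S. of_int (k * c s) *\<^sub>Q s)" by (simp add: Q.scale_sum_right)
  then show ?thesis unfolding int_span_def by (intro CollectI exI[of _ "\<lambda>s. k * c s"]) simp
qed

lemma int_span_insert:
  assumes "finite S" "v \<notin> S"
  shows "int_span (insert v S) = {of_int k *\<^sub>Q v + h | k h. h \<in> int_span S}"
proof (intro equalityI subsetI)
  fix x assume "x \<in> int_span (insert v S)"
  then obtain c where c: "x = (\<Sum>s\<in>insert v S. of_int (c s) *\<^sub>Q s)" by (auto simp: int_span_def)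
  then have "x = of_int (c v) *\<^sub>Q v + (\<Sum>s\<in>S. of_int (c s) *\<^sub>Q s)" using assms by simp
  then show "x \<in> {of_int k *\<^sub>Q v + h | k h. h \<in> int_span S}"
    by (auto simp: int_span_def)
next
  fix x assume "x \<in> {of_int k *\<^sub>Q v + h | k h. h \<in> int_span S}"
  then obtain a c where x: "x = of_int a *\<^sub>Q v + (\<Sum>s\<in>S. of_int (c s) *\<^sub>Q s)"
    by (auto simp: int_span_def)
  have "(\<Sum>s\<in>S. of_int ((c(v := a)) s) *\<^sub>Q s) = (\<Sum>s\<in>S. of_int (c s) *\<^sub>Q s)"
    using assms by (intro sum.cong) auto
  then have "x = (\<Sum>s\<in>insert v S. of_int ((c(v := a)) s) *\<^sub>Q s)"
    using assms x by simp
  then show "x \<in> int_span (insert v S)"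
    unfolding int_span_def by (intro CollectI exI[of _ "c(v := a)"]) simp
qed

lemma int_span_subset_span: "int_span S \<subseteq> Q.span S"
  by (auto simp: int_span_def intro!: Q.span_sum[OF Q.span_scale[OF Q.span_base]])

lemmas int_points_zero = int_span_zero[of LBasis, folded int_points_def]
  and int_points_add = int_span_add[of _ LBasis, folded int_points_def]
  and int_points_diff = int_span_diff[of _ LBasis, folded int_points_def]
  and int_points_scale = int_span_scale[of _ LBasis, folded int_points_def]

lemma common_denominator:
  fixes c :: "'x \<Rightarrow> rat"
  assumes "finite S"
  shows "\<exists>d::int. 0 < d \<and> (\<forall>s\<in>S. of_int d * c s \<in> \<int>)"
  using assms
proof (induction S rule: finite_induct)
  case empty
  show ?case by (intro exI[of _ 1]) simp
next
  case (insert x S)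
  then obtain d where d: "0 < d" "\<forall>s\<in>S. of_int d * c s \<in> \<int>" by blast
  obtain a b where ab: "c x = of_int a / of_int b" "b > 0"
    using quotient_of_div[of "c x"] quotient_of_denom_pos[of "c x"]
    by (metis surj_pair)
  have "of_int (b * d) * c s \<in> \<int>" if "s \<in> insert x S" for s
  proof (cases "s = x")
    case True
    have "of_int (b * d) * c x = of_int (d * a)" using ab by simp
    then show ?thesis unfolding True by (simp only: Ints_of_int)
  next
    case False
    then have "of_int d * c s \<in> \<int>" using d that by blast
    then have "of_int b * (of_int d * c s) \<in> \<int>" by (rule Ints_mult[OF Ints_of_int])
    then show ?thesis by (simp only: of_int_mult mult.assoc)
  qed
  then show ?case using ab d by (intro exI[of _ "b * d"]) simp
qed

lemma int_multiple_exists: "\<exists>d::int. 0 < d \<and> of_int d *\<^sub>Q x \<in> int_points"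
proof -
  obtain c where c: "x = (\<Sum>b\<in>LBasis. c b *\<^sub>Q b)"
    using ex1_implies_ex[OF LBasis_expansion[of x]] by blast
  obtain d :: int where d: "0 < d" "\<forall>b\<in>LBasis. of_int d * c b \<in> \<int>"
    using common_denominator[OF finite_LBasis] by blast
  have "of_int d *\<^sub>Q x = (\<Sum>b\<in>LBasis. (of_int d * c b) *\<^sub>Q b)"
    by (simp add: c Q.scale_sum_right)
  also have "\<dots> = (\<Sum>b\<in>LBasis. of_int \<lfloor>of_int d * c b\<rfloor> *\<^sub>Q b)"
    using d by (intro sum.cong refl) (metis Ints_cases floor_of_int)
  also have "\<dots> \<in> int_points" by (auto simp: int_points_def int_span_def)
  finally show ?thesis using d by blast
qed

lemma bounded_denominators:
  assumes m: "m \<in> dual UNIV"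
  shows "\<exists>d::int. 0 < d \<and> (\<forall>x\<in>int_points. of_int d * m x \<in> \<int>)"
proof -
  obtain d :: int where d: "0 < d" "\<forall>b\<in>LBasis. of_int d * m b \<in> \<int>"
    using common_denominator[OF finite_LBasis] by blast
  have "of_int d * m x \<in> \<int>" if x: "x \<in> int_points" for x
  proof -
    obtain c where c: "x = (\<Sum>b\<in>LBasis. of_int (c b) *\<^sub>Q b)"
      using x by (auto simp: int_points_def int_span_def)
    have "of_int d * m x = (\<Sum>b\<in>LBasis. of_int (c b) * (of_int d * m b))"
      unfolding c dual_lincomb[OF m Q.subspace_UNIV UNIV_I] sum_distrib_left
      by (intro sum.cong refl) simp
    also have "\<dots> \<in> \<int>" by (rule Ints_sum, rule Ints_mult[OF Ints_of_int]) (rule d(2)[rule_format])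
    finally show ?thesis .
  qed
  then show ?thesis using d by blast
qed

lemma scale_in_subspace_iff:
  "Q.subspace L \<Longrightarrow> v \<notin> L \<Longrightarrow> c *\<^sub>Q v \<in> L \<longleftrightarrow> c = 0"
  using Q.subspace_scale[of L "c *\<^sub>Q v" "inverse c"] by (cases "c = 0") (auto simp: Q.subspace_0)

text \<open>
  The \<open>v\<close>-coordinates, modulo \<open>L\<close>, of the lattice points in \<open>L + \<rat> v\<close> form a group that is nonzero, because
  a multiple of \<open>v\<close> is a lattice point, and has bounded denominators; so it is generated by its least
  positive element \<open>q\<close>.  The lattice points with coordinate \<open>q\<close> are those that map to the
  primitive generator of the ray of \<open>v\<close> in the quotient by \<open>L\<close> (\<open>primitive_mod_iff\<close>).  Both \<open>ray_gen\<close>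
  (with \<open>L = 0\<close>) and \<open>normal_rep\<close> (with \<open>L\<close> the span of a facet) are found in this way.
\<close>

lemma primitive_coordinate:
  assumes L: "Q.subspace L" and v: "v \<notin> L"
  shows "\<exists>q>0. (\<exists>n\<in>int_points. n - q *\<^sub>Q v \<in> L) \<and>
    (\<forall>n\<in>int_points. \<forall>c. n - c *\<^sub>Q v \<in> L \<longrightarrow> (\<exists>k::int. c = of_int k * q))"
proof -
  obtain u where u: "u \<in> dual UNIV" "u v = 1" "\<forall>x\<in>L. u x = 0"
    using separating_functional[OF L v] by blast
  define G where "G = {c. \<exists>n\<in>int_points. n - c *\<^sub>Q v \<in> L}"
  have u_coord: "u n = c" if "n - c *\<^sub>Q v \<in> L" for n c
    using u that dual_diff[OF u(1), of n "c *\<^sub>Q v"] dual_scale[OF u(1), of v c] by auto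
  obtain d :: int where d: "0 < d" "\<forall>x\<in>int_points. of_int d * u x \<in> \<int>"
    using bounded_denominators[OF u(1)] by blast
  have Gd: "of_int d * c \<in> \<int>" if "c \<in> G" for c
    using that d u_coord by (auto simp: G_def)
  have G_sub: "a - of_int k * b \<in> G" if "a \<in> G" "b \<in> G" for a b k
  proof -
    obtain x y where xy: "x \<in> int_points" "x - a *\<^sub>Q v \<in> L" "y \<in> int_points" "y - b *\<^sub>Q v \<in> L"
      using \<open>a \<in> G\<close> \<open>b \<in> G\<close> by (auto simp: G_def)
    have "(x - a *\<^sub>Q v) - of_int k *\<^sub>Q (y - b *\<^sub>Q v) \<in> L"
      by (intro Q.subspace_diff[OF L] Q.subspace_scale[OF L] xy)
    also have "(x - a *\<^sub>Q v) - of_int k *\<^sub>Q (y - b *\<^sub>Q v) =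
        (x - of_int k *\<^sub>Q y) - (a - of_int k * b) *\<^sub>Q v"
      by (simp add: Q.scale_right_diff_distrib Q.scale_left_diff_distrib)
    finally show ?thesis using int_points_diff[OF xy(1) int_points_scale[OF xy(3)]]
      by (auto simp: G_def)
  qed
  obtain N :: int where N: "0 < N" "of_int N *\<^sub>Q v \<in> int_points"
    using int_multiple_exists by blast
  have NG: "of_int N \<in> G"
    using N Q.subspace_0[OF L] by (auto simp: G_def intro!: bexI[of _ "of_int N *\<^sub>Q v"])
  \<comment> \<open>the positive elements of \<open>G\<close> have bounded denominators, so there is a least one\<close>
  define P where "P j \<longleftrightarrow> 0 < j \<and> of_nat j / of_int d \<in> G" for j :: nat
  have "P (nat (d * N))" using NG N d by (simp add: P_def)
  then have P: "P (LEAST j. P j)" by (rule LeastI)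
  define j where "j = (LEAST j. P j)"
  define q where "q = (of_nat j / of_int d :: rat)"
  have j: "0 < j" "q \<in> G" using P by (auto simp: j_def P_def q_def)
  have q: "q > 0" using j d by (simp add: q_def)
  have mult: "\<exists>k::int. c = of_int k * q" if c_G: "c \<in> G" for c
  proof -
    obtain e :: int where e: "of_int d * c = of_int e"
      using Gd[OF c_G] by (auto elim: Ints_cases)
    then have c: "c = of_int e / of_int d" using d by (simp add: field_simps)
    have "of_int (e mod int j) / of_int d = c - of_int (e div int j) * q"
    proof -
      define a r where "a = e div int j" and "r = e mod int j"
      have "e = a * int j + r" by (simp add: a_def r_def)
      then have "of_int e = (of_int a * of_nat j + of_int r :: rat)" by simp
      then show ?thesis
        unfolding c q_def a_def[symmetric] r_def[symmetric] by (simp add: add_divide_distrib)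
    qed
    then have "of_int (e mod int j) / of_int d \<in> G" using G_sub[OF c_G j(2)] by simp
    then have "P (nat (e mod int j))" if "0 < e mod int j" using that by (simp add: P_def)
    moreover have "nat (e mod int j) < j"
      using pos_mod_bound[of "int j" e] j(1) by (simp add: nat_less_iff)
    then have "\<not> P (nat (e mod int j))" unfolding j_def by (rule not_less_Least)
    ultimately have "\<not> 0 < e mod int j" by blast
    moreover have "0 \<le> e mod int j" using j(1) by simp
    ultimately have "e mod int j = 0" by linarith
    then obtain k where "e = int j * k" by auto
    then have "c = of_int k * q" by (simp add: c q_def)
    then show ?thesis by blast
  qed
  show ?thesis using q j(2) mult by (intro exI[of _ q] conjI) (auto simp: G_def)
qed

lemma primitive_mod_iff:
  assumes L: "Q.subspace L" and v: "v \<notin> L" and q: "0 < q"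
    and ex: "\<exists>n\<in>int_points. n - q *\<^sub>Q v \<in> L"
    and mult: "\<forall>n\<in>int_points. \<forall>c. n - c *\<^sub>Q v \<in> L \<longrightarrow> (\<exists>k::int. c = of_int k * q)"
    and n: "n \<in> int_points" "n - c *\<^sub>Q v \<in> L"
  shows "primitive_mod L n \<longleftrightarrow> \<bar>c\<bar> = q"
proof
  assume prim: "primitive_mod L n"
  obtain n0 where n0: "n0 \<in> int_points" "n0 - q *\<^sub>Q v \<in> L" using ex by blast
  obtain k :: int where k: "c = of_int k * q" using mult n by blast
  have "(n - c *\<^sub>Q v) - of_int k *\<^sub>Q (n0 - q *\<^sub>Q v) \<in> L"
    by (intro Q.subspace_diff[OF L] Q.subspace_scale[OF L] n n0)
  then have "n - of_int k *\<^sub>Q n0 \<in> L"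
    by (simp add: k Q.scale_right_diff_distrib)
  then have "\<bar>k\<bar> = 1" using prim n0 by (auto simp: primitive_mod_def)
  then show "\<bar>c\<bar> = q" using q by (auto simp: k abs_mult simp flip: of_int_abs)
next
  assume c: "\<bar>c\<bar> = q"
  have "\<bar>k\<bar> = 1" if n': "n' \<in> int_points" "n - of_int k *\<^sub>Q n' \<in> L" for k :: int and n'
  proof (cases "k = 0")
    case True
    then have "c *\<^sub>Q v \<in> L" using Q.subspace_diff[OF L n'(2) n(2)] by simp
    then show ?thesis using c q scale_in_subspace_iff[OF L v] by simp
  next
    case False
    have "(1 / of_int k) *\<^sub>Q ((n - c *\<^sub>Q v) - (n - of_int k *\<^sub>Q n')) \<in> L"
      by (intro Q.subspace_diff[OF L] Q.subspace_scale[OF L] n n')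
    then have "n' - (c / of_int k) *\<^sub>Q v \<in> L"
      using False by (simp add: Q.scale_right_diff_distrib)
    then obtain i :: int where i: "c / of_int k = of_int i * q" using mult n'(1) by blast
    have "c = of_int k * (c / of_int k)" using False by simp
    also have "\<dots> = of_int (k * i) * q" by (simp only: i of_int_mult mult.assoc)
    finally have "c = of_int (k * i) * q" .
    then have "q = of_int \<bar>k * i\<bar> * q" using c q by (simp add: abs_mult)
    then have "of_int \<bar>k * i\<bar> = (1::rat)" using q by (metis mult_cancel_right1 less_irrefl)
    then have "\<bar>k * i\<bar> = 1" by (simp only: of_int_eq_1_iff)
    then show ?thesis by (auto simp: abs_mult zmult_eq_1_iff)
  qed
  then show "primitive_mod L n" using n by (auto simp: primitive_mod_def)
qed

lemma ray_gen_cone_hull: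
  assumes v: "v \<noteq> 0"
  shows "\<exists>q>0. ray_gen (cone_hull {v}) = q *\<^sub>Q v \<and> q *\<^sub>Q v \<in> int_points \<and> primitive_mod {0} (q *\<^sub>Q v)"
proof -
  have L: "Q.subspace {0}" "v \<notin> {0}" using v by auto
  obtain q where q: "q > 0" "\<exists>n\<in>int_points. n - q *\<^sub>Q v \<in> {0}"
    "\<forall>n\<in>int_points. \<forall>c. n - c *\<^sub>Q v \<in> {0} \<longrightarrow> (\<exists>k::int. c = of_int k * q)"
    using primitive_coordinate[OF L] by blast
  note prim = primitive_mod_iff[OF L q]
  have qv: "q *\<^sub>Q v \<in> int_points" using q(2) by auto
  have p: "primitive_mod {0} (q *\<^sub>Q v)" using prim[OF qv, of q] q(1) by simp
  have "ray_gen (cone_hull {v}) = q *\<^sub>Q v"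
    unfolding ray_gen_def
  proof (rule the_equality)
    show "q *\<^sub>Q v \<in> cone_hull {v} \<and> primitive_mod {0} (q *\<^sub>Q v)"
      using p q(1) by (auto simp: cone_hull_singleton)
  next
    fix n assume n: "n \<in> cone_hull {v} \<and> primitive_mod {0} n"
    then obtain c where c: "n = c *\<^sub>Q v" "0 \<le> c" by (auto simp: cone_hull_singleton)
    have "n \<in> int_points" using n by (simp add: primitive_mod_def)
    then have "\<bar>c\<bar> = q" using prim[of n c] n c by simp
    then show "n = q *\<^sub>Q v" using c by simp
  qed
  then show ?thesis using q(1) qv p by blast
qed

text \<open>
  Division with remainder of the \<open>v\<close>-coordinate, which lies in \<open>\<int> / k\<close>: modulo the lattice generated by
  \<open>v\<close> and \<open>S\<close>, each lattice point in the span is \<open>x + i n\<^sub>0\<close> with a unique digit \<open>i < k\<close> and \<open>x\<close> in the span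
  of \<open>S\<close>, the latter unique modulo the lattice generated by \<open>S\<close>.
\<close>

lemma index_insert:
  assumes S: "finite S" "v \<notin> Q.span S" and k: "0 < k"
    and n0: "n0 \<in> int_points" "n0 - (1 / of_nat k) *\<^sub>Q v \<in> Q.span S"
    and mult: "\<forall>n\<in>int_points. \<forall>c. n - c *\<^sub>Q v \<in> Q.span S \<longrightarrow> (\<exists>j::int. c = of_int j * (1 / of_nat k))"
    and v: "v \<in> int_points"
  shows "card (rcosets\<^bsub>\<lparr>carrier = int_points \<inter> Q.span (insert v S), mult = (+), one = 0\<rparr>\<^esub>
      (int_span (insert v S))) =
    k * card (rcosets\<^bsub>\<lparr>carrier = int_points \<inter> Q.span S, mult = (+), one = 0\<rparr>\<^esub> (int_span S))"
proof -
  let ?cos = "\<lambda>H x. (\<lambda>h. h + x) ` H"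
  have rc: "rcosets\<^bsub>\<lparr>carrier = X, mult = (+), one = 0\<rparr>\<^esub> H = ?cos H ` X" for X H :: "'a set"
    by (auto simp: RCOSETS_def r_coset_def image_def)
  have vS: "v \<notin> S" using S Q.span_base by auto
  let ?H = "int_span S" and ?H' = "int_span (insert v S)"
  have cos_eq: "?cos (int_span T) x = ?cos (int_span T) y \<longleftrightarrow> x - y \<in> int_span T" for T and x y :: 'a
  proof
    assume "?cos (int_span T) x = ?cos (int_span T) y"
    moreover have "x \<in> ?cos (int_span T) x" using int_span_zero[of T] by (auto simp: image_iff intro!: bexI[of _ 0])
    ultimately obtain h where "h \<in> int_span T" "x = h + y" by auto
    then show "x - y \<in> int_span T" by simp
  next
    have sub: "?cos (int_span T) x \<subseteq> ?cos (int_span T) y" if "x - y \<in> int_span T" for x y :: 'a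
    proof
      fix z assume "z \<in> ?cos (int_span T) x"
      then obtain h where h: "h \<in> int_span T" "z = h + x" by auto
      then have "z = (h + (x - y)) + y" by simp
      then show "z \<in> ?cos (int_span T) y" using int_span_add[OF h(1) that] by blast
    qed
    assume "x - y \<in> int_span T"
    then show "?cos (int_span T) x = ?cos (int_span T) y"
      using sub[of x y] sub[of y x] int_span_minus[of "x - y" T] by auto
  qed
  have HH': "?H \<subseteq> ?H'"
  proof
    fix h assume "h \<in> ?H"
    then have "h = of_int 0 *\<^sub>Q v + h \<and> h \<in> ?H" by simp
    then show "h \<in> ?H'" unfolding int_span_insert[OF S(1) vS] by blast
  qed
  \<comment> \<open>\<open>F\<close> sends the coset of \<open>x\<close> and the digit \<open>i\<close> to the coset of \<open>x + i n\<^sub>0\<close>\<close>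
  define F where "F = (\<lambda>(A, i::nat). {h + (a + of_nat i *\<^sub>Q n0) | h a. h \<in> ?H' \<and> a \<in> A})"
  have F: "F (?cos ?H x, i) = ?cos ?H' (x + of_nat i *\<^sub>Q n0)" for x i
  proof (intro equalityI subsetI)
    fix z assume "z \<in> F (?cos ?H x, i)"
    then obtain h h2 where h: "h \<in> ?H'" "h2 \<in> ?H" "z = h + ((h2 + x) + of_nat i *\<^sub>Q n0)"
      unfolding F_def by auto
    then have "z = (h + h2) + (x + of_nat i *\<^sub>Q n0)" by (simp add: add.assoc)
    moreover have "h + h2 \<in> ?H'" using h HH' int_span_add by blast
    ultimately show "z \<in> ?cos ?H' (x + of_nat i *\<^sub>Q n0)" by blast
  next
    fix z assume "z \<in> ?cos ?H' (x + of_nat i *\<^sub>Q n0)"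
    then obtain h where h: "h \<in> ?H'" "z = h + (x + of_nat i *\<^sub>Q n0)" by auto
    moreover have "x \<in> ?cos ?H x" using int_span_zero[of S] by (auto simp: image_iff intro!: bexI[of _ 0])
    ultimately show "z \<in> F (?cos ?H x, i)" unfolding F_def by auto
  qed
  let ?N = "int_points \<inter> Q.span S" and ?N' = "int_points \<inter> Q.span (insert v S)"
  have "F ` (?cos ?H ` ?N \<times> {..<k}) = ?cos ?H' ` ?N'"
  proof (intro equalityI subsetI)
    fix z assume "z \<in> F ` (?cos ?H ` ?N \<times> {..<k})"
    then obtain x i where x: "x \<in> ?N" "z = ?cos ?H' (x + of_nat i *\<^sub>Q n0)" using F by auto
    have "(x + of_nat i *\<^sub>Q n0) - (of_nat i * (1 / of_nat k)) *\<^sub>Q v =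
      x + of_nat i *\<^sub>Q (n0 - (1 / of_nat k) *\<^sub>Q v)" by (simp add: Q.scale_right_diff_distrib)
    also have "\<dots> \<in> Q.span S" using x n0 by (intro Q.span_add Q.span_scale) auto
    finally have "x + of_nat i *\<^sub>Q n0 \<in> Q.span (insert v S)" by (auto simp: Q.span_breakdown_eq)
    moreover have "x + of_nat i *\<^sub>Q n0 \<in> int_points"
      using int_points_add[OF _ int_points_scale[OF n0(1), of "int i"], of x] x by simp
    ultimately show "z \<in> ?cos ?H' ` ?N'" using x(2) by blast
  next
    fix z assume "z \<in> ?cos ?H' ` ?N'"
    then obtain y where y: "y \<in> int_points" "y \<in> Q.span (insert v S)" "z = ?cos ?H' y" by auto
    obtain c where c: "y - c *\<^sub>Q v \<in> Q.span S" using y(2) by (auto simp: Q.span_breakdown_eq)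
    obtain l :: int where l: "c = of_int l * (1 / of_nat k)" using mult y(1) c by blast
    define i where "i = nat (l mod int k)"
    define j where "j = l div int k"
    have i: "int i = l mod int k" "i < k" using k by (auto simp: i_def nat_less_iff)
    have lij: "l = j * int k + int i" by (simp add: i j_def)
    have cij: "c = of_int j + of_nat i * (1 / of_nat k)" unfolding l lij using k by (simp add: field_simps)
    define x where "x = y - of_int j *\<^sub>Q v - of_nat i *\<^sub>Q n0"
    have "x \<in> int_points"
      unfolding x_def using int_points_scale[OF n0(1), of "int i"]
      by (intro int_points_diff y int_points_scale v) simp
    moreover have "x = (y - c *\<^sub>Q v) - of_nat i *\<^sub>Q (n0 - (1 / of_nat k) *\<^sub>Q v)"
      unfolding x_def cij by (simp add: Q.scale_right_diff_distrib Q.scale_left_distrib)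
    then have "x \<in> Q.span S" using c n0 by (auto intro: Q.span_diff Q.span_scale)
    ultimately have "F (?cos ?H x, i) \<in> F ` (?cos ?H ` ?N \<times> {..<k})"
      using i by (intro imageI) auto
    moreover have "z = F (?cos ?H x, i)"
    proof -
      have "y - (x + of_nat i *\<^sub>Q n0) = of_int j *\<^sub>Q v + 0" by (simp add: x_def)
      then have "y - (x + of_nat i *\<^sub>Q n0) \<in> ?H'"
        unfolding int_span_insert[OF S(1) vS] using int_span_zero[of S] by blast
      then show ?thesis unfolding y(3) F cos_eq .
    qed
    ultimately show "z \<in> F ` (?cos ?H ` ?N \<times> {..<k})" by simp
  qed
  moreover have "inj_on F (?cos ?H ` ?N \<times> {..<k})"
  proof (rule inj_onI, clarsimp)
    fix x x' and i i' :: nat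
    assume x: "x \<in> int_points" "x \<in> Q.span S" "x' \<in> int_points" "x' \<in> Q.span S" and i: "i < k" "i' < k"
      and "F (?cos ?H x, i) = F (?cos ?H x', i')"
    then have "(x + of_nat i *\<^sub>Q n0) - (x' + of_nat i' *\<^sub>Q n0) \<in> ?H'" by (simp only: F cos_eq)
    then obtain j :: int and h where jh: "h \<in> ?H"
      "(x + of_nat i *\<^sub>Q n0) - (x' + of_nat i' *\<^sub>Q n0) = of_int j *\<^sub>Q v + h"
      unfolding int_span_insert[OF S(1) vS] by blast
    \<comment> \<open>the \<open>v\<close>-coordinate of a vector that lies in the span of \<open>S\<close>, hence zero\<close>
    let ?c = "(of_nat i - of_nat i') * (1 / of_nat k) - of_int j :: rat"
    have "?c *\<^sub>Q v = h - (x - x') - (of_nat i - of_nat i') *\<^sub>Q (n0 - (1 / of_nat k) *\<^sub>Q v)"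
      using jh(2) by (simp add: Q.scale_right_diff_distrib Q.scale_left_diff_distrib algebra_simps)
    also have "\<dots> \<in> Q.span S"
      using jh(1) int_span_subset_span x by (intro Q.span_diff Q.span_scale[OF n0(2)]) auto
    finally have "?c = 0" using scale_in_subspace_iff[OF Q.subspace_span S(2)] by blast
    then have "of_int (int i - int i') = (of_int (j * int k) :: rat)" using k by (simp add: field_simps)
    then have ij: "int i - int i' = j * int k" by (simp only: of_int_eq_iff)
    then have "\<bar>j\<bar> * int k < 1 * int k" using i by (simp add: abs_mult[of j "int k", symmetric, simplified])
    then have "j = 0" using mult_right_less_imp_less[of "\<bar>j\<bar>" "int k" 1] by simp
    then have "i = i'" "x - x' \<in> ?H" using ij jh by auto
    then show "?cos ?H x = ?cos ?H x' \<and> i = i'" by (simp add: cos_eq)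
  qed
  ultimately have "card (?cos ?H' ` ?N') = card (?cos ?H ` ?N \<times> {..<k})"
    by (metis card_image)
  then show ?thesis by (simp add: rc card_cartesian_product mult.commute)
qed

section \<open>Simplicial fans\<close>

lemma cone_hull_singleton_scale: "0 < q \<Longrightarrow> cone_hull {q *\<^sub>Q v} = cone_hull {v}"
proof -
  assume q: "0 < q"
  have "c *\<^sub>Q v \<in> cone_hull {q *\<^sub>Q v}" if "0 \<le> c" for c
    unfolding cone_hull_singleton using q that by (intro CollectI exI[of _ "c / q"]) simp
  moreover have "c *\<^sub>Q q *\<^sub>Q v \<in> cone_hull {v}" if "0 \<le> c" for c
    unfolding cone_hull_singleton using q that by (intro CollectI exI[of _ "c * q"]) simp
  ultimately show ?thesis by (auto simp: cone_hull_singleton)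
qed

lemma dim_cone_hull: "finite S \<Longrightarrow> Q.independent S \<Longrightarrow> Q.dim (cone_hull S) = card S"
  by (metis Q.dim_eq_card span_cone_hull)

lemma inj_on_cone_hull_singleton:
  assumes "Q.independent S"
  shows "inj_on (\<lambda>s. cone_hull {s}) S"
proof (rule inj_onI, rule ccontr)
  fix s t assume st: "s \<in> S" "t \<in> S" "cone_hull {s} = cone_hull {t}" "s \<noteq> t"
  have "s \<in> cone_hull {t}" using generator_in_cone_hull[of "{s}" s] st(3) by simp
  then have "s \<in> Q.span {t}" using cone_hull_subset_span by blast
  then have "s \<in> Q.span (S - {s})" using Q.span_mono[of "{t}" "S - {s}"] st by auto
  then show False using assms st(1) by (auto simp: Q.dependent_def)
qed

locale simplicial =
  fixes \<Sigma> :: "'v::rat_lattice set set"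
  assumes simplicial: "simplicial_fan \<Sigma>"
begin

lemma finite_cones: "finite \<Sigma>" and cones_nonempty: "\<Sigma> \<noteq> {}"
  and face_in_fan: "\<tau> \<in> \<Sigma> \<Longrightarrow> cone_face \<sigma> \<tau> \<Longrightarrow> \<sigma> \<in> \<Sigma>"
  and inter_face: "\<sigma> \<in> \<Sigma> \<Longrightarrow> \<tau> \<in> \<Sigma> \<Longrightarrow> cone_face (\<sigma> \<inter> \<tau>) \<tau>"
  using simplicial unfolding simplicial_fan_def fan_def by blast+

lemma obtain_generators:
  assumes "\<sigma> \<in> \<Sigma>"
  obtains S where "finite S" "Q.independent S" "\<sigma> = cone_hull S"
  using simplicial assms unfolding simplicial_fan_def by blast

lemma finite_rays: "finite (rays \<Sigma>)"
  using finite_cones by (simp add: rays_def)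

lemma rays_of_subset: "rays_of \<Sigma> \<sigma> \<subseteq> rays \<Sigma>"
  by (auto simp: rays_of_def)

lemma finite_rays_of: "finite (rays_of \<Sigma> \<sigma>)"
  using finite_rays rays_of_subset finite_subset by blast

lemma ray_in_fan: "\<rho> \<in> rays \<Sigma> \<Longrightarrow> \<rho> \<in> \<Sigma>"
  by (simp add: rays_def)

lemma face_iff: "\<sigma> \<in> \<Sigma> \<Longrightarrow> \<tau> \<in> \<Sigma> \<Longrightarrow> cone_face \<sigma> \<tau> \<longleftrightarrow> \<sigma> \<subseteq> \<tau>"
  using inter_face[of \<sigma> \<tau>] by (auto simp: cone_face_def Int_absorb2)

text \<open>
  A ray has a single generator up to scaling, and the primitive one exists and is unique, so the definite
  description in \<open>ray_gen\<close> is meaningful.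
\<close>

lemma ray_props:
  assumes \<rho>: "\<rho> \<in> rays \<Sigma>"
  shows "\<rho> = cone_hull {ray_gen \<rho>}" "ray_gen \<rho> \<noteq> 0" "ray_gen \<rho> \<in> int_points"
    "primitive_mod {0} (ray_gen \<rho>)"
proof -
  obtain S where S: "finite S" "Q.independent S" "\<rho> = cone_hull S"
    using obtain_generators[OF ray_in_fan[OF \<rho>]] .
  have "card S = 1" using \<rho> S by (simp add: rays_def dim_cone_hull)
  then obtain v where v: "S = {v}" by (auto simp: card_1_singleton_iff)
  have v0: "v \<noteq> 0" using S(2) v Q.dependent_zero by blast
  obtain q where q: "q > 0" "ray_gen \<rho> = q *\<^sub>Q v" "q *\<^sub>Q v \<in> int_points" "primitive_mod {0} (q *\<^sub>Q v)"
    using ray_gen_cone_hull[OF v0] S(3) v by auto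
  show "\<rho> = cone_hull {ray_gen \<rho>}" using q(2) cone_hull_singleton_scale[OF q(1), of v] S(3) v by simp
  show "ray_gen \<rho> \<noteq> 0" "ray_gen \<rho> \<in> int_points" "primitive_mod {0} (ray_gen \<rho>)"
    using q v0 by auto
qed

lemma inj_on_ray_gen: "inj_on ray_gen (rays \<Sigma>)"
  by (rule inj_onI) (metis ray_props(1))

lemma minkowski_sum: "S \<subseteq> rays \<Sigma> \<Longrightarrow> (\<Sum>\<rho>\<in>S. \<rho>) = cone_hull (ray_gen ` S)"
proof -
  assume S: "S \<subseteq> rays \<Sigma>"
  then have "finite S" using finite_rays finite_subset by blast
  then have "cone_hull (ray_gen ` S) = (\<Sum>x\<in>ray_gen ` S. cone_hull {x})"
    by (simp add: minkowski_sum_rays)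
  also have "\<dots> = (\<Sum>\<rho>\<in>S. cone_hull {ray_gen \<rho>})"
    using inj_on_subset[OF inj_on_ray_gen S] by (simp add: sum.reindex)
  also have "\<dots> = (\<Sum>\<rho>\<in>S. \<rho>)"
    using S by (intro sum.cong refl) (metis ray_props(1) subsetD)
  finally show ?thesis ..
qed

lemma rays_of_cone_hull:
  assumes S: "finite S" "Q.independent S" "cone_hull S \<in> \<Sigma>"
  shows "rays_of \<Sigma> (cone_hull S) = (\<lambda>s. cone_hull {s}) ` S"
proof (intro equalityI subsetI)
  fix \<rho> assume \<rho>: "\<rho> \<in> rays_of \<Sigma> (cone_hull S)"
  then obtain T where T: "T \<subseteq> S" "\<rho> = cone_hull T"
    using face_of_cone_hull[OF S(1)] by (auto simp: rays_of_def)
  have "finite T" using T(1) S(1) finite_subset by blast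
  moreover have "Q.independent T" using Q.independent_mono[OF S(2) T(1)] .
  ultimately have "card T = 1" using \<rho> T by (simp add: rays_of_def rays_def dim_cone_hull)
  then obtain s where "T = {s}" by (auto simp: card_1_singleton_iff)
  then show "\<rho> \<in> (\<lambda>s. cone_hull {s}) ` S" using T by auto
next
  fix \<rho> assume "\<rho> \<in> (\<lambda>s. cone_hull {s}) ` S"
  then obtain s where s: "s \<in> S" "\<rho> = cone_hull {s}" by auto
  have face: "cone_face \<rho> (cone_hull S)" using cone_hull_face[OF S(1,2), of "{s}"] s by simp
  have "Q.dim \<rho> = 1"
    using Q.independent_mono[OF S(2), of "{s}"] s by (simp add: dim_cone_hull)
  then show "\<rho> \<in> rays_of \<Sigma> (cone_hull S)"
    using face face_in_fan[OF S(3) face] by (simp add: rays_of_def rays_def)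
qed

lemma sum_rays_of: "\<sigma> \<in> \<Sigma> \<Longrightarrow> (\<Sum>\<rho>\<in>rays_of \<Sigma> \<sigma>. \<rho>) = \<sigma>"
proof -
  assume \<sigma>: "\<sigma> \<in> \<Sigma>"
  obtain S where S: "finite S" "Q.independent S" "\<sigma> = cone_hull S"
    using obtain_generators[OF \<sigma>] .
  have "(\<Sum>\<rho>\<in>rays_of \<Sigma> \<sigma>. \<rho>) = (\<Sum>s\<in>S. cone_hull {s})"
    using rays_of_cone_hull[OF S(1,2)] \<sigma> S(3) inj_on_cone_hull_singleton[OF S(2)]
    by (simp add: sum.reindex)
  then show ?thesis using S by (simp add: minkowski_sum_rays)
qed

lemma cone_eq_hull: "\<sigma> \<in> \<Sigma> \<Longrightarrow> cone_hull (ray_gen ` rays_of \<Sigma> \<sigma>) = \<sigma>"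
  using minkowski_sum[OF rays_of_subset] sum_rays_of by simp

lemma span_ray_gens: "\<sigma> \<in> \<Sigma> \<Longrightarrow> Q.span (ray_gen ` rays_of \<Sigma> \<sigma>) = Q.span \<sigma>"
  using span_cone_hull[of "ray_gen ` rays_of \<Sigma> \<sigma>"] cone_eq_hull finite_rays_of by simp

lemma dim_cone: "\<sigma> \<in> \<Sigma> \<Longrightarrow> Q.dim \<sigma> = card (rays_of \<Sigma> \<sigma>)"
proof -
  assume \<sigma>: "\<sigma> \<in> \<Sigma>"
  obtain S where S: "finite S" "Q.independent S" "\<sigma> = cone_hull S"
    using obtain_generators[OF \<sigma>] .
  have "card (rays_of \<Sigma> \<sigma>) = card S"
    using rays_of_cone_hull[OF S(1,2)] \<sigma> S(3) card_image[OF inj_on_cone_hull_singleton[OF S(2)]]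
    by simp
  then show ?thesis using S by (simp add: dim_cone_hull)
qed

lemma card_ray_gens: "S \<subseteq> rays \<Sigma> \<Longrightarrow> card (ray_gen ` S) = card S"
  by (rule card_image[OF inj_on_subset[OF inj_on_ray_gen]])

lemma independent_ray_gens:
  assumes "\<sigma> \<in> \<Sigma>"
  shows "Q.independent (ray_gen ` rays_of \<Sigma> \<sigma>)"
proof (rule Q.card_le_dim_spanning)
  show "ray_gen ` rays_of \<Sigma> \<sigma> \<subseteq> Q.span \<sigma>"
    using Q.span_superset span_ray_gens[OF assms] by blast
  show "Q.span \<sigma> \<subseteq> Q.span (ray_gen ` rays_of \<Sigma> \<sigma>)"
    by (simp add: span_ray_gens assms)
  show "card (ray_gen ` rays_of \<Sigma> \<sigma>) \<le> Q.dim (Q.span \<sigma>)"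
    by (simp add: dim_cone assms card_ray_gens rays_of_subset)
qed (simp add: finite_rays_of)

lemma ray_gen_in_span: "\<sigma> \<in> \<Sigma> \<Longrightarrow> \<rho> \<in> rays_of \<Sigma> \<sigma> \<Longrightarrow> ray_gen \<rho> \<in> Q.span \<sigma>"
  using Q.span_base[of "ray_gen \<rho>"] span_ray_gens[of \<sigma>] by blast

text \<open>
  A ray of the fan contained in a cone of the fan is a face of it, by the intersection condition.  So all
  of \<open>S\<close> consists of rays of the sum, and the dimension, which counts the
  rays of a simplicial cone, leaves no room for others.
\<close>

lemma rays_of_sum:
  assumes S: "S \<subseteq> rays \<Sigma>" and in_fan: "(\<Sum>\<rho>\<in>S. \<rho>) \<in> \<Sigma>"
  shows "rays_of \<Sigma> (\<Sum>\<rho>\<in>S. \<rho>) = S"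
proof -
  let ?\<sigma> = "\<Sum>\<rho>\<in>S. \<rho>"
  have fin: "finite S" using S finite_rays finite_subset by blast
  have "\<rho> \<in> rays_of \<Sigma> ?\<sigma>" if \<rho>: "\<rho> \<in> S" for \<rho>
  proof -
    have "cone_hull {ray_gen \<rho>} \<subseteq> cone_hull (ray_gen ` S)"
      using fin \<rho> by (intro cone_hull_mono) auto
    then have "\<rho> \<subseteq> ?\<sigma>" using ray_props(1) minkowski_sum[OF S] S \<rho> by auto
    then show ?thesis using face_iff[OF ray_in_fan in_fan] S \<rho> by (auto simp: rays_of_def)
  qed
  then have sub: "S \<subseteq> rays_of \<Sigma> ?\<sigma>" by blast
  have ind: "Q.independent (ray_gen ` S)"
    using Q.independent_mono[OF independent_ray_gens[OF in_fan]] sub by blast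
  have "card (rays_of \<Sigma> ?\<sigma>) = Q.dim (cone_hull (ray_gen ` S))"
    using dim_cone[OF in_fan] minkowski_sum[OF S] by simp
  also have "\<dots> = card S"
    using ind fin card_ray_gens[OF S] by (simp add: dim_cone_hull)
  finally show ?thesis using sub card_subset_eq[OF finite_rays_of] by metis
qed

lemma sum_subset_in_fan:
  assumes \<sigma>: "\<sigma> \<in> \<Sigma>" and S: "S \<subseteq> rays_of \<Sigma> \<sigma>"
  shows "(\<Sum>\<rho>\<in>S. \<rho>) \<in> \<Sigma>"
proof -
  have "cone_face (cone_hull (ray_gen ` S)) (cone_hull (ray_gen ` rays_of \<Sigma> \<sigma>))"
    using S by (intro cone_hull_face independent_ray_gens \<sigma>) (auto simp: finite_rays_of)
  then show ?thesis
    using face_in_fan[OF \<sigma>] cone_eq_hull[OF \<sigma>] minkowski_sum[of S] S rays_of_subset[of \<sigma>] by auto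
qed

lemma zero_cone: "{0} \<in> \<Sigma>" and rays_of_zero: "rays_of \<Sigma> {0} = {}"
proof -
  obtain \<sigma> where "\<sigma> \<in> \<Sigma>" using cones_nonempty by blast
  from sum_subset_in_fan[OF this, of "{}"] show z: "{0} \<in> \<Sigma>" by (simp add: set_zero)
  then show "rays_of \<Sigma> {0} = {}"
    using rays_of_sum[of "{}"] by (simp add: set_zero)
qed

lemma rays_of_ray: "\<rho> \<in> rays \<Sigma> \<Longrightarrow> rays_of \<Sigma> \<rho> = {\<rho>}"
  using rays_of_sum[of "{\<rho>}"] ray_in_fan by simp

lemma subset_iff_rays_of:
  assumes "\<sigma> \<in> \<Sigma>" "\<tau> \<in> \<Sigma>"
  shows "\<sigma> \<subseteq> \<tau> \<longleftrightarrow> rays_of \<Sigma> \<sigma> \<subseteq> rays_of \<Sigma> \<tau>"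
proof
  assume "\<sigma> \<subseteq> \<tau>"
  then show "rays_of \<Sigma> \<sigma> \<subseteq> rays_of \<Sigma> \<tau>"
    using assms face_iff ray_in_fan unfolding rays_of_def by (smt (verit) Collect_mono order_trans)
next
  assume "rays_of \<Sigma> \<sigma> \<subseteq> rays_of \<Sigma> \<tau>"
  then have "cone_hull (ray_gen ` rays_of \<Sigma> \<sigma>) \<subseteq> cone_hull (ray_gen ` rays_of \<Sigma> \<tau>)"
    by (intro cone_hull_mono) (auto simp: finite_rays_of)
  then show "\<sigma> \<subseteq> \<tau>" using assms by (simp add: cone_eq_hull)
qed

lemma covers_iff:
  assumes "\<sigma> \<in> \<Sigma>" "\<tau> \<in> \<Sigma>"
  shows "covers \<tau> \<sigma> \<longleftrightarrow>
    (\<exists>\<rho>\<in>rays \<Sigma> - rays_of \<Sigma> \<sigma>. rays_of \<Sigma> \<tau> = insert \<rho> (rays_of \<Sigma> \<sigma>))"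
proof
  assume "covers \<tau> \<sigma>"
  then have "rays_of \<Sigma> \<sigma> \<subseteq> rays_of \<Sigma> \<tau>" "card (rays_of \<Sigma> \<tau>) = card (rays_of \<Sigma> \<sigma>) + 1"
    using assms by (auto simp: covers_def face_iff subset_iff_rays_of[symmetric] dim_cone)
  moreover from this have "card (rays_of \<Sigma> \<tau> - rays_of \<Sigma> \<sigma>) = 1"
    using card_Diff_subset[OF finite_rays_of, of \<sigma> "rays_of \<Sigma> \<tau>"] by simp
  then obtain \<rho> where "rays_of \<Sigma> \<tau> - rays_of \<Sigma> \<sigma> = {\<rho>}" by (auto simp: card_1_singleton_iff)
  ultimately show "\<exists>\<rho>\<in>rays \<Sigma> - rays_of \<Sigma> \<sigma>. rays_of \<Sigma> \<tau> = insert \<rho> (rays_of \<Sigma> \<sigma>)"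
    using rays_of_subset[of \<tau>] by (intro bexI[of _ \<rho>]) auto
next
  assume "\<exists>\<rho>\<in>rays \<Sigma> - rays_of \<Sigma> \<sigma>. rays_of \<Sigma> \<tau> = insert \<rho> (rays_of \<Sigma> \<sigma>)"
  then show "covers \<tau> \<sigma>"
    using assms by (auto simp: covers_def face_iff subset_iff_rays_of dim_cone finite_rays_of)
qed

text \<open>
  If \<open>q\<close> is the generator of the group of \<open>n\<^sub>\<rho>\<close>-coordinates modulo
  the span of \<open>\<sigma>\<close>, then \<open>q = 1 / k\<close> for an integer \<open>k\<close> since \<open>n\<^sub>\<rho>\<close> itself is a lattice point.  Modulo that
  span, \<open>normal_rep \<tau> \<sigma>\<close> is \<open>q n\<^sub>\<rho>\<close>: primitivity fixes the coordinate up to sign, and membership in \<open>\<tau>\<close> plus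
  the span fixes the sign.
\<close>

lemma normal_rep_and_mult:
  assumes \<sigma>: "\<sigma> \<in> \<Sigma>" and \<tau>: "\<tau> \<in> \<Sigma>" and \<rho>: "\<rho> \<in> rays \<Sigma>" "\<rho> \<notin> rays_of \<Sigma> \<sigma>"
    and eq: "rays_of \<Sigma> \<tau> = insert \<rho> (rays_of \<Sigma> \<sigma>)"
  shows "\<exists>k>0. normal_rep \<tau> \<sigma> - (1 / of_nat k) *\<^sub>Q ray_gen \<rho> \<in> Q.span \<sigma> \<and>
    normal_rep \<tau> \<sigma> \<in> int_points \<and> cone_mult \<Sigma> \<tau> = k * cone_mult \<Sigma> \<sigma>"
proof -
  define S where "S = ray_gen ` rays_of \<Sigma> \<sigma>"
  define v where "v = ray_gen \<rho>"
  have S: "finite S" "Q.span S = Q.span \<sigma>" "cone_hull S = \<sigma>"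
    using \<sigma> by (auto simp: S_def finite_rays_of span_ray_gens cone_eq_hull)
  have \<tau>S: "ray_gen ` rays_of \<Sigma> \<tau> = insert v S" by (simp add: eq S_def v_def)
  have vS: "v \<notin> S"
    using inj_on_ray_gen \<rho> rays_of_subset[of \<sigma>] by (auto simp: S_def v_def inj_on_def)
  have v: "v \<notin> Q.span S"
    using independent_ray_gens[OF \<tau>] vS by (simp add: \<tau>S Q.independent_insert)
  have vN: "v \<in> int_points" using ray_props(3)[OF \<rho>(1)] by (simp add: v_def)
  obtain q where q: "0 < q" "\<exists>n\<in>int_points. n - q *\<^sub>Q v \<in> Q.span S"
    "\<forall>n\<in>int_points. \<forall>c. n - c *\<^sub>Q v \<in> Q.span S \<longrightarrow> (\<exists>k::int. c = of_int k * q)"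
    using primitive_coordinate[OF Q.subspace_span v] by blast
  note prim = primitive_mod_iff[OF Q.subspace_span v q]
  have "v - 1 *\<^sub>Q v \<in> Q.span S" by (simp add: Q.span_zero)
  then obtain j :: int where j: "1 = of_int j * q" using q(3) vN by blast
  have "0 < of_int j * q" using j by simp
  then have j0: "0 < j" using q(1) by (simp add: zero_less_mult_iff)
  define k where "k = nat j"
  have k: "0 < k" "q = 1 / of_nat k"
    using j j0 by (auto simp: k_def field_simps)
  define n where "n = normal_rep \<tau> \<sigma>"
  have n: "n \<in> \<tau> + Q.span \<sigma> \<and> primitive_mod (Q.span \<sigma>) n"
    unfolding n_def normal_rep_def
  proof (rule someI_ex)
    obtain n0 where n0: "n0 \<in> int_points" "n0 - q *\<^sub>Q v \<in> Q.span S" using q(2) by blast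
    have "q *\<^sub>Q v \<in> cone_hull {v}" using q(1) by (auto simp: cone_hull_singleton)
    also have "cone_hull {v} \<subseteq> cone_hull (insert v S)" by (intro cone_hull_mono) (auto simp: S)
    also have "\<dots> = \<tau>" using cone_eq_hull[OF \<tau>] \<tau>S by simp
    finally have "q *\<^sub>Q v + (n0 - q *\<^sub>Q v) \<in> \<tau> + Q.span \<sigma>"
      using n0(2) by (intro set_plus_intro) (auto simp: S)
    then have "n0 \<in> \<tau> + Q.span \<sigma>" by simp
    moreover have "primitive_mod (Q.span \<sigma>) n0" using prim[OF n0] q(1) by (simp add: S)
    ultimately show "\<exists>n. n \<in> \<tau> + Q.span \<sigma> \<and> primitive_mod (Q.span \<sigma>) n" by blast
  qed
  then have nN: "n \<in> int_points" by (simp add: primitive_mod_def)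
  obtain t s where ts: "n = t + s" "t \<in> cone_hull (insert v S)" "s \<in> Q.span S"
    using n cone_eq_hull[OF \<tau>] \<tau>S S(2) by (auto elim: set_plus_elim)
  obtain c x where cx: "t = c *\<^sub>Q v + x" "0 \<le> c" "x \<in> cone_hull S"
    using ts(2) unfolding cone_hull_insert[OF S(1) vS] cone_hull_singleton
    by (auto elim!: set_plus_elim)
  have "n - c *\<^sub>Q v = x + s" by (simp add: ts cx)
  also have "\<dots> \<in> Q.span S" using cx ts cone_hull_subset_span[of S] by (auto intro: Q.span_add)
  finally have nc: "n - c *\<^sub>Q v \<in> Q.span S" .
  have "\<bar>c\<bar> = q" using prim[OF nN nc] n S(2) by simp
  then have "c = q" using cx(2) by simp
  then have nq: "n - (1 / of_nat k) *\<^sub>Q v \<in> Q.span S" using nc k(2) by simp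
  have "cone_mult \<Sigma> \<tau> = k * cone_mult \<Sigma> \<sigma>"
    using index_insert[OF S(1) v k(1) nN nq q(3)[unfolded k(2)] vN]
      span_ray_gens[OF \<tau>, unfolded \<tau>S]
    by (simp add: cone_mult_def \<tau>S S_def[symmetric] S(2))
  with nq k(1) nN show ?thesis by (auto simp: n_def v_def S(2))
qed

lemma cone_mult_zero: "cone_mult \<Sigma> {0} = 1"
proof -
  have "int_points \<inter> Q.span {0::'v} = {0}" using int_points_zero by auto
  moreover have "int_span {} = {0::'v}" by (auto simp: int_span_def)
  ultimately show ?thesis
    by (simp add: cone_mult_def rays_of_zero RCOSETS_def r_coset_def)
qed

lemma cone_mult_pos: "\<sigma> \<in> \<Sigma> \<Longrightarrow> 0 < cone_mult \<Sigma> \<sigma>"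
proof (induction "card (rays_of \<Sigma> \<sigma>)" arbitrary: \<sigma>)
  case 0
  then have "rays_of \<Sigma> \<sigma> = {}" by (simp add: finite_rays_of)
  then have "\<sigma> = {0}" using sum_rays_of[OF 0(2)] by (simp add: set_zero)
  then show ?case by (simp add: cone_mult_zero)
next
  case (Suc n \<tau>)
  then obtain \<rho> where \<rho>: "\<rho> \<in> rays_of \<Sigma> \<tau>" by fastforce
  define S where "S = rays_of \<Sigma> \<tau> - {\<rho>}"
  define \<sigma> where "\<sigma> = (\<Sum>\<rho>\<in>S. \<rho>)"
  have \<sigma>: "\<sigma> \<in> \<Sigma>" unfolding \<sigma>_def by (rule sum_subset_in_fan[OF Suc.prems]) (auto simp: S_def)
  have "S \<subseteq> rays \<Sigma>" using rays_of_subset[of \<tau>] by (auto simp: S_def)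
  then have r: "rays_of \<Sigma> \<sigma> = S" using rays_of_sum \<sigma> by (simp add: \<sigma>_def)
  have "n = card (rays_of \<Sigma> \<sigma>)"
    using Suc.hyps(2) \<rho> by (simp add: r S_def finite_rays_of)
  from Suc.hyps(1)[OF this \<sigma>] have "0 < cone_mult \<Sigma> \<sigma>" .
  moreover obtain k where "k > 0" "cone_mult \<Sigma> \<tau> = k * cone_mult \<Sigma> \<sigma>"
  proof -
    have "\<rho> \<in> rays \<Sigma>" "\<rho> \<notin> rays_of \<Sigma> \<sigma>" "rays_of \<Sigma> \<tau> = insert \<rho> (rays_of \<Sigma> \<sigma>)"
      using \<rho> rays_of_subset[of \<tau>] by (auto simp: r S_def)
    from normal_rep_and_mult[OF \<sigma> Suc.prems this] show ?thesis using that by blast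
  qed
  ultimately show ?case by simp
qed

lemma cone_mult_ray:
  assumes \<rho>: "\<rho> \<in> rays \<Sigma>"
  shows "cone_mult \<Sigma> \<rho> = 1"
proof -
  obtain k where k: "k > 0" "normal_rep \<rho> {0} - (1 / of_nat k) *\<^sub>Q ray_gen \<rho> \<in> Q.span {0}"
    "normal_rep \<rho> {0} \<in> int_points" "cone_mult \<Sigma> \<rho> = k * cone_mult \<Sigma> {0}"
    using normal_rep_and_mult[OF zero_cone ray_in_fan[OF \<rho>] \<rho>] \<rho>
    by (auto simp: rays_of_zero rays_of_ray)
  have "normal_rep \<rho> {0} = (1 / of_nat k) *\<^sub>Q ray_gen \<rho>" using k(2) by simp
  then have "ray_gen \<rho> - of_int (int k) *\<^sub>Q normal_rep \<rho> {0} \<in> {0}" using k(1) by simp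
  then have "\<bar>int k\<bar> = 1" using ray_props(4)[OF \<rho>] k(3) unfolding primitive_mod_def by blast
  then show ?thesis using k(4) cone_mult_zero by simp
qed

subsection \<open>Divisors\<close>

lemma Div_dual: "d \<in> Div \<Sigma> \<Longrightarrow> \<sigma> \<in> \<Sigma> \<Longrightarrow> d \<sigma> \<in> dual (Q.span \<sigma>)"
  and Div_restr: "d \<in> Div \<Sigma> \<Longrightarrow> \<sigma> \<in> \<Sigma> \<Longrightarrow> \<tau> \<in> \<Sigma> \<Longrightarrow> \<sigma> \<subseteq> \<tau> \<Longrightarrow> restr (Q.span \<sigma>) (d \<tau>) = d \<sigma>"
  and Div_outside: "d \<in> Div \<Sigma> \<Longrightarrow> \<sigma> \<notin> \<Sigma> \<Longrightarrow> d \<sigma> = (\<lambda>_. 0)"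
  by (auto simp: Div_def)

lemma Div_on_span:
  assumes "d \<in> Div \<Sigma>" "\<sigma> \<in> \<Sigma>" "\<tau> \<in> \<Sigma>" "\<sigma> \<subseteq> \<tau>" "x \<in> Q.span \<sigma>"
  shows "d \<tau> x = d \<sigma> x"
  using fun_cong[OF Div_restr[OF assms(1-4)], of x] assms(5) by (simp add: restr_def)

lemma Div_ray_value:
  assumes "d \<in> Div \<Sigma>" "\<sigma> \<in> \<Sigma>" "\<rho> \<in> rays_of \<Sigma> \<sigma>"
  shows "d \<sigma> (ray_gen \<rho>) = d \<rho> (ray_gen \<rho>)"
proof -
  have \<rho>: "\<rho> \<in> rays \<Sigma>" using assms rays_of_subset by blast
  have "\<rho> \<subseteq> \<sigma>" using assms face_iff[OF ray_in_fan[OF \<rho>]] by (simp add: rays_of_def)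
  then show ?thesis
    by (intro Div_on_span[OF assms(1) ray_in_fan[OF \<rho>] assms(2)] ray_gen_in_span ray_in_fan[OF \<rho>])
      (auto simp: rays_of_ray \<rho>)
qed

lemma dual_cone_eqI:
  assumes "\<sigma> \<in> \<Sigma>" "f \<in> dual (Q.span \<sigma>)" "g \<in> dual (Q.span \<sigma>)"
    and "\<And>\<rho>. \<rho> \<in> rays_of \<Sigma> \<sigma> \<Longrightarrow> f (ray_gen \<rho>) = g (ray_gen \<rho>)"
  shows "f = g"
  using assms by (intro dual_eqI[of f "ray_gen ` rays_of \<Sigma> \<sigma>"]) (auto simp: span_ray_gens)

lemma Div_eqI:
  assumes d: "d \<in> Div \<Sigma>" and e: "e \<in> Div \<Sigma>"
    and eq: "\<And>\<rho>. \<rho> \<in> rays \<Sigma> \<Longrightarrow> d \<rho> (ray_gen \<rho>) = e \<rho> (ray_gen \<rho>)"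
  shows "d = e"
proof
  fix \<sigma>
  show "d \<sigma> = e \<sigma>"
  proof (cases "\<sigma> \<in> \<Sigma>")
    case True
    show ?thesis
      by (rule dual_cone_eqI[OF True Div_dual[OF d True] Div_dual[OF e True]])
        (use eq rays_of_subset in \<open>auto simp: Div_ray_value d e True\<close>)
  qed (simp add: Div_outside d e)
qed

lemma Div_lin:
  assumes "d \<in> Div \<Sigma>" "e \<in> Div \<Sigma>"
  shows "(\<lambda>\<sigma> x. d \<sigma> x + c * e \<sigma> x) \<in> Div \<Sigma>"
proof -
  have "restr (Q.span \<sigma>) (\<lambda>x. d \<tau> x + c * e \<tau> x) = (\<lambda>x. d \<sigma> x + c * e \<sigma> x)"
    if "\<sigma> \<in> \<Sigma>" "\<tau> \<in> \<Sigma>" "\<sigma> \<subseteq> \<tau>" for \<sigma> \<tau>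
  proof
    fix x
    show "restr (Q.span \<sigma>) (\<lambda>x. d \<tau> x + c * e \<tau> x) x = d \<sigma> x + c * e \<sigma> x"
      using fun_cong[OF Div_restr[OF assms(1) that], of x] fun_cong[OF Div_restr[OF assms(2) that], of x]
      by (auto simp: restr_def split: if_splits)
  qed
  moreover have "(\<lambda>x. d \<sigma> x + c * e \<sigma> x) \<in> dual (Q.span \<sigma>)" if "\<sigma> \<in> \<Sigma>" for \<sigma>
    by (intro dual_lin Div_dual assms that)
  ultimately show ?thesis using assms by (simp add: Div_def)
qed

text \<open>
  On a simplicial cone a linear function may be prescribed on the ray generators, and the functions
  so obtained on different cones agree on common faces because they agree on the rays there.
\<close>

lemma Div_exists: "\<exists>d\<in>Div \<Sigma>. \<forall>\<rho>\<in>rays \<Sigma>. d \<rho> (ray_gen \<rho>) = a \<rho>"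
proof -
  have "\<exists>m\<in>dual UNIV. \<forall>\<rho>\<in>rays_of \<Sigma> \<sigma>. m (ray_gen \<rho>) = a \<rho>" if \<sigma>: "\<sigma> \<in> \<Sigma>" for \<sigma>
  proof -
    have inj: "inj_on ray_gen (rays_of \<Sigma> \<sigma>)" using inj_on_subset[OF inj_on_ray_gen rays_of_subset] .
    obtain m where "m \<in> dual UNIV"
      "\<forall>s\<in>ray_gen ` rays_of \<Sigma> \<sigma>. m s = a (inv_into (rays_of \<Sigma> \<sigma>) ray_gen s)"
      using functional_exists[OF independent_ray_gens[OF \<sigma>],
          of "\<lambda>s. a (inv_into (rays_of \<Sigma> \<sigma>) ray_gen s)"] by blast
    then show ?thesis using inj by (intro bexI[of _ m]) auto
  qed
  then obtain m where m: "\<And>\<sigma>. \<sigma> \<in> \<Sigma> \<Longrightarrow> m \<sigma> \<in> dual UNIV"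
    "\<And>\<sigma> \<rho>. \<sigma> \<in> \<Sigma> \<Longrightarrow> \<rho> \<in> rays_of \<Sigma> \<sigma> \<Longrightarrow> m \<sigma> (ray_gen \<rho>) = a \<rho>"
    by metis
  define d where "d \<sigma> = (if \<sigma> \<in> \<Sigma> then restr (Q.span \<sigma>) (m \<sigma>) else (\<lambda>_. 0))" for \<sigma>
  have dual: "d \<sigma> \<in> dual (Q.span \<sigma>)" if "\<sigma> \<in> \<Sigma>" for \<sigma>
    using that by (simp add: d_def restr_dual_UNIV m)
  have val: "d \<sigma> (ray_gen \<rho>) = a \<rho>" if "\<sigma> \<in> \<Sigma>" "\<rho> \<in> rays_of \<Sigma> \<sigma>" for \<sigma> \<rho>
    using that by (simp add: d_def restr_def m ray_gen_in_span)
  have "restr (Q.span \<sigma>) (d \<tau>) = d \<sigma>" if "\<sigma> \<in> \<Sigma>" "\<tau> \<in> \<Sigma>" "\<sigma> \<subseteq> \<tau>" for \<sigma> \<tau>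
  proof (rule dual_cone_eqI[OF that(1) _ dual[OF that(1)]])
    show "restr (Q.span \<sigma>) (d \<tau>) \<in> dual (Q.span \<sigma>)"
      by (rule restr_dual[OF dual[OF that(2)] Q.span_mono[OF that(3)] Q.subspace_span])
    fix \<rho> assume \<rho>: "\<rho> \<in> rays_of \<Sigma> \<sigma>"
    then have "\<rho> \<in> rays_of \<Sigma> \<tau>" using subset_iff_rays_of[OF that(1,2)] that(3) by blast
    then show "restr (Q.span \<sigma>) (d \<tau>) (ray_gen \<rho>) = d \<sigma> (ray_gen \<rho>)"
      using \<rho> that by (simp add: restr_def ray_gen_in_span val)
  qed
  then have "d \<in> Div \<Sigma>" using dual by (auto simp: Div_def d_def)
  moreover have "\<forall>\<rho>\<in>rays \<Sigma>. d \<rho> (ray_gen \<rho>) = a \<rho>"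
    by (auto simp: val ray_in_fan rays_of_ray)
  ultimately show ?thesis by blast
qed

end

section \<open>Cycles and the action of divisors\<close>

lemma lookup_smul: "Poly_Mapping.lookup (smul l z) \<sigma> = l * Poly_Mapping.lookup z \<sigma>"
  by (simp add: smul_def map.rep_eq when_def)

interpretation cyc: Modules.module "smul :: 'v::rat_lattice lam \<Rightarrow> 'v cyc \<Rightarrow> 'v cyc"
  by unfold_locales (auto intro!: poly_mapping_eqI simp: lookup_smul lookup_add algebra_simps)

lemma lookup_V: "Poly_Mapping.lookup (V \<sigma>) \<tau> = (if \<sigma> = \<tau> then 1 else 0)"
  by (simp add: V_def lookup_single when_def)

lemma Lam_lin_lin: "Lam_lin (\<lambda>x. f x + c * g x) = Lam_lin f + Cst c * Lam_lin g"
  by (simp add: Lam_lin_def Cst_add Cst_mult distrib_right sum.distrib sum_distrib_left mult.assoc)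

lemma unital_subring_Lam: "unital_subring (carrier Lam)"
  unfolding Lam_def by (rule unital_subring_poly_ring[OF unital_subring_UNIV])

lemma Cst_in_Lam: "Cst c \<in> carrier Lam"
  unfolding Lam_def by (simp add: Cst_in_poly_ring[OF unital_subring_UNIV])

lemma Lam_lin_in_Lam: "Lam_lin m \<in> carrier Lam"
  unfolding Lam_lin_def
  by (rule subring_sum[OF unital_subring_Lam], rule subring_mult[OF unital_subring_Lam Cst_in_Lam])
    (simp add: Lam_def Var_in_poly_ring[OF unital_subring_UNIV])

lemma sum_mono_neutral_filter:
  "finite A \<Longrightarrow> (\<And>x. x \<in> A \<Longrightarrow> \<not> Q x \<Longrightarrow> f x = 0) \<Longrightarrow> sum f {x\<in>A. Q x} = sum f A"
  by (rule sum.mono_neutral_left) auto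

locale generic_simplicial = simplicial \<Sigma> for \<Sigma> :: "'v::rat_lattice set set" +
  fixes \<L> :: "'v set set" and \<Psi> :: "'v set \<Rightarrow> 'v set \<Rightarrow> ('v \<Rightarrow> rat) \<Rightarrow> ('v \<Rightarrow> rat)"
  assumes complement: "complement_map \<L> \<Psi>" and generic: "generic_fan \<L> \<Sigma>"
begin

abbreviation ext :: "'v set \<Rightarrow> ('v \<Rightarrow> rat) \<Rightarrow> 'v \<Rightarrow> rat" where
  "ext \<sigma> \<equiv> \<Psi> (Q.span \<sigma>) UNIV"

lemma span_in_L: "\<sigma> \<in> \<Sigma> \<Longrightarrow> Q.span \<sigma> \<in> \<L>" and UNIV_in_L: "UNIV \<in> \<L>"
  using generic complement by (auto simp: generic_fan_def complement_map_def)

lemma Psi_section: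
  "L1 \<in> \<L> \<Longrightarrow> L2 \<in> \<L> \<Longrightarrow> L1 \<subseteq> L2 \<Longrightarrow> f \<in> dual L1 \<Longrightarrow> \<Psi> L1 L2 f \<in> dual L2 \<and> restr L1 (\<Psi> L1 L2 f) = f"
  using complement unfolding complement_map_def by blast

lemma ext_dual: "\<sigma> \<in> \<Sigma> \<Longrightarrow> f \<in> dual (Q.span \<sigma>) \<Longrightarrow> ext \<sigma> f \<in> dual UNIV"
  and restr_ext: "\<sigma> \<in> \<Sigma> \<Longrightarrow> f \<in> dual (Q.span \<sigma>) \<Longrightarrow> restr (Q.span \<sigma>) (ext \<sigma> f) = f"
  using Psi_section[OF span_in_L UNIV_in_L] by auto

lemma ext_on_span:
  "\<sigma> \<in> \<Sigma> \<Longrightarrow> f \<in> dual (Q.span \<sigma>) \<Longrightarrow> x \<in> Q.span \<sigma> \<Longrightarrow> ext \<sigma> f x = f x"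
  using fun_cong[OF restr_ext, of \<sigma> f x] by (simp add: restr_def)

lemma ext_lin:
  assumes "\<sigma> \<in> \<Sigma>" "f \<in> dual (Q.span \<sigma>)" "g \<in> dual (Q.span \<sigma>)"
  shows "ext \<sigma> (\<lambda>x. f x + c * g x) = (\<lambda>x. ext \<sigma> f x + c * ext \<sigma> g x)"
proof -
  have add: "ext \<sigma> (\<lambda>x. f x + h x) = (\<lambda>x. ext \<sigma> f x + ext \<sigma> h x)" if "h \<in> dual (Q.span \<sigma>)" for h
    using complement span_in_L[OF assms(1)] UNIV_in_L assms(2) that
    unfolding complement_map_def by blast
  have scale: "ext \<sigma> (\<lambda>x. c * g x) = (\<lambda>x. c * ext \<sigma> g x)"
    using complement span_in_L[OF assms(1)] UNIV_in_L assms(3)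
    unfolding complement_map_def by blast
  show ?thesis using add[OF dual_lin(2)[OF assms(3)]] by (simp add: scale)
qed

lemma ext_zero: "\<sigma> \<in> \<Sigma> \<Longrightarrow> ext \<sigma> (\<lambda>_. 0) = (\<lambda>_. 0)"
  using ext_lin[of \<sigma> "\<lambda>_. 0" "\<lambda>_. 0" "-1"] by (simp add: dual_def)

text \<open>
  By transitivity, extending from the span of \<open>\<sigma>\<close> to the whole space factors through the span of \<open>\<tau>\<close>.
\<close>

lemma Psi_space_mono:
  assumes "\<sigma> \<in> \<Sigma>" "\<tau> \<in> \<Sigma>" "\<sigma> \<subseteq> \<tau>"
  shows "Psi_space \<Psi> \<sigma> \<subseteq> Psi_space \<Psi> \<tau>"
proof
  fix m assume "m \<in> Psi_space \<Psi> \<sigma>"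
  then obtain f where f: "f \<in> dual (Q.span \<sigma>)" "m = ext \<sigma> f" by (auto simp: Psi_space_def)
  note L = span_in_L[OF assms(1)] span_in_L[OF assms(2)] UNIV_in_L Q.span_mono[OF assms(3)]
  have "m = ext \<tau> (\<Psi> (Q.span \<sigma>) (Q.span \<tau>) f)"
    using complement f L unfolding complement_map_def by (metis top_greatest)
  moreover have "\<Psi> (Q.span \<sigma>) (Q.span \<tau>) f \<in> dual (Q.span \<tau>)"
    using Psi_section L f(1) by blast
  ultimately show "m \<in> Psi_space \<Psi> \<tau>" by (simp add: Psi_space_def)
qed

lemma Psi_space_dual: "\<sigma> \<in> \<Sigma> \<Longrightarrow> Psi_space \<Psi> \<sigma> \<subseteq> dual UNIV"
  by (auto simp: Psi_space_def ext_dual)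

subsection \<open>The action on cycles of cones\<close>

abbreviation gen :: "'v set \<Rightarrow> 'v" where "gen \<equiv> ray_gen"
abbreviation val :: "'v divisor \<Rightarrow> 'v set \<Rightarrow> rat" where "val d \<rho> \<equiv> d \<rho> (gen \<rho>)"

definition act_cone :: "'v divisor \<Rightarrow> 'v set \<Rightarrow> 'v cyc" where
  "act_cone d \<sigma> =
     (\<Sum>\<tau> | \<tau> \<in> \<Sigma> \<and> covers \<tau> \<sigma>.
        smul (Cst (d \<tau> (normal_rep \<tau> \<sigma>) - ext \<sigma> (d \<sigma>) (normal_rep \<tau> \<sigma>))) (V \<tau>))
     + smul (Lam_lin (ext \<sigma> (d \<sigma>))) (V \<sigma>)"

lemma act_eq: "act \<Psi> \<Sigma> d z = (\<Sum>\<sigma>\<in>\<Sigma>. smul (Poly_Mapping.lookup z \<sigma>) (act_cone d \<sigma>))"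
  by (simp add: act_def act_cone_def Let_def)

lemma act_add: "act \<Psi> \<Sigma> d (x + y) = act \<Psi> \<Sigma> d x + act \<Psi> \<Sigma> d y"
  by (simp add: act_eq lookup_add cyc.scale_left_distrib sum.distrib)

lemma act_smul: "act \<Psi> \<Sigma> d (smul a x) = smul a (act \<Psi> \<Sigma> d x)"
  by (simp add: act_eq lookup_smul cyc.scale_sum_right)

lemma act_V: "\<sigma> \<in> \<Sigma> \<Longrightarrow> act \<Psi> \<Sigma> d (V \<sigma>) = act_cone d \<sigma>"
proof -
  assume \<sigma>: "\<sigma> \<in> \<Sigma>"
  have "act \<Psi> \<Sigma> d (V \<sigma>) = (\<Sum>\<tau>\<in>\<Sigma>. if \<sigma> = \<tau> then act_cone d \<tau> else 0)"
    unfolding act_eq by (intro sum.cong refl) (simp add: lookup_V)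
  then show ?thesis using \<sigma> finite_cones by simp
qed

lemma act_lin:
  assumes "d \<in> Div \<Sigma>" "e \<in> Div \<Sigma>"
  shows "act \<Psi> \<Sigma> (\<lambda>\<sigma> x. d \<sigma> x + c * e \<sigma> x) z = act \<Psi> \<Sigma> d z + smul (Cst c) (act \<Psi> \<Sigma> e z)"
proof -
  have "act_cone (\<lambda>\<sigma> x. d \<sigma> x + c * e \<sigma> x) \<sigma> = act_cone d \<sigma> + smul (Cst c) (act_cone e \<sigma>)"
    if \<sigma>: "\<sigma> \<in> \<Sigma>" for \<sigma>
  proof -
    have sub: "(d \<tau> n + c * e \<tau> n) - (ext \<sigma> (d \<sigma>) n + c * ext \<sigma> (e \<sigma>) n) =
      (d \<tau> n - ext \<sigma> (d \<sigma>) n) + c * (e \<tau> n - ext \<sigma> (e \<sigma>) n)" for \<tau> n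
      by (simp add: algebra_simps)
    show ?thesis
      unfolding act_cone_def ext_lin[OF \<sigma> Div_dual[OF assms(1) \<sigma>] Div_dual[OF assms(2) \<sigma>]] sub
      by (simp add: Lam_lin_lin Cst_add Cst_mult cyc.scale_left_distrib cyc.scale_right_distrib
          sum.distrib cyc.scale_sum_right)
  qed
  then show ?thesis
    by (simp add: act_eq cyc.scale_right_distrib sum.distrib cyc.scale_sum_right mult.commute)
qed

text \<open>
  The \<open>\<rat>\<close>-Cartier divisor whose Weil divisor is \<open>V \<rho>\<close>, see \<open>weil_ray_div\<close>.
\<close>

definition ray_div :: "'v set \<Rightarrow> 'v divisor" where
  "ray_div \<rho> = (SOME d. d \<in> Div \<Sigma> \<and> (\<forall>\<rho>'\<in>rays \<Sigma>. val d \<rho>' = (if \<rho>' = \<rho> then 1 else 0)))"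

lemma ray_div: "ray_div \<rho> \<in> Div \<Sigma>"
  "\<rho>' \<in> rays \<Sigma> \<Longrightarrow> val (ray_div \<rho>) \<rho>' = (if \<rho>' = \<rho> then 1 else 0)"
proof -
  have "\<exists>d. d \<in> Div \<Sigma> \<and> (\<forall>\<rho>'\<in>rays \<Sigma>. val d \<rho>' = (if \<rho>' = \<rho> then 1 else 0))"
    using Div_exists[of "\<lambda>\<rho>'. if \<rho>' = \<rho> then 1 else 0"] by blast
  from someI_ex[OF this] show "ray_div \<rho> \<in> Div \<Sigma>"
    "\<rho>' \<in> rays \<Sigma> \<Longrightarrow> val (ray_div \<rho>) \<rho>' = (if \<rho>' = \<rho> then 1 else 0)"
    unfolding ray_div_def by blast+
qed

text \<open>
  Divisors are determined by their values on the rays and the action is linear in the divisor; the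
  induction removes one ray at a time from the support.
\<close>

lemma act_expand:
  assumes "d \<in> Div \<Sigma>"
  shows "act \<Psi> \<Sigma> d z = (\<Sum>\<rho>\<in>rays \<Sigma>. smul (Cst (val d \<rho>)) (act \<Psi> \<Sigma> (ray_div \<rho>) z))"
proof -
  have "act \<Psi> \<Sigma> d z = (\<Sum>\<rho>\<in>F. smul (Cst (val d \<rho>)) (act \<Psi> \<Sigma> (ray_div \<rho>) z))"
    if "finite F" "F \<subseteq> rays \<Sigma>" "d \<in> Div \<Sigma>" "\<forall>\<rho>\<in>rays \<Sigma> - F. val d \<rho> = 0" for F d
    using that
  proof (induction F arbitrary: d rule: finite_induct)
    case empty
    \<comment> \<open>\<open>d = 0\<close>; written as \<open>d = d + d\<close>, additivity of the action gives \<open>0\<close>\<close>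
    then have "d = (\<lambda>\<sigma> x. d \<sigma> x + 1 * d \<sigma> x)" by (intro Div_eqI Div_lin) auto
    then have "act \<Psi> \<Sigma> d z = act \<Psi> \<Sigma> d z + smul (Cst 1) (act \<Psi> \<Sigma> d z)"
      using act_lin[OF empty(2,2), of 1 z] by simp
    then show ?case by simp
  next
    case (insert \<rho> F)
    define c where "c = val d \<rho>"
    define e where "e = (\<lambda>\<sigma> x. d \<sigma> x + (- c) * ray_div \<rho> \<sigma> x)"
    have e: "e \<in> Div \<Sigma>" unfolding e_def by (intro Div_lin insert.prems ray_div)
    have e_val: "val e \<rho>' = (if \<rho>' = \<rho> then 0 else val d \<rho>')" if "\<rho>' \<in> rays \<Sigma>" for \<rho>'
      using that by (simp add: e_def ray_div c_def)
    have "act \<Psi> \<Sigma> e z = (\<Sum>\<rho>'\<in>F. smul (Cst (val e \<rho>')) (act \<Psi> \<Sigma> (ray_div \<rho>') z))"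
      using insert.prems by (intro insert.IH e) (auto simp: e_val)
    also have "\<dots> = (\<Sum>\<rho>'\<in>F. smul (Cst (val d \<rho>')) (act \<Psi> \<Sigma> (ray_div \<rho>') z))"
      using insert.prems insert.hyps(2) by (intro sum.cong refl) (auto simp: e_val)
    finally have e_act: "act \<Psi> \<Sigma> e z = (\<Sum>\<rho>'\<in>F. smul (Cst (val d \<rho>')) (act \<Psi> \<Sigma> (ray_div \<rho>') z))" .
    have "d = (\<lambda>\<sigma> x. e \<sigma> x + c * ray_div \<rho> \<sigma> x)" by (simp add: e_def)
    then have "act \<Psi> \<Sigma> d z = act \<Psi> \<Sigma> e z + smul (Cst c) (act \<Psi> \<Sigma> (ray_div \<rho>) z)"
      using act_lin[OF e ray_div(1), of c \<rho> z] by simp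
    then show ?case using insert.hyps by (simp add: e_act c_def)
  qed
  from this[of "rays \<Sigma>" d] show ?thesis using assms finite_rays by simp
qed

subsection \<open>The complex of cones\<close>

definition faces :: "'v set set set" where
  "faces = {S. S \<subseteq> rays \<Sigma> \<and> (\<Sum>\<rho>\<in>S. \<rho>) \<in> \<Sigma>}"

abbreviation cone :: "'v set set \<Rightarrow> 'v set" where
  "cone S \<equiv> \<Sum>\<rho>\<in>S. \<rho>"

text \<open>
  Dividing by the multiplicity makes \<open>face_cycle S\<close> correspond to the square-free monomial of \<open>S\<close>.
\<close>

definition face_cycle :: "'v set set \<Rightarrow> 'v cyc" where
  "face_cycle S = (if S \<in> faces then smul (Cst (1 / of_nat (cone_mult \<Sigma> (cone S)))) (V (cone S)) else 0)"

definition face_coord :: "'v cyc \<Rightarrow> 'v set set \<Rightarrow> 'v lam" where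
  "face_coord z S = of_nat (cone_mult \<Sigma> (cone S)) * Poly_Mapping.lookup z (cone S)"

definition face_rel :: "'v set set \<Rightarrow> ('v set \<Rightarrow> 'v lam) \<Rightarrow> 'v lam \<Rightarrow> bool" where
  "face_rel S c l \<longleftrightarrow> (\<exists>m\<in>Psi_space \<Psi> (cone S). c = (\<lambda>\<rho>. Cst (m (gen \<rho>))) \<and> l = Lam_lin m)"

lemma faceD: "S \<in> faces \<Longrightarrow> S \<subseteq> rays \<Sigma>" "S \<in> faces \<Longrightarrow> cone S \<in> \<Sigma>"
  "S \<in> faces \<Longrightarrow> rays_of \<Sigma> (cone S) = S"
  by (auto simp: faces_def rays_of_sum)

lemma rays_of_face: "\<sigma> \<in> \<Sigma> \<Longrightarrow> rays_of \<Sigma> \<sigma> \<in> faces"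
  using rays_of_subset by (simp add: faces_def sum_rays_of)

lemma bij_faces: "bij_betw (\<lambda>S. cone S) faces \<Sigma>"
  by (rule bij_betw_byWitness[of _ "rays_of \<Sigma>"]) (auto simp: faceD rays_of_face sum_rays_of)

lemma face_down: "S \<in> faces \<Longrightarrow> T \<subseteq> S \<Longrightarrow> T \<in> faces"
proof -
  assume S: "S \<in> faces" and T: "T \<subseteq> S"
  have "cone T \<in> \<Sigma>"
    by (rule sum_subset_in_fan[OF faceD(2)[OF S]]) (simp add: faceD(3)[OF S] T)
  then show "T \<in> faces" using faceD(1)[OF S] T by (auto simp: faces_def)
qed

lemma of_nat_mult_Cst: "n > 0 \<Longrightarrow> of_nat n * Cst (1 / of_nat n) = (1 :: 'v lam)"
  by (simp flip: Cst_of_nat Cst_mult)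

lemma face_coord_face_cycle:
  assumes "S \<in> faces" "T \<in> faces"
  shows "face_coord (face_cycle S) T = (if S = T then 1 else 0)"
proof -
  have "cone S = cone T \<longleftrightarrow> S = T" using assms faceD(3) by metis
  then show ?thesis
    using assms cone_mult_pos[OF faceD(2)] of_nat_mult_Cst
    by (auto simp: face_coord_def face_cycle_def lookup_smul lookup_V)
qed

lemma coord_smul_face_cycle:
  assumes "S \<in> faces"
  shows "smul (face_coord z S) (face_cycle S) = smul (Poly_Mapping.lookup z (cone S)) (V (cone S))"
proof -
  have "(of_nat (cone_mult \<Sigma> (cone S)) * Poly_Mapping.lookup z (cone S)) *
      Cst (1 / of_nat (cone_mult \<Sigma> (cone S))) = Poly_Mapping.lookup z (cone S)"
    using of_nat_mult_Cst[OF cone_mult_pos[OF faceD(2)[OF assms]]]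
    by (simp add: mult.assoc mult.left_commute)
  then show ?thesis using assms by (simp add: face_coord_def face_cycle_def)
qed

lemma sum_faces: "(\<Sum>S\<in>faces. g (cone S)) = (\<Sum>\<sigma>\<in>\<Sigma>. g \<sigma>)"
  by (rule sum.reindex_bij_betw[OF bij_faces])

lemma sum_face_cycles:
  "(\<Sum>S\<in>faces. smul (face_coord z S) (face_cycle S)) =
    (\<Sum>\<sigma>\<in>\<Sigma>. smul (Poly_Mapping.lookup z \<sigma>) (V \<sigma>))"
  by (simp add: coord_smul_face_cycle sum_faces[where g = "\<lambda>\<sigma>. smul (Poly_Mapping.lookup z \<sigma>) (V \<sigma>)"]
      cong: sum.cong)

text \<open>
  The cones covering \<open>\<sigma>\<close> correspond to the rays \<open>\<rho>\<close> outside \<open>\<sigma>\<close> for which \<open>\<sigma> + \<rho>\<close> is a cone \<open>\<tau>\<close>.  The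
  difference of \<open>d\<^sub>\<tau>\<close> and \<open>d\<^sub>\<sigma>\<^sup>\<Psi>\<close> vanishes on \<open>\<sigma>\<close>, so its value at the normal vector is \<open>1 / k\<close> times its
  value at \<open>n\<^sub>\<rho>\<close>, and this factor is absorbed by \<open>mult \<tau> = k mult \<sigma>\<close>.
\<close>

lemma act_face_cycle:
  assumes d: "d \<in> Div \<Sigma>" and S: "S \<in> faces"
  shows "act \<Psi> \<Sigma> d (face_cycle S) =
    (\<Sum>\<rho>\<in>rays \<Sigma> - S. smul (Cst (val d \<rho> - ext (cone S) (d (cone S)) (gen \<rho>))) (face_cycle (insert \<rho> S)))
    + smul (Lam_lin (ext (cone S) (d (cone S)))) (face_cycle S)"
proof -
  define \<sigma> where "\<sigma> = cone S"
  define m where "m = ext \<sigma> (d \<sigma>)"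
  have \<sigma>: "\<sigma> \<in> \<Sigma>" "rays_of \<Sigma> \<sigma> = S" using S by (auto simp: \<sigma>_def faceD)
  have dd: "d \<sigma> \<in> dual (Q.span \<sigma>)" by (rule Div_dual[OF d \<sigma>(1)])
  have m: "m \<in> dual UNIV" unfolding m_def by (rule ext_dual[OF \<sigma>(1) dd])
  have finR: "finite (rays \<Sigma> - S)" by (simp add: finite_rays)
  define N where "N = {\<rho>\<in>rays \<Sigma> - S. insert \<rho> S \<in> faces}"
  have bij: "bij_betw (\<lambda>\<rho>. cone (insert \<rho> S)) N {\<tau>. \<tau> \<in> \<Sigma> \<and> covers \<tau> \<sigma>}"
  proof (rule bij_betw_imageI)
    show "inj_on (\<lambda>\<rho>. cone (insert \<rho> S)) N"
    proof (rule inj_onI)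
      fix \<rho> \<rho>' assume N: "\<rho> \<in> N" "\<rho>' \<in> N" and "cone (insert \<rho> S) = cone (insert \<rho>' S)"
      then have "insert \<rho> S = insert \<rho>' S" unfolding N_def by (metis (no_types, lifting) faceD(3) mem_Collect_eq)
      then show "\<rho> = \<rho>'" using N by (auto simp: N_def)
    qed
    show "(\<lambda>\<rho>. cone (insert \<rho> S)) ` N = {\<tau>. \<tau> \<in> \<Sigma> \<and> covers \<tau> \<sigma>}"
    proof (intro equalityI subsetI)
      fix \<tau> assume "\<tau> \<in> (\<lambda>\<rho>. cone (insert \<rho> S)) ` N"
      then obtain \<rho> where \<rho>: "\<rho> \<in> rays \<Sigma> - S" "insert \<rho> S \<in> faces" "\<tau> = cone (insert \<rho> S)"
        by (auto simp: N_def)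
      have "\<tau> \<in> \<Sigma>" "rays_of \<Sigma> \<tau> = insert \<rho> S" using faceD(2,3)[OF \<rho>(2)] \<rho>(3) by auto
      then show "\<tau> \<in> {\<tau>. \<tau> \<in> \<Sigma> \<and> covers \<tau> \<sigma>}"
        using covers_iff[OF \<sigma>(1), of \<tau>] \<sigma>(2) \<rho>(1) by auto
    next
      fix \<tau> assume "\<tau> \<in> {\<tau>. \<tau> \<in> \<Sigma> \<and> covers \<tau> \<sigma>}"
      then obtain \<rho> where \<rho>: "\<tau> \<in> \<Sigma>" "\<rho> \<in> rays \<Sigma> - S" "rays_of \<Sigma> \<tau> = insert \<rho> S"
        using covers_iff[OF \<sigma>(1), of \<tau>] \<sigma>(2) by auto
      have "\<rho> \<in> N" using rays_of_face[OF \<rho>(1)] \<rho> by (simp add: N_def)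
      moreover have "\<tau> = cone (insert \<rho> S)" using sum_rays_of[OF \<rho>(1)] \<rho>(3) by simp
      ultimately show "\<tau> \<in> (\<lambda>\<rho>. cone (insert \<rho> S)) ` N" by blast
    qed
  qed
  let ?s = "Cst (1 / of_nat (cone_mult \<Sigma> \<sigma>)) :: 'v lam"
  have coeff: "smul ?s (smul (Cst (d \<tau> (normal_rep \<tau> \<sigma>) - m (normal_rep \<tau> \<sigma>))) (V \<tau>)) =
      smul (Cst (val d \<rho> - m (gen \<rho>))) (face_cycle (insert \<rho> S))"
    if \<rho>: "\<rho> \<in> N" and \<tau>_def: "\<tau> = cone (insert \<rho> S)" for \<rho> \<tau>
  proof -
    have \<rho>': "\<rho> \<in> rays \<Sigma>" "\<rho> \<notin> S" "insert \<rho> S \<in> faces" using \<rho> by (auto simp: N_def)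
    have \<tau>: "\<tau> \<in> \<Sigma>" "rays_of \<Sigma> \<tau> = insert \<rho> S" using faceD(2,3)[OF \<rho>'(3)] \<tau>_def by auto
    have \<sigma>\<tau>: "\<sigma> \<subseteq> \<tau>" using subset_iff_rays_of[OF \<sigma>(1) \<tau>(1)] \<sigma>(2) \<tau>(2) by auto
    obtain k where k: "k > 0" "normal_rep \<tau> \<sigma> - (1 / of_nat k) *\<^sub>Q gen \<rho> \<in> Q.span \<sigma>"
      "cone_mult \<Sigma> \<tau> = k * cone_mult \<Sigma> \<sigma>"
      using normal_rep_and_mult[OF \<sigma>(1) \<tau>(1) \<rho>'(1)] \<rho>'(2) \<sigma>(2) \<tau>(2) by auto
    define s where "s = normal_rep \<tau> \<sigma> - (1 / of_nat k) *\<^sub>Q gen \<rho>"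
    have n: "normal_rep \<tau> \<sigma> = s + (1 / of_nat k) *\<^sub>Q gen \<rho>" by (simp add: s_def)
    have s: "s \<in> Q.span \<sigma>" using k(2) by (simp add: s_def)
    have s\<tau>: "s \<in> Q.span \<tau>" using s Q.span_mono[OF \<sigma>\<tau>] by blast
    have g\<tau>: "gen \<rho> \<in> Q.span \<tau>" using ray_gen_in_span[OF \<tau>(1)] \<tau>(2) by simp
    note d\<tau> = Div_dual[OF d \<tau>(1)]
    have 1: "d \<tau> (normal_rep \<tau> \<sigma>) = d \<tau> s + 1 / of_nat k * d \<tau> (gen \<rho>)"
      unfolding n dual_add[OF d\<tau> s\<tau> Q.span_scale[OF g\<tau>]] dual_scale[OF d\<tau> g\<tau>] ..
    have 2: "m (normal_rep \<tau> \<sigma>) = m s + 1 / of_nat k * m (gen \<rho>)"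
      unfolding n dual_add[OF m UNIV_I UNIV_I] dual_scale[OF m UNIV_I] ..
    have 3: "d \<tau> s = m s"
      using Div_on_span[OF d \<sigma>(1) \<tau>(1) \<sigma>\<tau> s] ext_on_span[OF \<sigma>(1) dd s] by (simp add: m_def)
    have 4: "d \<tau> (gen \<rho>) = val d \<rho>" using Div_ray_value[OF d \<tau>(1)] \<tau>(2) by simp
    have "d \<tau> (normal_rep \<tau> \<sigma>) - m (normal_rep \<tau> \<sigma>) = (val d \<rho> - m (gen \<rho>)) * (1 / of_nat k)"
      by (simp add: 1 2 3 4 diff_divide_distrib)
    then show ?thesis
      using \<rho>'(3)
      by (simp add: face_cycle_def \<tau>_def[symmetric] k(3) mult.commute flip: Cst_mult)
  qed
  have "act \<Psi> \<Sigma> d (face_cycle S) = smul ?s (act_cone d \<sigma>)"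
    using S \<sigma>(1) by (simp add: face_cycle_def act_smul act_V \<sigma>_def)
  also have "\<dots> = (\<Sum>\<tau> | \<tau> \<in> \<Sigma> \<and> covers \<tau> \<sigma>.
        smul ?s (smul (Cst (d \<tau> (normal_rep \<tau> \<sigma>) - m (normal_rep \<tau> \<sigma>))) (V \<tau>)))
      + smul (Lam_lin m) (smul ?s (V \<sigma>))"
    by (simp add: act_cone_def cyc.scale_right_distrib cyc.scale_sum_right m_def mult.commute)
  also have "smul ?s (V \<sigma>) = face_cycle S" using S by (simp add: face_cycle_def \<sigma>_def)
  also have "(\<Sum>\<tau> | \<tau> \<in> \<Sigma> \<and> covers \<tau> \<sigma>.
        smul ?s (smul (Cst (d \<tau> (normal_rep \<tau> \<sigma>) - m (normal_rep \<tau> \<sigma>))) (V \<tau>))) =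
      (\<Sum>\<rho>\<in>N. smul (Cst (val d \<rho> - m (gen \<rho>))) (face_cycle (insert \<rho> S)))"
    by (subst sum.reindex_bij_betw[OF bij, symmetric]) (intro sum.cong refl coeff)
  also have "\<dots> = (\<Sum>\<rho>\<in>rays \<Sigma> - S. smul (Cst (val d \<rho> - m (gen \<rho>))) (face_cycle (insert \<rho> S)))"
    unfolding N_def by (rule sum_mono_neutral_filter[OF finR]) (simp add: face_cycle_def)
  finally show ?thesis by (simp add: m_def \<sigma>_def)
qed

end

section \<open>The ring of equivariant cycles\<close>

context generic_simplicial
begin

abbreviation A :: "'v set \<Rightarrow> 'v cyc \<Rightarrow> 'v cyc" where
  "A \<rho> \<equiv> act \<Psi> \<Sigma> (ray_div \<rho>)"

text \<open>
  The divisor whose local equations are the restrictions of \<open>m\<close> has \<open>d\<^sub>\<sigma>\<^sup>\<Psi> = m\<close>, because \<open>m \<in> \<Psi>(\<sigma>)\<close> is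
  recovered from its restriction to \<open>\<sigma>\<close>.  So all coefficients at larger cones cancel.
\<close>

lemma face_rel_act:
  assumes S: "S \<in> faces" and rel: "face_rel S c l"
  shows "(\<Sum>\<rho>\<in>rays \<Sigma>. smul (c \<rho>) (A \<rho> (face_cycle S))) = smul l (face_cycle S)"
proof -
  obtain m where m: "m \<in> Psi_space \<Psi> (cone S)" "c = (\<lambda>\<rho>. Cst (m (gen \<rho>)))" "l = Lam_lin m"
    using rel by (auto simp: face_rel_def)
  note \<sigma> = faceD(2)[OF S]
  obtain f where f: "f \<in> dual (Q.span (cone S))" "m = ext (cone S) f"
    using m(1) by (auto simp: Psi_space_def)
  have mU: "m \<in> dual UNIV" using f ext_dual[OF \<sigma>] by simp
  define d where "d \<sigma> = (if \<sigma> \<in> \<Sigma> then restr (Q.span \<sigma>) m else (\<lambda>_. 0))" for \<sigma>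
  have "restr (Q.span \<sigma>) (d \<tau>) = d \<sigma>" if "\<sigma> \<in> \<Sigma>" "\<tau> \<in> \<Sigma>" "\<sigma> \<subseteq> \<tau>" for \<sigma> \<tau>
    using that Q.span_mono[OF that(3)] by (auto simp: d_def restr_def fun_eq_iff)
  then have d: "d \<in> Div \<Sigma>"
    by (simp add: Div_def) (simp add: d_def restr_dual_UNIV mU)
  have val: "val d \<rho> = m (gen \<rho>)" if "\<rho> \<in> rays \<Sigma>" for \<rho>
    using that ray_gen_in_span[OF ray_in_fan, of \<rho> \<rho>]
    by (simp add: d_def ray_in_fan restr_def rays_of_ray)
  have "ext (cone S) (d (cone S)) = m"
    using restr_ext[OF \<sigma> f(1)] f(2) \<sigma> by (simp add: d_def)
  moreover have "(\<Sum>\<rho>\<in>rays \<Sigma> - S. smul (Cst (val d \<rho> - m (gen \<rho>))) (face_cycle (insert \<rho> S))) = 0"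
    by (intro sum.neutral ballI) (simp add: val)
  ultimately have "act \<Psi> \<Sigma> d (face_cycle S) = smul l (face_cycle S)"
    by (simp add: act_face_cycle[OF d S] m(3))
  moreover have "act \<Psi> \<Sigma> d (face_cycle S) = (\<Sum>\<rho>\<in>rays \<Sigma>. smul (c \<rho>) (A \<rho> (face_cycle S)))"
    unfolding act_expand[OF d] by (intro sum.cong refl) (simp add: val m(2))
  ultimately show ?thesis by simp
qed

lemma face_rel_mono:
  assumes T: "T \<in> faces" and ST: "S \<subseteq> T" and rel: "face_rel S c l"
  shows "face_rel T c l"
proof -
  have S: "S \<in> faces" using face_down[OF T ST] .
  have "cone S \<subseteq> cone T"
    using subset_iff_rays_of[OF faceD(2)[OF S] faceD(2)[OF T]] ST by (simp add: faceD S T)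
  then show ?thesis
    using Psi_space_mono[OF faceD(2)[OF S] faceD(2)[OF T]] rel unfolding face_rel_def by blast
qed

lemma face_rel_delta:
  assumes S: "S \<in> faces" and \<rho>: "\<rho> \<in> S"
  shows "\<exists>c l. face_rel S c l \<and> (\<forall>j\<in>S. c j = (if j = \<rho> then 1 else 0))"
proof -
  note \<sigma> = faceD(2)[OF S]
  let ?m = "ext (cone S) (ray_div \<rho> (cone S))"
  have "face_rel S (\<lambda>\<rho>. Cst (?m (gen \<rho>))) (Lam_lin ?m)"
    unfolding face_rel_def Psi_space_def using Div_dual[OF ray_div(1) \<sigma>] by blast
  moreover have "Cst (?m (gen j)) = (if j = \<rho> then 1 else 0 :: 'v lam)" if j: "j \<in> S" for j
  proof -
    have jr: "j \<in> rays_of \<Sigma> (cone S)" "j \<in> rays \<Sigma>" using j faceD[OF S] by auto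
    have "?m (gen j) = ray_div \<rho> (cone S) (gen j)"
      by (rule ext_on_span[OF \<sigma> Div_dual[OF ray_div(1) \<sigma>] ray_gen_in_span[OF \<sigma> jr(1)]])
    also have "\<dots> = (if j = \<rho> then 1 else 0)"
      using Div_ray_value[OF ray_div(1) \<sigma> jr(1)] ray_div(2)[OF jr(2)] by simp
    finally show ?thesis by simp
  qed
  ultimately show ?thesis by (intro exI conjI ballI)
qed

text \<open>
  The local equation of the ray divisor vanishes on a cone that does not contain the ray.
\<close>

lemma A_face_cycle:
  assumes \<rho>: "\<rho> \<in> rays \<Sigma>" "\<rho> \<notin> S" and S: "S \<in> faces"
  shows "A \<rho> (face_cycle S) = face_cycle (insert \<rho> S)"
proof -
  note \<sigma> = faceD(2)[OF S]
  have "ray_div \<rho> (cone S) = (\<lambda>_. 0)"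
  proof (rule dual_cone_eqI[OF \<sigma> Div_dual[OF ray_div(1) \<sigma>]])
    fix j assume j: "j \<in> rays_of \<Sigma> (cone S)"
    then have "j \<in> rays \<Sigma>" "j \<noteq> \<rho>" using faceD[OF S] \<rho> by auto
    then show "ray_div \<rho> (cone S) (gen j) = 0"
      using Div_ray_value[OF ray_div(1) \<sigma> j] by (simp add: ray_div)
  qed (simp add: dual_def)
  then have "ext (cone S) (ray_div \<rho> (cone S)) = (\<lambda>_. 0)" by (simp add: ext_zero \<sigma>)
  then have "A \<rho> (face_cycle S) =
      (\<Sum>j\<in>rays \<Sigma> - S. smul (Cst (val (ray_div \<rho>) j)) (face_cycle (insert j S)))"
    by (simp add: act_face_cycle[OF ray_div(1) S] Lam_lin_def)
  also have "\<dots> = (\<Sum>j\<in>rays \<Sigma> - S. if j = \<rho> then face_cycle (insert j S) else 0)"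
    by (intro sum.cong refl) (simp add: ray_div)
  also have "\<dots> = face_cycle (insert \<rho> S)" using \<rho> finite_rays by simp
  finally show ?thesis .
qed

lemma act_sum: "act \<Psi> \<Sigma> d (sum g I) = (\<Sum>x\<in>I. act \<Psi> \<Sigma> d (g x))"
  using act_add[of d 0 0] by (induction I rule: infinite_finite_induct) (auto simp: act_add)

lemma act_support: "act \<Psi> \<Sigma> d (\<Sum>\<sigma>\<in>\<Sigma>. smul (Poly_Mapping.lookup z \<sigma>) (V \<sigma>)) = act \<Psi> \<Sigma> d z"
  by (simp add: act_sum act_smul act_V act_eq[of d z] cong: sum.cong)

sublocale face: face_module smul "carrier Lam" "rays \<Sigma>" faces face_cycle face_coord A face_rel
proof
  show "unital_subring (carrier Lam)" by (rule unital_subring_Lam)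
  show "finite (rays \<Sigma>)" by (rule finite_rays)
  show "S \<subseteq> rays \<Sigma>" if "S \<in> faces" for S by (rule faceD(1)[OF that])
  show "{} \<in> faces" by (simp add: faces_def set_zero zero_cone)
  show "T \<in> faces" if "S \<in> faces" "T \<subseteq> S" for S T by (rule face_down[OF that])
  show "face_cycle S = 0" if "S \<notin> faces" for S using that by (simp add: face_cycle_def)
  show "face_coord (face_cycle S) T = (if S = T then 1 else 0)" if "S \<in> faces" "T \<in> faces" for S T
    by (rule face_coord_face_cycle[OF that])
  show "face_coord (x + y) T = face_coord x T + face_coord y T" for x y T
    by (simp add: face_coord_def lookup_add distrib_left)
  show "face_coord (smul a x) T = a * face_coord x T" for a x T
    by (simp add: face_coord_def lookup_smul mult.left_commute)
  show "A i (x + y) = A i x + A i y" for i x y by (rule act_add)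
  show "A i (smul a x) = smul a (A i x)" for i a x by (rule act_smul)
  show "A i (\<Sum>S\<in>faces. smul (face_coord z S) (face_cycle S)) = A i z" for i z
    by (simp add: sum_face_cycles act_support)
  show "A i (face_cycle S) = face_cycle (insert i S)" if "i \<in> rays \<Sigma>" "S \<in> faces" "i \<notin> S" for i S
    by (rule A_face_cycle[OF that(1,3,2)])
  show "l \<in> carrier Lam \<and> (\<forall>j\<in>rays \<Sigma>. c j \<in> carrier Lam)" if "face_rel S c l" for S c l
    using that by (auto simp: face_rel_def Cst_in_Lam Lam_lin_in_Lam)
  show "(\<Sum>j\<in>rays \<Sigma>. smul (c j) (A j (face_cycle S))) = smul l (face_cycle S)"
    if "S \<in> faces" "face_rel S c l" for S c l by (rule face_rel_act[OF that])
  show "face_rel T c l" if "T \<in> faces" "S \<subseteq> T" "face_rel S c l" for S T c l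
    by (rule face_rel_mono[OF that])
  show "\<exists>c l. face_rel S c l \<and> (\<forall>j\<in>S. c j = (if j = i then 1 else 0))"
    if "S \<in> faces" "i \<in> S" for S i by (rule face_rel_delta[OF that])
qed

lemma D_span_eq_cycles: "face.D_span = cycles \<Sigma>"
proof (intro equalityI subsetI)
  fix z assume z: "z \<in> face.D_span"
  then have eq: "z = (\<Sum>\<sigma>\<in>\<Sigma>. smul (Poly_Mapping.lookup z \<sigma>) (V \<sigma>))"
    unfolding face.D_span_def sum_face_cycles by blast
  show "z \<in> cycles \<Sigma>" unfolding cycles_def
  proof (intro CollectI ballI conjI)
    fix \<sigma> assume k: "\<sigma> \<in> Poly_Mapping.keys z"
    have L: "Poly_Mapping.lookup z \<sigma> = (\<Sum>\<tau>\<in>\<Sigma>. Poly_Mapping.lookup z \<tau> * (if \<tau> = \<sigma> then 1 else 0))"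
      using arg_cong[OF eq, of "\<lambda>z. Poly_Mapping.lookup z \<sigma>"]
      by (simp only: lookup_sum lookup_smul lookup_V)
    show \<sigma>: "\<sigma> \<in> \<Sigma>"
    proof (rule ccontr)
      assume "\<sigma> \<notin> \<Sigma>"
      then have "Poly_Mapping.lookup z \<sigma> = 0" by (subst L, intro sum.neutral) auto
      then show False using k by (simp add: in_keys_iff)
    qed
    define S where "S = rays_of \<Sigma> \<sigma>"
    have S: "S \<in> faces" "cone S = \<sigma>" using \<sigma> by (auto simp: S_def rays_of_face sum_rays_of)
    have "Cst (1 / of_nat (cone_mult \<Sigma> \<sigma>)) * face_coord z S \<in> carrier Lam"
      using z S(1) by (intro subring_mult[OF unital_subring_Lam] Cst_in_Lam) (simp add: face.D_span_def)
    also have "Cst (1 / of_nat (cone_mult \<Sigma> \<sigma>)) * face_coord z S = Poly_Mapping.lookup z \<sigma>"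
      using of_nat_mult_Cst[OF cone_mult_pos[OF \<sigma>]]
      by (simp add: face_coord_def S(2) mult.commute mult.left_commute mult.assoc[symmetric])
    finally show "Poly_Mapping.lookup z \<sigma> \<in> carrier Lam" .
  qed
next
  fix z assume z: "z \<in> cycles \<Sigma>"
  have C: "Poly_Mapping.lookup z \<sigma> \<in> carrier Lam" for \<sigma>
    using z subring_zero[OF unital_subring_Lam]
    by (cases "\<sigma> \<in> Poly_Mapping.keys z") (auto simp: cycles_def in_keys_iff)
  have out: "Poly_Mapping.lookup z \<sigma> = 0" if "\<sigma> \<notin> \<Sigma>" for \<sigma>
    using z that by (auto simp: cycles_def in_keys_iff)
  have "z = (\<Sum>\<sigma>\<in>\<Sigma>. smul (Poly_Mapping.lookup z \<sigma>) (V \<sigma>))"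
  proof (rule poly_mapping_eqI)
    fix \<sigma>
    have "(\<Sum>\<tau>\<in>\<Sigma>. Poly_Mapping.lookup z \<tau> * (if \<tau> = \<sigma> then 1 else 0)) =
        (\<Sum>\<tau>\<in>\<Sigma>. if \<tau> = \<sigma> then Poly_Mapping.lookup z \<tau> else 0)"
      by (intro sum.cong) auto
    then show "Poly_Mapping.lookup z \<sigma> =
        Poly_Mapping.lookup (\<Sum>\<sigma>\<in>\<Sigma>. smul (Poly_Mapping.lookup z \<sigma>) (V \<sigma>)) \<sigma>"
      using out[of \<sigma>] by (simp add: lookup_sum lookup_smul lookup_V finite_cones)
  qed
  then show "z \<in> face.D_span"
    unfolding face.D_span_def sum_face_cycles
    by (auto simp: face_coord_def intro!: subring_mult[OF unital_subring_Lam]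
        subring_of_nat[OF unital_subring_Lam] C)
qed

text \<open>
  The polynomial in the definition of \<open>to_AT\<close> is the normal form: the multiplicity appears when the
  coordinates with respect to \<open>V \<sigma>\<close> are turned into those with respect to \<open>D\<^sub>\<sigma>\<close>.
\<close>

lemma to_AT_normal_form: "to_AT \<Sigma> z = AT_ideal \<Sigma> +>\<^bsub>D_ring \<Sigma>\<^esub> face.normal_form z"
proof -
  have "face.normal_form z = (\<Sum>S\<in>faces. Cst (Poly_Mapping.lookup z (cone S)) *
      (of_nat (cone_mult \<Sigma> (cone S)) * (\<Prod>\<rho>\<in>rays_of \<Sigma> (cone S). Var \<rho>)))"
    unfolding face.normal_form_def
    by (intro sum.cong refl) (simp add: face_coord_def faceD Cst_mult Cst_of_nat ac_simps)
  also have "\<dots> = (\<Sum>\<sigma>\<in>\<Sigma>. Cst (Poly_Mapping.lookup z \<sigma>) *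
      (of_nat (cone_mult \<Sigma> \<sigma>) * (\<Prod>\<rho>\<in>rays_of \<Sigma> \<sigma>. Var \<rho>)))"
    by (rule sum_faces[where g = "\<lambda>\<sigma>. Cst (Poly_Mapping.lookup z \<sigma>) *
      (of_nat (cone_mult \<Sigma> \<sigma>) * (\<Prod>\<rho>\<in>rays_of \<Sigma> \<sigma>. Var \<rho>))"])
  finally show ?thesis by (simp add: to_AT_def)
qed

lemma face_cycle_empty: "face_cycle {} = V {0}"
  using face.empty_face by (simp add: face_cycle_def set_zero cone_mult_zero)

lemma face_cycle_ray: "\<rho> \<in> rays \<Sigma> \<Longrightarrow> face_cycle {\<rho>} = V \<rho>"
  by (simp add: face_cycle_def faces_def ray_in_fan cone_mult_ray)

subsection \<open>The ideals\<close>

abbreviation SR_gens :: "'v dpoly set" where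
  "SR_gens \<equiv> {\<Prod>\<rho>\<in>S. Var \<rho> | S. S \<subseteq> rays \<Sigma> \<and> (\<Sum>\<rho>\<in>S. \<rho>) \<notin> \<Sigma>}"

abbreviation J_gens :: "('v set \<Rightarrow> ('v \<Rightarrow> rat) set) \<Rightarrow> 'v dpoly set" where
  "J_gens P \<equiv> {(\<Prod>\<rho>\<in>S. Var \<rho>) *
        ((\<Sum>\<rho>\<in>rays \<Sigma>. Cst (Cst (m (ray_gen \<rho>))) * Var \<rho>) - Cst (Lam_lin m))
        | S m. S \<subseteq> rays \<Sigma> \<and> (\<Sum>\<rho>\<in>S. \<rho>) \<in> \<Sigma> \<and> m \<in> P (\<Sum>\<rho>\<in>S. \<rho>)}"

lemma cring_D: "cring (D_ring \<Sigma>)"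
  unfolding D_ring_def by (rule cring_poly_ring[OF unital_subring_Lam])

lemma ring_D: "ring (D_ring \<Sigma>)"
  using cring_D by (rule cring.axioms(1))

lemma SR_gens_in_D: "SR_gens \<subseteq> carrier (D_ring \<Sigma>)"
  using face.prod_Var_in_P by (auto simp: D_ring_def)

lemma J_gens_in_D: "J_gens P \<subseteq> carrier (D_ring \<Sigma>)"
proof -
  note U = unital_subring_poly_ring[OF unital_subring_Lam]
  have "(\<Prod>\<rho>\<in>S. Var \<rho>) *
      ((\<Sum>\<rho>\<in>rays \<Sigma>. Cst (Cst (m (ray_gen \<rho>))) * Var \<rho>) - Cst (Lam_lin m)) \<in> carrier (D_ring \<Sigma>)"
    if "S \<subseteq> rays \<Sigma>" for S m
    unfolding D_ring_def
    by (intro subring_mult[OF U] subring_diff[OF U] subring_sum[OF U] face.prod_Var_in_P that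
        Cst_in_poly_ring[OF unital_subring_Lam] Cst_in_Lam Lam_lin_in_Lam
        Var_in_poly_ring[OF unital_subring_Lam])
  then show ?thesis by blast
qed

lemma ideal_SR_J:
  "ideal (SR_ideal \<Sigma> <+>\<^bsub>D_ring \<Sigma>\<^esub> J_ideal P \<Sigma>) (D_ring \<Sigma>)"
  "SR_gens \<union> J_gens P \<subseteq> SR_ideal \<Sigma> <+>\<^bsub>D_ring \<Sigma>\<^esub> J_ideal P \<Sigma>"
  "ideal I (D_ring \<Sigma>) \<Longrightarrow> SR_gens \<union> J_gens P \<subseteq> I \<Longrightarrow> SR_ideal \<Sigma> <+>\<^bsub>D_ring \<Sigma>\<^esub> J_ideal P \<Sigma> \<subseteq> I"
proof -
  interpret D: ring "D_ring \<Sigma>" by (rule ring_D)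
  have SR: "ideal (SR_ideal \<Sigma>) (D_ring \<Sigma>)" "SR_gens \<subseteq> SR_ideal \<Sigma>"
    unfolding SR_ideal_def by (rule D.genideal_ideal[OF SR_gens_in_D] D.genideal_self[OF SR_gens_in_D])+
  have J: "ideal (J_ideal P \<Sigma>) (D_ring \<Sigma>)" "J_gens P \<subseteq> J_ideal P \<Sigma>"
    unfolding J_ideal_def by (rule D.genideal_ideal[OF J_gens_in_D] D.genideal_self[OF J_gens_in_D])+
  have carr: "SR_ideal \<Sigma> \<union> J_ideal P \<Sigma> \<subseteq> carrier (D_ring \<Sigma>)"
    using ideal.Icarr[OF SR(1)] ideal.Icarr[OF J(1)] by blast
  note union = D.union_genideal[OF SR(1) J(1)]
  show "ideal (SR_ideal \<Sigma> <+>\<^bsub>D_ring \<Sigma>\<^esub> J_ideal P \<Sigma>) (D_ring \<Sigma>)"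
    unfolding union[symmetric] by (rule D.genideal_ideal[OF carr])
  show "SR_gens \<union> J_gens P \<subseteq> SR_ideal \<Sigma> <+>\<^bsub>D_ring \<Sigma>\<^esub> J_ideal P \<Sigma>"
    using D.genideal_self[OF carr] SR(2) J(2) unfolding union
    by (intro Un_least order_trans[OF SR(2)] order_trans[OF J(2)]) simp_all
  show "SR_ideal \<Sigma> <+>\<^bsub>D_ring \<Sigma>\<^esub> J_ideal P \<Sigma> \<subseteq> I"
    if I: "ideal I (D_ring \<Sigma>)" "SR_gens \<union> J_gens P \<subseteq> I"
  proof -
    have "SR_ideal \<Sigma> \<subseteq> I" unfolding SR_ideal_def by (rule D.genideal_minimal[OF I(1)]) (use I in simp)
    moreover have "J_ideal P \<Sigma> \<subseteq> I" unfolding J_ideal_def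
      by (rule D.genideal_minimal[OF I(1)]) (use I in simp)
    ultimately show ?thesis unfolding union[symmetric] by (intro D.genideal_minimal[OF I(1)]) simp
  qed
qed

lemma relators_eq: "face.relators = SR_gens \<union> J_gens (Psi_space \<Psi>)"
proof -
  have 1: "{(\<Prod>\<rho>\<in>S. Var \<rho>) | S. S \<subseteq> rays \<Sigma> \<and> S \<notin> faces} = SR_gens"
    by (auto simp: faces_def)
  have 2: "{(\<Prod>i\<in>S. Var i) * ((\<Sum>j\<in>rays \<Sigma>. Cst (c j) * Var j) - Cst l) | S c l. S \<in> faces \<and> face_rel S c l}
      = J_gens (Psi_space \<Psi>)"
  proof (intro equalityI subsetI)
    fix p assume "p \<in> {(\<Prod>i\<in>S. Var i) * ((\<Sum>j\<in>rays \<Sigma>. Cst (c j) * Var j) - Cst l) | S c l.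
      S \<in> faces \<and> face_rel S c l}"
    then show "p \<in> J_gens (Psi_space \<Psi>)" by (auto simp: face_rel_def faces_def)
  next
    fix p assume "p \<in> J_gens (Psi_space \<Psi>)"
    then obtain S m where p: "p = (\<Prod>\<rho>\<in>S. Var \<rho>) *
        ((\<Sum>\<rho>\<in>rays \<Sigma>. Cst (Cst (m (gen \<rho>))) * Var \<rho>) - Cst (Lam_lin m))"
      and S: "S \<in> faces" "m \<in> Psi_space \<Psi> (cone S)"
      by (auto simp: faces_def)
    have "face_rel S (\<lambda>\<rho>. Cst (m (gen \<rho>))) (Lam_lin m)" using S(2) by (auto simp: face_rel_def)
    with p S(1) show "p \<in> {(\<Prod>i\<in>S. Var i) * ((\<Sum>j\<in>rays \<Sigma>. Cst (c j) * Var j) - Cst l) | S c l.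
      S \<in> faces \<and> face_rel S c l}"
      by (intro CollectI exI[of _ S] exI[of _ "\<lambda>\<rho>. Cst (m (gen \<rho>))"] exI[of _ "Lam_lin m"] conjI)
  qed
  show ?thesis unfolding face.relators_def 1 2 ..
qed

lemma ideal_Psi: "ideal (Psi_ideal \<Psi> \<Sigma>) (D_ring \<Sigma>)"
  and relators_Psi: "face.relators \<subseteq> Psi_ideal \<Psi> \<Sigma>"
  and Psi_minimal: "ideal I (D_ring \<Sigma>) \<Longrightarrow> face.relators \<subseteq> I \<Longrightarrow> Psi_ideal \<Psi> \<Sigma> \<subseteq> I"
  unfolding Psi_ideal_def relators_eq by (fact ideal_SR_J)+

lemma ideal_AT: "ideal (AT_ideal \<Sigma>) (D_ring \<Sigma>)"
  unfolding AT_ideal_def by (rule ideal_SR_J)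

lemma Psi_subset_AT: "Psi_ideal \<Psi> \<Sigma> \<subseteq> AT_ideal \<Sigma>"
proof (rule Psi_minimal[OF ideal_AT])
  have "J_gens (Psi_space \<Psi>) \<subseteq> J_gens (\<lambda>\<sigma>. dual UNIV)"
    using Psi_space_dual by blast
  then show "face.relators \<subseteq> AT_ideal \<Sigma>"
    using ideal_SR_J(2)[of "\<lambda>\<sigma>. dual UNIV"] unfolding relators_eq AT_ideal_def by blast
qed

subsection \<open>The cycle ring\<close>

abbreviation Cyc :: "('v lam, 'v cyc) module" where
  "Cyc \<equiv> cycle_ring \<Sigma> face.face_prod"

lemma Cyc_simps [simp]: "carrier (cycle_ring \<Sigma> f) = cycles \<Sigma>" "mult (cycle_ring \<Sigma> f) = f"
  "one (cycle_ring \<Sigma> f) = V {0}" "zero (cycle_ring \<Sigma> f) = 0" "add (cycle_ring \<Sigma> f) = (+)"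
  "Module.smult (cycle_ring \<Sigma> f) = smul"
  by (simp_all add: cycle_ring_def)

lemma cring_Cyc: "cring Cyc"
proof (rule cringI)
  show "abelian_group Cyc"
  proof (rule abelian_groupI)
    fix z assume "z \<in> carrier Cyc"
    then have "0 - z \<in> cycles \<Sigma>" using face.D_span_diff[OF face.D_span_zero] by (simp add: D_span_eq_cycles)
    then show "\<exists>y\<in>carrier Cyc. y \<oplus>\<^bsub>Cyc\<^esub> z = \<zero>\<^bsub>Cyc\<^esub>" by (intro bexI[of _ "0 - z"]) auto
  qed (use face.D_span_add face.D_span_zero in \<open>auto simp: D_span_eq_cycles algebra_simps\<close>)
  show "Group.comm_monoid Cyc"
    using face.face_prod_in_D_span face.face_prod_assoc face.face_prod_commute face.face_prod_D_empty
      face.D_in_D_span[of "{}"]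
    by (intro comm_monoidI) (auto simp: D_span_eq_cycles face_cycle_empty)
qed (simp add: face.face_prod_add)

lemma cring_Lam: "cring Lam"
  unfolding Lam_def by (rule cring_poly_ring[OF unital_subring_UNIV])

lemma Lam_simps: "mult Lam = (*)" "add Lam = (+)" "one Lam = 1"
  by (simp_all add: Lam_def)

lemma algebra_Cyc: "algebra Lam Cyc"
  by (rule algebraI[OF cring_Lam cring_Cyc])
    (use face.D_span_scale in \<open>auto simp: D_span_eq_cycles Lam_simps cyc.scale_left_distrib cyc.scale_right_distrib
      face.face_prod_scale\<close>)

lemma cycle_of_hom: "face.cycle_of \<in> ring_hom (D_ring \<Sigma>) Cyc"
  by (rule ring_hom_memI)
    (use face.cycle_of_in_D_span face.cycle_of_mult in \<open>auto simp: D_ring_def D_span_eq_cycles face.cycle_of_add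
      face.cycle_of_one face_cycle_empty\<close>)

lemma normal_form_cong_Psi:
  "p \<in> carrier (D_ring \<Sigma>) \<Longrightarrow> p - face.normal_form (face.cycle_of p) \<in> Psi_ideal \<Psi> \<Sigma>"
  using face.normal_form_cong ideal_Psi relators_Psi by (simp add: D_ring_def)

lemma ring_hom_cycle_of: "ring_hom_ring (D_ring \<Sigma>) Cyc face.cycle_of"
  by (rule ring_hom_ringI2[OF ring_D cring.axioms(1)[OF cring_Cyc] cycle_of_hom])

text \<open>
  The kernel is an ideal containing the relators.  Conversely, an element of the kernel is congruent to
  the normal form of \<open>0\<close>.
\<close>

lemma kernel_cycle_of: "a_kernel (D_ring \<Sigma>) Cyc face.cycle_of = Psi_ideal \<Psi> \<Sigma>"
proof -
  have ker: "a_kernel (D_ring \<Sigma>) Cyc face.cycle_of = {p\<in>carrier (D_ring \<Sigma>). face.cycle_of p = 0}"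
    by (simp add: a_kernel_def')
  have "face.relators \<subseteq> a_kernel (D_ring \<Sigma>) Cyc face.cycle_of"
    using face.cycle_of_relators relators_Psi ideal.Icarr[OF ideal_Psi] by (auto simp: ker)
  then have "Psi_ideal \<Psi> \<Sigma> \<subseteq> a_kernel (D_ring \<Sigma>) Cyc face.cycle_of"
    by (rule Psi_minimal[OF ring_hom_ring.kernel_is_ideal[OF ring_hom_cycle_of]])
  moreover have "p \<in> Psi_ideal \<Psi> \<Sigma>" if "p \<in> a_kernel (D_ring \<Sigma>) Cyc face.cycle_of" for p
    using normal_form_cong_Psi[of p] that by (simp add: ker face.normal_form_zero)
  ultimately show ?thesis by blast
qed

lemma cycle_of_Psi: "p \<in> Psi_ideal \<Psi> \<Sigma> \<Longrightarrow> face.cycle_of p = 0"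
  using kernel_cycle_of by (auto simp: a_kernel_def')

lemma coset_eqI:
  assumes "ideal I (D_ring \<Sigma>)" "p \<in> carrier (D_ring \<Sigma>)" "q \<in> carrier (D_ring \<Sigma>)" "p - q \<in> I"
  shows "I +>\<^bsub>D_ring \<Sigma>\<^esub> p = I +>\<^bsub>D_ring \<Sigma>\<^esub> q"
  using poly_ring_coset_eq_iff[OF unital_subring_Lam] assms unfolding D_ring_def by blast

lemma normal_form_in_D: "z \<in> cycles \<Sigma> \<Longrightarrow> face.normal_form z \<in> carrier (D_ring \<Sigma>)"
  using face.normal_form_in_P by (simp add: D_ring_def D_span_eq_cycles)

lemma D_simps: "mult (D_ring \<Sigma>) = (*)" "add (D_ring \<Sigma>) = (+)" "one (D_ring \<Sigma>) = 1"
  by (simp_all add: D_ring_def)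

text \<open>
  A polynomial differs from its normal form by an element of \<open>I + J\<^sup>\<Psi> \<subseteq> I + J'\<close>.
\<close>

lemma to_AT_cycle_of:
  assumes "p \<in> carrier (D_ring \<Sigma>)"
  shows "to_AT \<Sigma> (face.cycle_of p) = AT_ideal \<Sigma> +>\<^bsub>D_ring \<Sigma>\<^esub> p"
proof -
  have "face.cycle_of p \<in> cycles \<Sigma>" using ring_hom_closed[OF cycle_of_hom assms] by simp
  then show ?thesis
    unfolding to_AT_normal_form
    using coset_eqI[OF ideal_AT assms normal_form_in_D] normal_form_cong_Psi[OF assms] Psi_subset_AT by auto
qed

lemma cycle_of_surj: "face.cycle_of ` carrier (D_ring \<Sigma>) = cycles \<Sigma>"
  using face.cycle_of_image by (simp add: D_ring_def D_span_eq_cycles)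

lemma to_AT_hom: "to_AT \<Sigma> \<in> ring_hom Cyc (AT_ring \<Sigma>)"
proof (rule ring_hom_memI)
  interpret D: ring "D_ring \<Sigma>" by (rule ring_D)
  note hom = ideal.rcos_ring_hom[OF ideal_AT, folded AT_ring_def]
  note E = cycle_of_surj[symmetric]
  show "to_AT \<Sigma> z \<in> carrier (AT_ring \<Sigma>)" if "z \<in> carrier Cyc" for z
    using ring_hom_closed[OF hom normal_form_in_D] that by (simp add: to_AT_normal_form)
  fix x y assume "x \<in> carrier Cyc" "y \<in> carrier Cyc"
  then obtain p q where p: "p \<in> carrier (D_ring \<Sigma>)" "x = face.cycle_of p"
    and q: "q \<in> carrier (D_ring \<Sigma>)" "y = face.cycle_of q" by (auto simp: E)
  show "to_AT \<Sigma> (x \<otimes>\<^bsub>Cyc\<^esub> y) = to_AT \<Sigma> x \<otimes>\<^bsub>AT_ring \<Sigma>\<^esub> to_AT \<Sigma> y"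
    using ring_hom_mult[OF hom p(1) q(1)] ring_hom_mult[OF cycle_of_hom p(1) q(1)]
      to_AT_cycle_of[OF D.m_closed[OF p(1) q(1)]] to_AT_cycle_of[OF p(1)] to_AT_cycle_of[OF q(1)]
    by (simp add: p(2) q(2))
  show "to_AT \<Sigma> (x \<oplus>\<^bsub>Cyc\<^esub> y) = to_AT \<Sigma> x \<oplus>\<^bsub>AT_ring \<Sigma>\<^esub> to_AT \<Sigma> y"
    using ring_hom_add[OF hom p(1) q(1)] ring_hom_add[OF cycle_of_hom p(1) q(1)]
      to_AT_cycle_of[OF D.a_closed[OF p(1) q(1)]] to_AT_cycle_of[OF p(1)] to_AT_cycle_of[OF q(1)]
    by (simp add: p(2) q(2))
next
  interpret D: ring "D_ring \<Sigma>" by (rule ring_D)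
  show "to_AT \<Sigma> \<one>\<^bsub>Cyc\<^esub> = \<one>\<^bsub>AT_ring \<Sigma>\<^esub>"
    using ring_hom_one[OF ideal.rcos_ring_hom[OF ideal_AT, folded AT_ring_def]] to_AT_cycle_of[OF D.one_closed]
      ring_hom_one[OF cycle_of_hom] by simp
qed

lemma to_AT_surj: "to_AT \<Sigma> ` cycles \<Sigma> = carrier (AT_ring \<Sigma>)"
proof -
  have "to_AT \<Sigma> ` cycles \<Sigma> = (\<lambda>p. AT_ideal \<Sigma> +>\<^bsub>D_ring \<Sigma>\<^esub> p) ` carrier (D_ring \<Sigma>)"
    unfolding cycle_of_surj[symmetric] image_image by (intro image_cong refl) (rule to_AT_cycle_of)
  also have "\<dots> = carrier (AT_ring \<Sigma>)"
    by (auto simp: AT_ring_def FactRing_def A_RCOSETS_def')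
  finally show ?thesis .
qed

lemma presentation:
  "\<exists>\<phi> \<in> ring_iso (D_ring \<Sigma> Quot Psi_ideal \<Psi> \<Sigma>) Cyc.
     \<forall>p\<in>carrier (D_ring \<Sigma>). \<phi> (Psi_ideal \<Psi> \<Sigma> +>\<^bsub>D_ring \<Sigma>\<^esub> p) = face.cycle_of p"
proof -
  have iso: "(\<lambda>X. the_elem (face.cycle_of ` X)) \<in> ring_iso (D_ring \<Sigma> Quot Psi_ideal \<Psi> \<Sigma>) Cyc"
    using ring_hom_ring.FactRing_iso_set[OF ring_hom_cycle_of] cycle_of_surj kernel_cycle_of by simp
  have "the_elem (face.cycle_of ` (Psi_ideal \<Psi> \<Sigma> +>\<^bsub>D_ring \<Sigma>\<^esub> p)) = face.cycle_of p" for p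
  proof -
    have "face.cycle_of ` (Psi_ideal \<Psi> \<Sigma> +>\<^bsub>D_ring \<Sigma>\<^esub> p) = {face.cycle_of p}"
      using poly_ring_ideal(1)[OF unital_subring_Lam ideal_Psi[unfolded D_ring_def]]
      by (auto simp: a_r_coset_def' D_simps face.cycle_of_add cycle_of_Psi image_iff intro!: bexI[of _ 0])
    then show ?thesis by simp
  qed
  then show ?thesis by (intro bexI[OF _ iso]) blast
qed

subsection \<open>The action determines the product\<close>

lemma weil_eq: "weil \<Sigma> d = (\<Sum>\<rho>\<in>rays \<Sigma>. smul (Cst (val d \<rho>)) (face_cycle {\<rho>}))"
  unfolding weil_def by (intro sum.cong refl) (simp add: face_cycle_ray)

lemma weil_ray_div: "\<rho> \<in> rays \<Sigma> \<Longrightarrow> weil \<Sigma> (ray_div \<rho>) = V \<rho>"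
proof -
  assume \<rho>: "\<rho> \<in> rays \<Sigma>"
  have "weil \<Sigma> (ray_div \<rho>) = (\<Sum>\<rho>'\<in>rays \<Sigma>. if \<rho>' = \<rho> then V \<rho>' else 0)"
    unfolding weil_def by (intro sum.cong refl) (simp add: ray_div)
  then show ?thesis using \<rho> finite_rays by simp
qed

lemma face_prod_sum: "face.face_prod (sum g I) z = (\<Sum>x\<in>I. face.face_prod (g x) z)"
  using face.face_prod_add[of 0 0 z]
  by (induction I rule: infinite_finite_induct) (auto simp: face.face_prod_add)

lemma face_prod_weil:
  assumes "d \<in> Div \<Sigma>" "z \<in> cycles \<Sigma>"
  shows "face.face_prod (weil \<Sigma> d) z = act \<Psi> \<Sigma> d z"
  using assms
  by (simp add: weil_eq face_prod_sum face.face_prod_scale face.face_prod_D_singleton D_span_eq_cycles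
      act_expand cong: sum.cong)

lemma induced_face_prod: "induced_product \<Psi> \<Sigma> face.face_prod"
  unfolding induced_product_def
proof (intro conjI ballI)
  show "algebra Lam Cyc" by (rule algebra_Cyc)
  show "face.face_prod (weilT \<Sigma> E) z = actT \<Psi> \<Sigma> E z" if "E \<in> DivT \<Sigma>" "z \<in> cycles \<Sigma>" for E z
    unfolding weilT_def actT_def face_prod_sum face.face_prod_scale
    using that by (intro sum.cong refl) (simp add: face_prod_weil DivT_def)
  show "\<exists>d\<in>Div \<Sigma>. weil \<Sigma> d = V \<rho> \<and> (\<forall>z\<in>cycles \<Sigma>. face.face_prod (V \<rho>) z = act \<Psi> \<Sigma> d z)"
    if "\<rho> \<in> rays \<Sigma>" for \<rho>
    using weil_ray_div[OF that] face_prod_weil[OF ray_div(1)] ray_div(1) by (metis)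
qed

text \<open>
  Multiplication by \<open>V \<rho>\<close> is prescribed, and \<open>face_cycle (insert \<rho> S)\<close> is the product of \<open>V \<rho>\<close> and
  \<open>face_cycle S\<close>; so associativity fixes multiplication by every \<open>face_cycle S\<close>, and bilinearity the rest.
\<close>

lemma induced_product_unique:
  assumes g: "induced_product \<Psi> \<Sigma> g" and y: "y \<in> cycles \<Sigma>" and z: "z \<in> cycles \<Sigma>"
  shows "g y z = face.face_prod y z"
proof -
  interpret g: algebra Lam "cycle_ring \<Sigma> g" using g by (simp add: induced_product_def)
  have ray: "g (V \<rho>) x = A \<rho> x" if "\<rho> \<in> rays \<Sigma>" "x \<in> cycles \<Sigma>" for \<rho> x
  proof -
    define E where "E = Poly_Mapping.single (ray_div \<rho>) (1 :: 'v lam)"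
    have "E \<in> DivT \<Sigma>"
      using ray_div(1) subring_one[OF unital_subring_Lam] by (simp add: DivT_def E_def)
    then have "g (weilT \<Sigma> E) x = actT \<Psi> \<Sigma> E x"
      using g that(2) by (simp add: induced_product_def)
    then show ?thesis by (simp add: weilT_def actT_def E_def weil_ray_div that(1))
  qed
  have cyc: "face_cycle S \<in> cycles \<Sigma>" for S using face.D_in_D_span by (simp add: D_span_eq_cycles)
  have face: "g (face_cycle S) z = face.face_prod (face_cycle S) z"
    if "S \<in> faces" for S
  proof -
    have "finite S" using that by (rule face.finite_face)
    then show ?thesis using that
    proof (induction S rule: finite_induct)
      case empty
      show ?case using g.l_one[of z] z face.face_prod_D_empty[of z]
        by (simp add: face_cycle_empty D_span_eq_cycles)
    next
      case (insert \<rho> S)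
      have S: "S \<in> faces" using face_down[OF insert.prems] by blast
      have \<rho>: "\<rho> \<in> rays \<Sigma>" using faceD(1)[OF insert.prems] by blast
      have V: "V \<rho> \<in> cycles \<Sigma>" using cyc[of "{\<rho>}"] face_cycle_ray[OF \<rho>] by simp
      have fV: "face.face_prod (V \<rho>) x = A \<rho> x" if "x \<in> cycles \<Sigma>" for x
        using face.face_prod_D_singleton[OF \<rho>] that by (simp add: face_cycle_ray \<rho> D_span_eq_cycles)
      note fcyc = face.face_prod_in_D_span[unfolded D_span_eq_cycles]
      have "g (face_cycle (insert \<rho> S)) z = g (g (V \<rho>) (face_cycle S)) z"
        using insert.hyps(2) by (simp add: ray \<rho> cyc A_face_cycle S)
      also have "\<dots> = g (V \<rho>) (g (face_cycle S) z)"
        using g.m_assoc[of "V \<rho>" "face_cycle S" z] V cyc z by simp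
      also have "\<dots> = face.face_prod (V \<rho>) (face.face_prod (face_cycle S) z)"
        using insert.IH[OF S] by (simp add: ray \<rho> fV fcyc cyc z)
      also have "\<dots> = face.face_prod (face.face_prod (V \<rho>) (face_cycle S)) z"
        using face.face_prod_assoc[unfolded D_span_eq_cycles] V cyc z by simp
      also have "\<dots> = face.face_prod (face_cycle (insert \<rho> S)) z"
        using insert.hyps(2) by (simp add: fV \<rho> cyc A_face_cycle S)
      finally show ?case .
    qed
  qed
  have C: "face_coord y S \<in> carrier Lam" if "S \<in> faces" for S
    using y that by (simp add: D_span_eq_cycles[symmetric] face.D_span_def)
  have "g (\<Sum>S\<in>F. smul (face_coord y S) (face_cycle S)) z =
      face.face_prod (\<Sum>S\<in>F. smul (face_coord y S) (face_cycle S)) z \<and>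
      (\<Sum>S\<in>F. smul (face_coord y S) (face_cycle S)) \<in> cycles \<Sigma>" if "finite F" "F \<subseteq> faces" for F
    using that
  proof (induction F rule: finite_induct)
    case empty
    show ?case using g.l_null[of z] z face.face_prod_add[of 0 0 z] face.D_span_zero by (simp add: D_span_eq_cycles)
  next
    case (insert S F)
    let ?s = "\<Sum>S\<in>F. smul (face_coord y S) (face_cycle S)"
    have S: "S \<in> faces" and IH: "g ?s z = face.face_prod ?s z" "?s \<in> cycles \<Sigma>" using insert by auto
    have t: "smul (face_coord y S) (face_cycle S) \<in> cycles \<Sigma>"
      using face.D_span_scale[OF C[OF S] face.D_in_D_span] by (simp add: D_span_eq_cycles)
    have "g (smul (face_coord y S) (face_cycle S) + ?s) z =
        g (smul (face_coord y S) (face_cycle S)) z + g ?s z"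
      using g.l_distr[of "smul (face_coord y S) (face_cycle S)" ?s z] t IH(2) z by simp
    also have "g (smul (face_coord y S) (face_cycle S)) z = smul (face_coord y S) (g (face_cycle S) z)"
      using g.smult_assoc2[OF C[OF S], of "face_cycle S" z] cyc z by simp
    finally show ?case
      using insert.hyps face.D_span_add[unfolded D_span_eq_cycles, OF t IH(2)]
      by (simp add: face[OF S] IH(1) face.face_prod_add face.face_prod_scale)
  qed
  from this[OF face.finite_K order_refl] show ?thesis
    using y by (simp add: D_span_eq_cycles[symmetric] face.D_span_def)
qed

end

theorem theorem2:
  fixes \<Sigma> :: "'v::rat_lattice set set"
    and \<L> :: "'v set set"
    and \<Psi> :: "'v set \<Rightarrow> 'v set \<Rightarrow> ('v \<Rightarrow> rat) \<Rightarrow> ('v \<Rightarrow> rat)"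
  assumes "simplicial_fan \<Sigma>"
    and "complement_map \<L> \<Psi>"
    and "generic_fan \<L> \<Sigma>"
  shows "\<exists>f. induced_product \<Psi> \<Sigma> f
           \<and> (\<forall>g. induced_product \<Psi> \<Sigma> g \<longrightarrow> (\<forall>y\<in>cycles \<Sigma>. \<forall>z\<in>cycles \<Sigma>. g y z = f y z))
           \<and> to_AT \<Sigma> \<in> ring_hom (cycle_ring \<Sigma> f) (AT_ring \<Sigma>)
           \<and> to_AT \<Sigma> ` cycles \<Sigma> = carrier (AT_ring \<Sigma>)
           \<and> (\<exists>\<phi> \<in> ring_iso (D_ring \<Sigma> Quot Psi_ideal \<Psi> \<Sigma>) (cycle_ring \<Sigma> f).
                (\<forall>\<rho>\<in>rays \<Sigma>. \<phi> (Psi_ideal \<Psi> \<Sigma> +>\<^bsub>D_ring \<Sigma>\<^esub> Var \<rho>) = V \<rho>) \<and>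
                (\<forall>l\<in>carrier Lam. \<forall>p\<in>carrier (D_ring \<Sigma>).
                   \<phi> (Psi_ideal \<Psi> \<Sigma> +>\<^bsub>D_ring \<Sigma>\<^esub> (Cst l * p))
                     = smul l (\<phi> (Psi_ideal \<Psi> \<Sigma> +>\<^bsub>D_ring \<Sigma>\<^esub> p))))"
proof -
  interpret generic_simplicial \<Sigma> \<L> \<Psi>
    using assms by (intro generic_simplicial.intro simplicial.intro generic_simplicial_axioms.intro)
  obtain \<phi> where \<phi>: "\<phi> \<in> ring_iso (D_ring \<Sigma> Quot Psi_ideal \<Psi> \<Sigma>) Cyc"
    and cycle_of: "\<And>p. p \<in> carrier (D_ring \<Sigma>) \<Longrightarrow> \<phi> (Psi_ideal \<Psi> \<Sigma> +>\<^bsub>D_ring \<Sigma>\<^esub> p) = face.cycle_of p"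
    using presentation by blast
  have "\<phi> (Psi_ideal \<Psi> \<Sigma> +>\<^bsub>D_ring \<Sigma>\<^esub> Var \<rho>) = V \<rho>" if \<rho>: "\<rho> \<in> rays \<Sigma>" for \<rho>
    using face.cycle_of_prod_Var[of "{\<rho>}"] \<rho> cycle_of[of "Var \<rho>"] Var_in_poly_ring[OF unital_subring_Lam \<rho>]
    by (simp add: D_ring_def face_cycle_ray)
  moreover have "\<phi> (Psi_ideal \<Psi> \<Sigma> +>\<^bsub>D_ring \<Sigma>\<^esub> (Cst l * p)) =
      smul l (\<phi> (Psi_ideal \<Psi> \<Sigma> +>\<^bsub>D_ring \<Sigma>\<^esub> p))"
    if "l \<in> carrier Lam" "p \<in> carrier (D_ring \<Sigma>)" for l p
  proof -
    have "Cst l * p \<in> carrier (D_ring \<Sigma>)"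
      using that unfolding D_ring_def
      by (intro subring_mult[OF unital_subring_poly_ring[OF unital_subring_Lam]]
          Cst_in_poly_ring[OF unital_subring_Lam])
    then show ?thesis using that(2) by (simp add: cycle_of face.cycle_of_Cst_mult)
  qed
  ultimately show ?thesis
    using induced_face_prod induced_product_unique to_AT_hom to_AT_surj \<phi> by blast
qed

end
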